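(* Let $\phi^\sigma$ be a continuous flow on a compact Hausdorff space $X$. Let $\Sigma$ be a closed subset of $X\times X$ with $\Delta\subset\Sigma$, and let $W\colon(X\times X)\setminus\Sigma\to\mathbb{Z}$ and $\pi\colon X\to\pi(X)\subset\mathbb{R}^2$ be mappings satisfying Axioms (A1)-(A5) listed in the context. Let $u\in X$. Then for $\omega(u)$ we have the following dichotomy: (i) either $\omega(u)$ consists of precisely one periodic orbit, or else (ii) $\alpha(w)\subseteq E$ and $\omega(w)\subseteq E$ for every $w\in\omega(u)$. The same dichotomy holds for $\alpha(u)$ (that is, with $\omega(u)$ replaced by $\alpha(u)$ in (i) and (ii)).
   Context: A continuous flow on $X$ is a continuous map $\mathbb{R}\times X\to X$, $(\sigma,u)\mapsto\phi^\sigma(u)$, with $\phi^0=\mathrm{id}$ and $\phi^{\sigma+\sigma'}=\phi^\sigma\circ\phi^{\sigma'}$. $\Delta=\{(u^1,u^2)\in X\times X:u^1=u^2\}$ is the diagonal. The axioms are: (A1) $W\colon(X\times X)\setminus\Sigma\to\mathbb{Z}$ is continuous and symmetric, i.e. $W(u^1,u^2)=W(u^2,u^1)$; (A2) $\pi\colon X\to\pi(X)\subset\mathbb{R}^2$ is a continuous map onto its (compact) image; (A3) $\{(u^1,u^2)\in X\times X:\pi(u^1)=\pi(u^2)\}\subset\Sigma$; (A4) for every $(u^1,u^2)\in\Sigma\setminus\Delta$ there is $\varepsilon_0>0$, depending on $(u^1,u^2)$, such that $(\phi^\sigma(u^1),\phi^\sigma(u^2))\notin\Sigma$ for all $\sigma\in(-\varepsilon_0,\varepsilon_0)\setminus\{0\}$;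 (A5) for every $(u^1,u^2)\in\Sigma\setminus\Delta$ there is $\varepsilon_0>0$, depending on $(u^1,u^2)$ (and small enough that the values below are defined, by (A4)), such that $W(\phi^\sigma(u^1),\phi^\sigma(u^2))>W(\phi^{\sigma'}(u^1),\phi^{\sigma'}(u^2))$ for all $\sigma\in(-\varepsilon_0,0)$ and all $\sigma'\in(0,\varepsilon_0)$. $\omega(u)=\{w\in X:\phi^{\sigma_n}(u)\to w\text{ for some }\sigma_n\to\infty\}$ and $\alpha(u)=\{w\in X:\phi^{\sigma_n}(u)\to w\text{ for some }\sigma_n\to-\infty\}$; these are taken to be non-empty, compact, connected, invariant sets. $E=\{u\in X:\phi^\sigma(u)=u\ \forall\sigma\in\mathbb{R}\}$ is the set of equilibria. $\gamma(u)=\{\phi^\sigma(u):\sigma\in\mathbb{R}\}$ is the orbit of $u$; it is a periodic orbit if $u\notin E$ and $\phi^T(u)=u$ for some $T>0$. *)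

theory Defs
  imports "HOL-Analysis.Analysis"
begin

definition continuous_flow :: "(real \<Rightarrow> 'a::topological_space \<Rightarrow> 'a) \<Rightarrow> bool" where
  "continuous_flow \<phi> \<longleftrightarrow>
     continuous_on UNIV (\<lambda>(s, u). \<phi> s u) \<and>
     \<phi> 0 = id \<and>
     (\<forall>s t. \<phi> (s + t) = \<phi> s \<circ> \<phi> t)"

definition equilibria :: "(real \<Rightarrow> 'a \<Rightarrow> 'a) \<Rightarrow> 'a set" where
  "equilibria \<phi> = {u. \<forall>s. \<phi> s u = u}"

definition orbit :: "(real \<Rightarrow> 'a \<Rightarrow> 'a) \<Rightarrow> 'a \<Rightarrow> 'a set" where
  "orbit \<phi> u = range (\<lambda>s. \<phi> s u)"

definition periodic_orbit :: "(real \<Rightarrow> 'a \<Rightarrow> 'a) \<Rightarrow> 'a set \<Rightarrow> bool" where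
  "periodic_orbit \<phi> \<gamma> \<longleftrightarrow>
     (\<exists>u. \<gamma> = orbit \<phi> u \<and> u \<notin> equilibria \<phi> \<and> (\<exists>T>0. \<phi> T u = u))"

definition omega_limit :: "(real \<Rightarrow> 'a::topological_space \<Rightarrow> 'a) \<Rightarrow> 'a \<Rightarrow> 'a set" where
  "omega_limit \<phi> u =
     {w. \<exists>s::nat \<Rightarrow> real. filterlim s at_top sequentially \<and> (\<lambda>n. \<phi> (s n) u) \<longlonglongrightarrow> w}"

definition alpha_limit :: "(real \<Rightarrow> 'a::topological_space \<Rightarrow> 'a) \<Rightarrow> 'a \<Rightarrow> 'a set" where
  "alpha_limit \<phi> u =
     {w. \<exists>s::nat \<Rightarrow> real. filterlim s at_bot sequentially \<and> (\<lambda>n. \<phi> (s n) u) \<longlonglongrightarrow> w}"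

text \<open>
  In a compact Hausdorff space that is not metrizable, limit sets defined by sequences need not
  be non-empty, closed or connected. These standard properties of limit sets are therefore a
  standing assumption on the flow; they hold automatically if the space is metrizable.
\<close>

definition regular_limit_set :: "(real \<Rightarrow> 'a::topological_space \<Rightarrow> 'a) \<Rightarrow> 'a set \<Rightarrow> bool" where
  "regular_limit_set \<phi> L \<longleftrightarrow>
     L \<noteq> {} \<and> compact L \<and> connected L \<and> (\<forall>s. \<phi> s ` L = L)"

definition limits_in_equilibria :: "(real \<Rightarrow> 'a::topological_space \<Rightarrow> 'a) \<Rightarrow> 'a set \<Rightarrow> bool" where
  "limits_in_equilibria \<phi> L \<longleftrightarrow>
     (\<forall>w\<in>L. alpha_limit \<phi> w \<subseteq> equilibria \<phi> \<and> omega_limit \<phi> w \<subseteq> equilibria \<phi>)"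

text \<open>
  The map \<open>W\<close> is only meaningful off \<open>S\<close>; its values on \<open>S\<close> are
  never used. Symmetry of \<open>W\<close> as a partial map includes that its domain is symmetric.
  In the last axiom the clause on \<open>S\<close> says that all the values of \<open>W\<close> which
  are compared are defined.
\<close>

definition axiom_A1 :: "('a::topological_space \<times> 'a) set \<Rightarrow> ('a \<times> 'a \<Rightarrow> int) \<Rightarrow> bool" where
  "axiom_A1 S W \<longleftrightarrow>
     continuous_on (- S) W \<and>
     (\<forall>u1 u2. (u1, u2) \<notin> S \<longrightarrow> (u2, u1) \<notin> S \<and> W (u1, u2) = W (u2, u1))"

definition axiom_A2 :: "('a::topological_space \<Rightarrow> real ^ 2) \<Rightarrow> bool" where
  "axiom_A2 \<pi> \<longleftrightarrow> continuous_on UNIV \<pi>"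

definition axiom_A3 :: "('a \<times> 'a) set \<Rightarrow> ('a \<Rightarrow> real ^ 2) \<Rightarrow> bool" where
  "axiom_A3 S \<pi> \<longleftrightarrow> {(u1, u2). \<pi> u1 = \<pi> u2} \<subseteq> S"

definition axiom_A4 :: "(real \<Rightarrow> 'a \<Rightarrow> 'a) \<Rightarrow> ('a \<times> 'a) set \<Rightarrow> bool" where
  "axiom_A4 \<phi> S \<longleftrightarrow>
     (\<forall>(u1, u2) \<in> S - Id. \<exists>\<epsilon>>0. \<forall>s \<in> {-\<epsilon><..<\<epsilon>} - {0}. (\<phi> s u1, \<phi> s u2) \<notin> S)"

definition axiom_A5 ::
    "(real \<Rightarrow> 'a \<Rightarrow> 'a) \<Rightarrow> ('a \<times> 'a) set \<Rightarrow> ('a \<times> 'a \<Rightarrow> int) \<Rightarrow> bool" where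
  "axiom_A5 \<phi> S W \<longleftrightarrow>
     (\<forall>(u1, u2) \<in> S - Id. \<exists>\<epsilon>>0.
        (\<forall>s \<in> {-\<epsilon><..<\<epsilon>} - {0}. (\<phi> s u1, \<phi> s u2) \<notin> S) \<and>
        (\<forall>s \<in> {-\<epsilon><..<0}. \<forall>t \<in> {0<..<\<epsilon>}.
           W (\<phi> s u1, \<phi> s u2) > W (\<phi> t u1, \<phi> t u2)))"

end

theory Submission
  imports Defs "HOL-Complex_Analysis.Complex_Analysis"
begin

text \<open>
  Along a pair of distinct orbits \<open>W\<close> never increases, and it drops at each visit to \<open>\<Sigma>\<close>. A visit by a
  limit pair would be shadowed infinitely often, so limit pairs of one pair of orbits avoid \<open>\<Sigma>\<close>; in
  particular \<open>\<pi>\<close> is injective on the closure of the orbit of every \<open>w\<close> in the limit set \<open>\<Omega>\<close> of \<open>u\<close>. If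
  \<open>w\<close> is neither periodic nor recurrent in backward time, then \<open>W\<close> takes a single value \<open>k\<close> on this closure and
  is at least \<open>k\<close> on all pairs of points of the orbits of \<open>u\<close> and \<open>w\<close>. As \<open>u\<close> starts arbitrarily close to \<open>w\<close>,
  where \<open>W\<close> already equals \<open>k\<close> against the whole past of \<open>w\<close>, no drop is left: the projected orbit of \<open>u\<close>
  eventually misses every given piece of the projected orbit of \<open>w\<close>.

  Suppose such a \<open>w\<close> has a non-equilibrium \<open>q\<close> in one of its limit sets. The orbit of \<open>w\<close> passes
  near \<open>q\<close> at least three times, along disjoint arcs through a thin strip; two of these passages bound a
  box that the third one, the \<open>k\<close>-th say, crosses. Consider the winding number around the projection of \<open>u(t)\<close>
  of the loop made of the arc of \<open>w\<close> between the two outer passages and a chord. It changes only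
  when \<open>u\<close> crosses the box, always in the same direction, and it does change when \<open>u\<close> shadows the \<open>k\<close>-th
  passage. But \<open>u\<close> shadows \<open>w\<close> infinitely often, which returns the winding number to its initial value.
  Hence \<open>w\<close> is periodic. (If \<open>w\<close> is recurrent in backward time, the same argument applies to the reversed
  flow with \<open>u = w = q\<close>.)

  Finally let \<open>\<Gamma>\<close> be a periodic orbit in \<open>\<Omega>\<close> with \<open>\<Gamma> \<noteq> \<Omega>\<close>. Last exits of \<open>u\<close> from thin neighbourhoods of
  \<open>\<Gamma>\<close> produce points of \<open>\<Omega>\<close> whose backward orbits stay near \<open>\<Gamma>\<close>; by the above they are
  periodic. The projection of \<open>u\<close> eventually stays on one side of each periodic orbit in \<open>\<Omega>\<close>, which is
  impossible for two nearby ones.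
\<close>

section \<open>Cluster sets of curves\<close>

text \<open>Unlike sequential limit sets, these are never empty on a compact space, metrizable or not.\<close>

definition cluster_set :: "(real \<Rightarrow> 'b::topological_space) \<Rightarrow> 'b set" where
  "cluster_set f = (\<Inter>N. closure (f ` {N..}))"

lemma mem_cluster_set_iff:
  "p \<in> cluster_set f \<longleftrightarrow> (\<forall>U. open U \<longrightarrow> p \<in> U \<longrightarrow> (\<forall>N. \<exists>s\<ge>N. f s \<in> U))"
proof -
  have "p \<in> closure A \<longleftrightarrow> (\<forall>U. open U \<longrightarrow> p \<in> U \<longrightarrow> U \<inter> A \<noteq> {})" for A
    using closure_iff_nhds_not_empty[of p A] by blast
  then have "p \<in> cluster_set f \<longleftrightarrow> (\<forall>N U. open U \<longrightarrow> p \<in> U \<longrightarrow> U \<inter> f ` {N..} \<noteq> {})"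
    by (simp add: cluster_set_def)
  also have "\<dots> \<longleftrightarrow> (\<forall>U. open U \<longrightarrow> p \<in> U \<longrightarrow> (\<forall>N. \<exists>s\<ge>N. f s \<in> U))"
    by (fastforce simp: disjoint_iff)
  finally show ?thesis .
qed

lemma cluster_setD:
  assumes "p \<in> cluster_set f" "open U" "p \<in> U"
  shows "\<exists>s\<ge>N. f s \<in> U"
  using assms mem_cluster_set_iff[of p f] by blast

lemma closed_cluster_set: "closed (cluster_set f)"
  unfolding cluster_set_def by (intro closed_INT) simp

lemma cluster_set_subset_closed:
  assumes "closed C" "\<And>s. s \<ge> N \<Longrightarrow> f s \<in> C"
  shows "cluster_set f \<subseteq> C"
proof -
  have "closure (f ` {N..}) \<subseteq> C"
    using assms by (intro closure_minimal) auto
  then show ?thesis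
    by (auto simp: cluster_set_def)
qed

text \<open>This is the finite intersection property: by monotonicity a finite intersection contains
  the member with the largest index. Inserting \<open>0\<close> makes the maximum meaningful for an
  empty index set.\<close>

lemma Inter_antimono_closed_nonempty:
  fixes F :: "real \<Rightarrow> 'b::topological_space set"
  assumes "compact (UNIV :: 'b set)" "\<And>N. closed (F N)" "\<And>N. F N \<noteq> {}"
    and anti: "\<And>M N. M \<le> N \<Longrightarrow> F N \<subseteq> F M"
  shows "(\<Inter>N. F N) \<noteq> {}"
proof -
  have "UNIV \<inter> (\<Inter>N\<in>UNIV. F N) \<noteq> {}"
  proof (rule compact_imp_fip_image)
    fix I :: "real set" assume I: "finite I"
    have "F (Max (insert 0 I)) \<subseteq> F N" if "N \<in> I" for N
      using I that by (intro anti) simp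
    then show "UNIV \<inter> (\<Inter>i\<in>I. F i) \<noteq> {}"
      using assms(3)[of "Max (insert 0 I)"] by blast
  qed (use assms in auto)
  then show ?thesis by simp
qed

lemma cluster_set_nonempty:
  fixes f :: "real \<Rightarrow> 'b::topological_space"
  assumes "compact (UNIV :: 'b set)"
  shows "cluster_set f \<noteq> {}"
  unfolding cluster_set_def using assms
  by (intro Inter_antimono_closed_nonempty) (auto intro!: closure_mono image_mono)

text \<open>Otherwise the closed tails minus \<open>U\<close> would form a decreasing family of
  nonempty closed sets, and by compactness they would share a cluster point outside
  \<open>U\<close>.\<close>

lemma eventually_in_nbhd_cluster_set:
  fixes f :: "real \<Rightarrow> 'b::topological_space"
  assumes comp: "compact (UNIV :: 'b set)" and U: "open U" "cluster_set f \<subseteq> U"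
  shows "\<exists>N. \<forall>s\<ge>N. f s \<in> U"
proof (rule ccontr)
  assume *: "\<not> (\<exists>N. \<forall>s\<ge>N. f s \<in> U)"
  have "(\<Inter>N. closure (f ` {N..}) - U) \<noteq> {}"
  proof (rule Inter_antimono_closed_nonempty[OF comp])
    show "closed (closure (f ` {N..}) - U)" for N
      using U by (intro closed_Diff) auto
    show "closure (f ` {N..}) - U \<noteq> {}" for N
      using * closure_subset[of "f ` {N..}"] by blast
    show "closure (f ` {N..}) - U \<subseteq> closure (f ` {M..}) - U" if "M \<le> N" for M N
      using that by (intro Diff_mono closure_mono image_mono) auto
  qed
  then show False
    using U by (auto simp: cluster_set_def)
qed

text \<open>The projection of a compact set is closed, so each closed tail of the pair has a point
  above \<open>p\<close>; compactness gives one common to all tails. This takes the place of passing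
  to a subsequence.\<close>

lemma cluster_set_Pair:
  fixes f :: "real \<Rightarrow> 'a::t2_space" and g :: "real \<Rightarrow> 'b::t2_space"
  assumes "compact (UNIV :: 'a set)" "compact (UNIV :: 'b set)" "p \<in> cluster_set f"
  shows "\<exists>q. (p, q) \<in> cluster_set (\<lambda>s. (f s, g s))"
proof -
  let ?h = "\<lambda>s. (f s, g s)"
  have comp: "compact (UNIV :: ('a \<times> 'b) set)"
    using compact_Times[OF assms(1,2)] by simp
  have "(\<Inter>N. closure (?h ` {N..}) \<inter> {p} \<times> UNIV) \<noteq> {}"
  proof (rule Inter_antimono_closed_nonempty[OF comp])
    show "closed (closure (?h ` {N..}) \<inter> {p} \<times> UNIV)" for N
      by (intro closed_Int closed_Times) auto
    show "closure (?h ` {N..}) \<inter> {p} \<times> UNIV \<noteq> {}" for N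
    proof -
      have "compact (closure (?h ` {N..}))"
        using comp compact_Int_closed[of UNIV "closure (?h ` {N..})"] by simp
      then have "compact (fst ` closure (?h ` {N..}))"
        by (rule compact_continuous_image[rotated]) (intro continuous_intros)
      then have "closed (fst ` closure (?h ` {N..}))"
        by (rule compact_imp_closed)
      moreover have "f ` {N..} \<subseteq> fst ` closure (?h ` {N..})"
        using closure_subset[of "?h ` {N..}"] by force
      ultimately have "closure (f ` {N..}) \<subseteq> fst ` closure (?h ` {N..})"
        by (intro closure_minimal)
      moreover have "p \<in> closure (f ` {N..})"
        using assms(3) by (simp add: cluster_set_def)
      ultimately show ?thesis by force
    qed
    show "closure (?h ` {N..}) \<inter> {p} \<times> UNIV \<subseteq> closure (?h ` {M..}) \<inter> {p} \<times> UNIV" if "M \<le> N" for M N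
      using that by (intro Int_mono closure_mono image_mono) auto
  qed
  then show ?thesis
    by (auto simp: cluster_set_def)
qed

lemma int_valued_constant_on_real:
  fixes g :: "real \<Rightarrow> int"
  assumes "continuous_on T g" "connected T" "s \<in> T" "t \<in> T"
  shows "g s = g t"
proof -
  have c: "connected (g ` T)"
    using assms by (intro connected_continuous_image)
  have "g ` T \<inter> {g s} = {} \<or> g ` T \<inter> - {g s} = {}"
    using connectedD[OF c, of "{g s}" "- {g s}"] open_discrete by auto
  moreover have "g s \<in> g ` T" "g t \<in> g ` T"
    using assms(3,4) by auto
  ultimately show ?thesis by auto
qed

section \<open>Continuous flows on compact spaces\<close>

lemma omega_limit_subset_cluster_set: "omega_limit \<phi> u \<subseteq> cluster_set (\<lambda>s. \<phi> s u)"
proof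
  fix w assume "w \<in> omega_limit \<phi> u"
  then obtain s :: "nat \<Rightarrow> real" where s: "filterlim s at_top sequentially"
    and lim: "(\<lambda>n. \<phi> (s n) u) \<longlonglongrightarrow> w"
    by (auto simp: omega_limit_def)
  have "\<exists>r\<ge>N. \<phi> r u \<in> U" if "open U" "w \<in> U" for U N
  proof -
    have "\<forall>\<^sub>F n in sequentially. s n \<ge> N \<and> \<phi> (s n) u \<in> U"
      using s topological_tendstoD[OF lim that] by (auto simp: filterlim_at_top intro: eventually_conj)
    then show ?thesis
      using eventually_happens by fastforce
  qed
  then show "w \<in> cluster_set (\<lambda>s. \<phi> s u)"
    by (simp add: mem_cluster_set_iff)
qed

lemma alpha_limit_eq: "alpha_limit \<phi> u = omega_limit (\<lambda>s. \<phi> (- s)) u"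
proof -
  have "(\<exists>s::nat \<Rightarrow> real. filterlim s at_bot sequentially \<and> (\<lambda>n. \<phi> (s n) u) \<longlonglongrightarrow> w) \<longleftrightarrow>
        (\<exists>s::nat \<Rightarrow> real. filterlim s at_top sequentially \<and> (\<lambda>n. \<phi> (- s n) u) \<longlonglongrightarrow> w)" for w
  proof safe
    fix s :: "nat \<Rightarrow> real"
    assume "filterlim s at_bot sequentially" "(\<lambda>n. \<phi> (s n) u) \<longlonglongrightarrow> w"
    then show "\<exists>s::nat \<Rightarrow> real. filterlim s at_top sequentially \<and> (\<lambda>n. \<phi> (- s n) u) \<longlonglongrightarrow> w"
      by (intro exI[of _ "\<lambda>n. - s n"]) (simp flip: filterlim_uminus_at_bot)
  next
    fix s :: "nat \<Rightarrow> real"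
    assume "filterlim s at_top sequentially" "(\<lambda>n. \<phi> (- s n) u) \<longlonglongrightarrow> w"
    then show "\<exists>s::nat \<Rightarrow> real. filterlim s at_bot sequentially \<and> (\<lambda>n. \<phi> (s n) u) \<longlonglongrightarrow> w"
      by (intro exI[of _ "\<lambda>n. - s n"]) (simp flip: filterlim_uminus_at_top)
  qed
  then show ?thesis
    by (simp add: alpha_limit_def omega_limit_def)
qed

locale compact_flow =
  fixes \<phi> :: "real \<Rightarrow> 'a::t2_space \<Rightarrow> 'a"
  assumes compact_UNIV: "compact (UNIV :: 'a set)"
    and flow: "continuous_flow \<phi>"
begin

lemma flow_0 [simp]: "\<phi> 0 x = x"
  using flow by (simp add: continuous_flow_def)

lemma flow_flow [simp]: "\<phi> s (\<phi> t x) = \<phi> (s + t) x"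
  using flow by (simp add: continuous_flow_def)

lemma flow_inj [simp]: "\<phi> s x = \<phi> s y \<longleftrightarrow> x = y"
proof
  assume "\<phi> s x = \<phi> s y"
  then have "\<phi> (- s) (\<phi> s x) = \<phi> (- s) (\<phi> s y)"
    by simp
  then show "x = y" by simp
qed simp

lemma continuous_on_flow [continuous_intros]:
  assumes "continuous_on A f" "continuous_on A g"
  shows "continuous_on A (\<lambda>z. \<phi> (f z) (g z))"
proof -
  have "continuous_on A (\<lambda>z. (\<lambda>(s, u). \<phi> s u) (f z, g z))"
    by (rule continuous_on_compose2[of UNIV "\<lambda>(s, u). \<phi> s u"])
       (use flow assms in \<open>auto simp: continuous_flow_def intro!: continuous_intros\<close>)
  then show ?thesis by simp
qed

lemma compact_closed: "closed C \<Longrightarrow> compact (C :: 'a set)"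
  using compact_Int_closed[OF compact_UNIV, of C] by simp

lemma reverse: "compact_flow (\<lambda>s. \<phi> (- s))"
proof
  show "continuous_flow (\<lambda>s. \<phi> (- s))"
    unfolding continuous_flow_def
  proof (intro conjI allI)
    show "continuous_on UNIV (\<lambda>(s, u). \<phi> (- s) u)"
      by (auto simp: case_prod_unfold intro!: continuous_intros)
    show "\<phi> (- 0) = id"
      by auto
    show "\<phi> (- (s + t)) = \<phi> (- s) \<circ> \<phi> (- t)" for s t
      by (auto simp: add.commute)
  qed
qed (rule compact_UNIV)

section \<open>Limit sets and orbit closures of a flow\<close>

abbreviation \<Omega> :: "'a \<Rightarrow> 'a set" where
  "\<Omega> x \<equiv> cluster_set (\<lambda>s. \<phi> s x)"

lemma open_vimage_flow: "open U \<Longrightarrow> open {x. \<phi> t x \<in> U}"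
  using open_vimage[of U "\<phi> t"] continuous_on_flow[of UNIV "\<lambda>_. t" "\<lambda>x. x"]
  by (simp add: vimage_def)

lemma flow_cluster_set:
  assumes "w \<in> \<Omega> u"
  shows "\<phi> t w \<in> \<Omega> u"
  unfolding mem_cluster_set_iff
proof (intro allI impI)
  fix U N assume U: "open U" "\<phi> t w \<in> U"
  obtain s where "s \<ge> N - t" "\<phi> s u \<in> {x. \<phi> t x \<in> U}"
    using cluster_setD[OF assms open_vimage_flow[OF U(1)], of t "N - t"] U(2) by auto
  then show "\<exists>s\<ge>N. \<phi> s u \<in> U"
    by (intro exI[of _ "t + s"]) auto
qed

lemma orbit_subset_cluster_set: "w \<in> \<Omega> u \<Longrightarrow> orbit \<phi> w \<subseteq> \<Omega> u"
  by (auto simp: orbit_def flow_cluster_set)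

lemma closure_orbit_subset_cluster_set: "w \<in> \<Omega> u \<Longrightarrow> closure (orbit \<phi> w) \<subseteq> \<Omega> u"
  by (intro closure_minimal orbit_subset_cluster_set closed_cluster_set)

lemma cluster_set_subset_closure_orbit: "\<Omega> w \<subseteq> closure (orbit \<phi> w)"
proof (rule cluster_set_subset_closed)
  show "\<phi> s w \<in> closure (orbit \<phi> w)" for s
    using closure_subset[of "orbit \<phi> w"] by (auto simp: orbit_def)
qed simp

lemma flow_closure_orbit:
  assumes "x \<in> closure (orbit \<phi> w)"
  shows "\<phi> t x \<in> closure (orbit \<phi> w)"
proof -
  have "\<phi> t ` closure (orbit \<phi> w) \<subseteq> closure (orbit \<phi> w)"
  proof (rule image_closure_subset)
    show "continuous_on (closure (orbit \<phi> w)) (\<phi> t)"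
      by (intro continuous_intros)
    show "\<phi> t ` orbit \<phi> w \<subseteq> closure (orbit \<phi> w)"
      using closure_subset[of "orbit \<phi> w"] by (auto simp: orbit_def)
  qed simp
  then show ?thesis using assms by blast
qed

lemma closed_equilibria: "closed (equilibria \<phi>)"
proof -
  have "equilibria \<phi> = (\<Inter>s. {x. \<phi> s x = x})"
    by (auto simp: equilibria_def)
  then show ?thesis
    by (auto intro!: closed_INT closed_Collect_eq continuous_intros)
qed

text \<open>Multiples of arbitrarily small periods come arbitrarily close to every time, so by
  continuity such periods would fix \<open>q\<close> at all times.\<close>

lemma no_small_periods:
  assumes "q \<notin> equilibria \<phi>"
  shows "\<exists>d>0. \<forall>t. 0 < \<bar>t\<bar> \<and> \<bar>t\<bar> < d \<longrightarrow> \<phi> t q \<noteq> q"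
proof (rule ccontr)
  assume neg: "\<not> ?thesis"
  have "\<phi> s q = q" for s
  proof (rule ccontr)
    assume ne: "\<phi> s q \<noteq> q"
    have "open {t. \<phi> t q \<noteq> q}"
      by (intro open_Collect_neq continuous_intros)
    then obtain e where e: "e > 0" "\<And>t. \<bar>t - s\<bar> < e \<Longrightarrow> \<phi> t q \<noteq> q"
      using ne unfolding open_dist dist_real_def by blast
    obtain t0 where t0: "0 < \<bar>t0\<bar>" "\<bar>t0\<bar> < e" "\<phi> t0 q = q"
      using neg e(1) by blast
    obtain t where t: "0 < t" "t < e" "\<phi> t q = q"
    proof (cases "t0 > 0")
      case False
      have "\<phi> (- t0) (\<phi> t0 q) = q" by simp
      then show ?thesis using that[of "- t0"] t0 False by simp
    qed (use that t0 in auto)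
    have nat: "\<phi> (real n * t) q = q" for n
    proof (induction n)
      case (Suc n)
      have "\<phi> (real (Suc n) * t) q = \<phi> t (\<phi> (real n * t) q)"
        by (simp add: algebra_simps)
      then show ?case using Suc t by simp
    qed simp
    have int: "\<phi> (real_of_int k * t) q = q" for k
    proof (cases "k \<ge> 0")
      case True
      then show ?thesis using nat[of "nat k"] by simp
    next
      case False
      have "\<phi> (real_of_int k * t) (\<phi> (real (nat (- k)) * t) q) = q"
        using False by (simp add: algebra_simps)
      then show ?thesis using nat[of "nat (- k)"] by simp
    qed
    have "\<bar>real_of_int \<lfloor>s / t\<rfloor> * t - s\<bar> < e"
    proof -
      have "real_of_int \<lfloor>s / t\<rfloor> * t \<le> s"
        using t by (metis of_int_floor_le pos_le_divide_eq)
      moreover have "s < (real_of_int \<lfloor>s / t\<rfloor> + 1) * t"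
        using t by (metis floor_divide_lower floor_divide_upper add.commute)
      ultimately show ?thesis using t by (simp add: algebra_simps)
    qed
    then show False using e(2) int by blast
  qed
  then show False using assms by (simp add: equilibria_def)
qed

lemma flow_period_nat:
  assumes "\<phi> T q = q"
  shows "\<phi> (real n * T) q = q"
proof (induction n)
  case (Suc n)
  have "\<phi> (real (Suc n) * T) q = \<phi> T (\<phi> (real n * T) q)"
    by (simp add: algebra_simps)
  then show ?case using Suc assms by simp
qed simp

text \<open>The set of periods in \<open>{d..T}\<close> is compact and has a least element; the
  bound \<open>d\<close> from \<open>no_small_periods\<close> keeps it away from zero.\<close>

lemma minimal_period:
  assumes "q \<notin> equilibria \<phi>" "T > 0" "\<phi> T q = q"
  obtains T0 where "T0 > 0" "\<phi> T0 q = q" "\<And>t. 0 < t \<Longrightarrow> t < T0 \<Longrightarrow> \<phi> t q \<noteq> q"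
proof -
  obtain d where d: "d > 0" "\<And>t. 0 < \<bar>t\<bar> \<Longrightarrow> \<bar>t\<bar> < d \<Longrightarrow> \<phi> t q \<noteq> q"
    using no_small_periods[OF assms(1)] by blast
  let ?A = "{t \<in> {d..T}. \<phi> t q = q}"
  have "T \<in> ?A" using assms d(2)[of T] by force
  moreover have "compact ?A"
  proof -
    have "closed {t. \<phi> t q = q}" by (intro closed_Collect_eq continuous_intros)
    then have "compact ({d..T} \<inter> {t. \<phi> t q = q})" by (intro compact_Int_closed) auto
    then show ?thesis by (simp add: Int_def)
  qed
  ultimately obtain T0 where T0: "T0 \<in> ?A" "\<And>t. t \<in> ?A \<Longrightarrow> T0 \<le> t"
    using compact_attains_inf[of ?A] by blast
  show thesis
  proof (rule that[of T0])
    show "\<phi> t q \<noteq> q" if "0 < t" "t < T0" for t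
    proof
      assume "\<phi> t q = q"
      then have "t \<ge> d" using d(2)[of t] that by force
      then have "t \<in> ?A" using T0(1) that \<open>\<phi> t q = q\<close> by auto
      then show False using T0(2) that by force
    qed
  qed (use T0 d in auto)
qed

text \<open>Continuous dependence on the initial point is uniform on compact time intervals, by the
  tube lemma.\<close>

lemma nbhd_shadowing:
  fixes P :: "'a \<Rightarrow> complex"
  assumes "continuous_on UNIV P" "e > 0"
  shows "\<exists>V. open V \<and> x \<in> V \<and> (\<forall>y\<in>V. \<forall>t\<in>{a..b}. dist (P (\<phi> t y)) (P (\<phi> t x)) < e)"
proof -
  let ?W = "{(y, t). dist (P (\<phi> t y)) (P (\<phi> t x)) < e}"
  have "open ?W"
    unfolding case_prod_unfold
    by (intro open_Collect_less continuous_intros continuous_on_compose2[OF assms(1)]) auto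
  moreover have "{x} \<times> {a..b} \<subseteq> ?W"
    using assms by auto
  ultimately obtain V where "x \<in> V" "open V" "V \<times> {a..b} \<subseteq> ?W"
    using Elementary_Topology.tube_lemma[of "{a..b}" ?W x] by auto
  then show ?thesis by blast
qed

end

section \<open>The integer-valued function along pairs of orbits\<close>

text \<open>The plane is identified with the complex numbers to have winding numbers at hand. The
  assumptions are stable under time reversal, so every result also holds in backward time.\<close>

locale pb_flow = compact_flow \<phi> for \<phi> :: "real \<Rightarrow> 'a::t2_space \<Rightarrow> 'a" +
  fixes S :: "('a \<times> 'a) set" and W :: "'a \<times> 'a \<Rightarrow> int" and P :: "'a \<Rightarrow> complex"
  assumes closed_S: "closed S"
    and diag_S: "Id \<subseteq> S"
    and A1: "axiom_A1 S W"
    and continuous_P: "continuous_on UNIV P"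
    and P_eq: "\<And>x y. P x = P y \<Longrightarrow> (x, y) \<in> S"
    and A5: "axiom_A5 \<phi> S W"
begin

lemma W_sym: "(x, y) \<notin> S \<Longrightarrow> (y, x) \<notin> S" "(x, y) \<notin> S \<Longrightarrow> W (x, y) = W (y, x)"
  using A1 unfolding axiom_A1_def by blast+

lemma W_cont: "continuous_on (- S) W"
  using A1 by (simp add: axiom_A1_def)

lemma A5D:
  assumes "(x, y) \<in> S" "x \<noteq> y"
  shows "\<exists>e>0. (\<forall>s\<in>{-e<..<e} - {0}. (\<phi> s x, \<phi> s y) \<notin> S) \<and>
    (\<forall>s\<in>{-e<..<0}. \<forall>t\<in>{0<..<e}. W (\<phi> s x, \<phi> s y) > W (\<phi> t x, \<phi> t y))"
proof -
  have "(x, y) \<in> S - Id" using assms by simp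
  from bspec[OF A5[unfolded axiom_A5_def] this] show ?thesis by (simp only: prod.case)
qed

text \<open>Reversing time turns each drop of \<open>W\<close> into a rise; the change of sign
  restores the drop.\<close>

lemma reverse_pb: "pb_flow (\<lambda>s. \<phi> (- s)) S (\<lambda>p. - W p) P"
proof -
  interpret R: compact_flow "\<lambda>s. \<phi> (- s)"
    by (rule reverse)
  show ?thesis
  proof
    show "axiom_A1 S (\<lambda>p. - W p)"
    proof -
      have "continuous_on UNIV (uminus :: int \<Rightarrow> int)"
        by (simp add: continuous_on_open_vimage open_discrete)
      then have "continuous_on (- S) (\<lambda>p. - W p)"
        using W_cont by (rule continuous_on_compose2) auto
      then show ?thesis
        using W_sym unfolding axiom_A1_def by metis
    qed
    show "axiom_A5 (\<lambda>s. \<phi> (- s)) S (\<lambda>p. - W p)"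
      unfolding axiom_A5_def
    proof
      fix z assume "z \<in> S - Id"
      then obtain x y where z: "z = (x, y)" and xy: "(x, y) \<in> S" "x \<noteq> y"
        by (cases z) auto
      from xy obtain e where e: "e > 0"
        "\<And>s. s \<in> {-e<..<e} - {0} \<Longrightarrow> (\<phi> s x, \<phi> s y) \<notin> S"
        "\<And>s t. s \<in> {-e<..<0} \<Longrightarrow> t \<in> {0<..<e} \<Longrightarrow> W (\<phi> s x, \<phi> s y) > W (\<phi> t x, \<phi> t y)"
        using A5D by metis
      show "case z of (x, y) \<Rightarrow> \<exists>e>0. (\<forall>s\<in>{- e<..<e} - {0}. (\<phi> (- s) x, \<phi> (- s) y) \<notin> S) \<and>
          (\<forall>s\<in>{- e<..<0}. \<forall>t\<in>{0<..<e}. - W (\<phi> (- t) x, \<phi> (- t) y) < - W (\<phi> (- s) x, \<phi> (- s) y))"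
        unfolding z prod.case using e by (intro exI[of _ e]) auto
    qed
  qed (use closed_S diag_S continuous_P P_eq in auto)
qed

section \<open>Monotonicity of \<open>W\<close> and its drops at visits to \<open>S\<close>\<close>

lemma crossing:
  assumes "(x, y) \<in> S" "x \<noteq> y"
  obtains e where "e > 0"
    "\<And>s. 0 < \<bar>s\<bar> \<Longrightarrow> \<bar>s\<bar> < e \<Longrightarrow> (\<phi> s x, \<phi> s y) \<notin> S"
    "\<And>s t. - e < s \<Longrightarrow> s < 0 \<Longrightarrow> 0 < t \<Longrightarrow> t < e \<Longrightarrow> W (\<phi> s x, \<phi> s y) > W (\<phi> t x, \<phi> t y)"
proof -
  obtain e where e: "e > 0"
      "\<And>s. s \<in> {-e<..<e} - {0} \<Longrightarrow> (\<phi> s x, \<phi> s y) \<notin> S"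
      "\<And>s t. s \<in> {-e<..<0} \<Longrightarrow> t \<in> {0<..<e} \<Longrightarrow> W (\<phi> s x, \<phi> s y) > W (\<phi> t x, \<phi> t y)"
    using A5D[OF assms] by metis
  show thesis
  proof (rule that[of e])
    show "(\<phi> s x, \<phi> s y) \<notin> S" if "0 < \<bar>s\<bar>" "\<bar>s\<bar> < e" for s
      using e(2)[of s] that by (auto simp: abs_less_iff)
    show "W (\<phi> s x, \<phi> s y) > W (\<phi> t x, \<phi> t y)" if "- e < s" "s < 0" "0 < t" "t < e" for s t
      using e(3)[of s t] that by auto
  qed (rule e(1))
qed

lemma crossing_at:
  assumes "(\<phi> r x, \<phi> r y) \<in> S" "x \<noteq> y"
  obtains e where "e > 0"
    "\<And>s. s \<noteq> r \<Longrightarrow> \<bar>s - r\<bar> < e \<Longrightarrow> (\<phi> s x, \<phi> s y) \<notin> S"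
    "\<And>s t. r - e < s \<Longrightarrow> s < r \<Longrightarrow> r < t \<Longrightarrow> t < r + e \<Longrightarrow> W (\<phi> s x, \<phi> s y) > W (\<phi> t x, \<phi> t y)"
proof -
  obtain e where e: "e > 0"
    "\<And>s. 0 < \<bar>s\<bar> \<Longrightarrow> \<bar>s\<bar> < e \<Longrightarrow> (\<phi> s (\<phi> r x), \<phi> s (\<phi> r y)) \<notin> S"
    "\<And>s t. - e < s \<Longrightarrow> s < 0 \<Longrightarrow> 0 < t \<Longrightarrow> t < e \<Longrightarrow>
      W (\<phi> s (\<phi> r x), \<phi> s (\<phi> r y)) > W (\<phi> t (\<phi> r x), \<phi> t (\<phi> r y))"
    using crossing[OF assms(1)] assms(2) by auto
  show thesis
  proof (rule that[OF e(1)])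
    show "(\<phi> s x, \<phi> s y) \<notin> S" if "s \<noteq> r" "\<bar>s - r\<bar> < e" for s
      using e(2)[of "s - r"] that by simp
    show "W (\<phi> s x, \<phi> s y) > W (\<phi> t x, \<phi> t y)"
      if "r - e < s" "s < r" "r < t" "t < r + e" for s t
      using e(3)[of "s - r" "t - r"] that by simp
  qed
qed

lemma open_W_level: "open {z. z \<notin> S \<and> W z = k}"
proof -
  have "open (- S \<inter> W -` {k})"
    using closed_S by (intro continuous_open_preimage[OF W_cont] open_discrete) auto
  then show ?thesis
    by (simp add: vimage_def Int_def conj_commute)
qed

lemma open_pair_flow_level: "open {(x, y). (\<phi> t x, \<phi> t y) \<notin> S \<and> W (\<phi> t x, \<phi> t y) = k}"
proof -
  have "open ((\<lambda>z. (\<phi> t (fst z), \<phi> t (snd z))) -` {z. z \<notin> S \<and> W z = k})"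
    by (intro open_vimage open_W_level continuous_intros)
  then show ?thesis
    by (simp add: vimage_def case_prod_unfold)
qed

lemma W_locally_constant:
  assumes "(\<phi> r x, \<phi> r y) \<notin> S"
  obtains e where "e > 0" "\<And>s. \<bar>s - r\<bar> < e \<Longrightarrow> (\<phi> s x, \<phi> s y) \<notin> S \<and> W (\<phi> s x, \<phi> s y) = W (\<phi> r x, \<phi> r y)"
proof -
  define A where "A = (\<lambda>s. (\<phi> s x, \<phi> s y)) -` {z. z \<notin> S \<and> W z = W (\<phi> r x, \<phi> r y)}"
  have "open A"
    unfolding A_def by (intro open_vimage open_W_level continuous_intros)
  moreover have "r \<in> A" using assms by (simp add: A_def)
  ultimately obtain e where e: "e > 0" "\<And>s. dist s r < e \<Longrightarrow> s \<in> A"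
    unfolding open_dist by blast
  show thesis
  proof (rule that[OF e(1)])
    fix s assume "\<bar>s - r\<bar> < e"
    then have "s \<in> A" using e(2) by (simp add: dist_real_def)
    then show "(\<phi> s x, \<phi> s y) \<notin> S \<and> W (\<phi> s x, \<phi> s y) = W (\<phi> r x, \<phi> r y)"
      by (simp add: A_def)
  qed
qed

text \<open>The inequality is local and passes to adjoining intervals, so bisection applies. Visits
  to \<open>S\<close> are isolated; near one, \<open>W\<close> is constant on either side and drops
  across it.\<close>

lemma W_mono:
  assumes "x \<noteq> y" "a \<le> b" "(\<phi> a x, \<phi> a y) \<notin> S" "(\<phi> b x, \<phi> b y) \<notin> S"
  shows "W (\<phi> a x, \<phi> a y) \<ge> W (\<phi> b x, \<phi> b y)"
proof -
  let ?p = "\<lambda>s. (\<phi> s x, \<phi> s y)"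
  have "\<forall>s t. a \<le> s \<and> s \<le> t \<and> t \<le> b \<and> ?p s \<notin> S \<and> ?p t \<notin> S \<longrightarrow> W (?p s) \<ge> W (?p t)"
    using \<open>a \<le> b\<close>
  proof (induction rule: Bolzano)
    case (trans a b c)
    show ?case
    proof (intro allI impI)
      fix s t assume st: "a \<le> s \<and> s \<le> t \<and> t \<le> c \<and> ?p s \<notin> S \<and> ?p t \<notin> S"
      consider "t \<le> b" | "b \<le> s" | "s < b" "b < t" by linarith
      then show "W (?p s) \<ge> W (?p t)"
      proof cases
        case 3
        show ?thesis
        proof (cases "?p b \<in> S")
          case True
          obtain e where e: "e > 0" "\<And>s. s \<noteq> b \<Longrightarrow> \<bar>s - b\<bar> < e \<Longrightarrow> ?p s \<notin> S"
            "\<And>s t. b - e < s \<Longrightarrow> s < b \<Longrightarrow> b < t \<Longrightarrow> t < b + e \<Longrightarrow> W (?p s) > W (?p t)"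
            using crossing_at[OF True assms(1)] by metis
          \<comment> \<open>\<open>W\<close> means nothing at the junction \<open>b\<close>, so the
            two halves are linked through \<open>s'\<close> and \<open>t'\<close>, just before and
            just after it.\<close>
          define s' where "s' = max s (b - e / 2)"
          define t' where "t' = min t (b + e / 2)"
          have "W (?p s) \<ge> W (?p s')"
            using trans(1)[rule_format, of s s'] st 3 e(1) e(2)[of s'] by (auto simp: s'_def)
          moreover have "W (?p s') > W (?p t')"
            using e 3 by (intro e(3)) (auto simp: s'_def t'_def)
          moreover have "W (?p t') \<ge> W (?p t)"
            using trans(2)[rule_format, of t' t] st 3 e(1) e(2)[of t'] by (auto simp: t'_def)
          ultimately show ?thesis by linarith
        next
          case False
          have "W (?p s) \<ge> W (?p b)" "W (?p b) \<ge> W (?p t)"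
            using trans(1)[rule_format, of s b] trans(2)[rule_format, of b t] st 3 False by auto
          then show ?thesis by linarith
        qed
      qed (use trans st in auto)
    qed
  next
    case (local r)
    show ?case
    proof (cases "?p r \<in> S")
      case True
      obtain e where e: "e > 0" "\<And>s. s \<noteq> r \<Longrightarrow> \<bar>s - r\<bar> < e \<Longrightarrow> ?p s \<notin> S"
        "\<And>s t. r - e < s \<Longrightarrow> s < r \<Longrightarrow> r < t \<Longrightarrow> t < r + e \<Longrightarrow> W (?p s) > W (?p t)"
        using crossing_at[OF True assms(1)] by metis
      have const: "W (?p s) = W (?p t)" if "s \<in> T" "t \<in> T" "connected T" "T \<subseteq> {r - e<..<r + e} - {r}" for s t T
      proof (rule int_valued_constant_on_real[of T "\<lambda>s. W (?p s)"])
        show "continuous_on T (\<lambda>s. W (?p s))"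
        proof (rule continuous_on_compose2[OF W_cont])
          show "?p ` T \<subseteq> - S"
            using e(2) that(4) by (fastforce simp: abs_less_iff)
        qed (intro continuous_intros)
      qed (use that in auto)
      have "W (?p s) \<ge> W (?p t)" if "r - e < s" "s \<le> t" "t < r + e" "?p s \<notin> S" "?p t \<notin> S" for s t
      proof -
        have "s \<noteq> r" "t \<noteq> r" using that True by auto
        then consider "t < r" | "s > r" | "s < r" "r < t" by linarith
        then show ?thesis
        proof cases
          case 1
          moreover have "{r - e<..<r} \<subseteq> {r - e<..<r + e} - {r}" using e(1) by auto
          ultimately show ?thesis using const[of s "{r - e<..<r}" t] that by auto
        next
          case 2
          moreover have "{r<..<r + e} \<subseteq> {r - e<..<r + e} - {r}" using e(1) by auto
          ultimately show ?thesis using const[of s "{r<..<r + e}" t] that by auto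
        qed (use e(3)[of s t] that in auto)
      qed
      then show ?thesis
        by (intro exI[of _ e]) (use e(1) in auto)
    next
      case False
      obtain e where e: "e > 0" "\<And>s. \<bar>s - r\<bar> < e \<Longrightarrow> W (?p s) = W (?p r)"
        using W_locally_constant[OF False] by metis
      have "W (?p s) = W (?p t)" if "a \<le> r" "r \<le> b" "b - a < e" "a \<le> s" "s \<le> t" "t \<le> b" for a b s t
        using e(2)[of s] e(2)[of t] that by auto
      then show ?thesis
        by (intro exI[of _ e]) (use e(1) in auto)
    qed
  qed
  then show ?thesis using assms by blast
qed

text \<open>The strict drop at the visit is embedded between two stretches on which \<open>W\<close>
  does not increase.\<close>

lemma W_drop:
  assumes "x \<noteq> y" "a < r" "r < b" "(\<phi> a x, \<phi> a y) \<notin> S" "(\<phi> b x, \<phi> b y) \<notin> S" "(\<phi> r x, \<phi> r y) \<in> S"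
  shows "W (\<phi> a x, \<phi> a y) > W (\<phi> b x, \<phi> b y)"
proof -
  let ?p = "\<lambda>s. (\<phi> s x, \<phi> s y)"
  obtain e where e: "e > 0" "\<And>s. s \<noteq> r \<Longrightarrow> \<bar>s - r\<bar> < e \<Longrightarrow> ?p s \<notin> S"
    "\<And>s t. r - e < s \<Longrightarrow> s < r \<Longrightarrow> r < t \<Longrightarrow> t < r + e \<Longrightarrow> W (?p s) > W (?p t)"
    using crossing_at[OF assms(6,1)] by metis
  define s' where "s' = max a (r - e / 2)"
  define t' where "t' = min b (r + e / 2)"
  have *: "?p s' \<notin> S" "?p t' \<notin> S"
    using e(1) e(2)[of s'] e(2)[of t'] assms by (auto simp: s'_def t'_def)
  have "W (?p a) \<ge> W (?p s')"
    by (rule W_mono) (use assms * in \<open>auto simp: s'_def\<close>)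
  moreover have "W (?p s') > W (?p t')"
    using e assms by (intro e(3)) (auto simp: s'_def t'_def)
  moreover have "W (?p t') \<ge> W (?p b)"
    by (rule W_mono) (use assms * in \<open>auto simp: t'_def\<close>)
  ultimately show ?thesis by linarith
qed

text \<open>The visit itself is not an open condition, but the values of \<open>W\<close> shortly
  before and after it are. Hence every pair near \<open>(p, q)\<close> goes from \<open>k\<close>
  down to \<open>l\<close>, whether or not it meets \<open>S\<close> on the way.\<close>

lemma crossing_stable:
  assumes "(p, q) \<in> S" "p \<noteq> q"
  obtains U e k l where "open U" "(p, q) \<in> U" "e > 0" "k > l"
    "\<And>x y. (x, y) \<in> U \<Longrightarrow> (\<phi> (- e) x, \<phi> (- e) y) \<notin> S \<and> W (\<phi> (- e) x, \<phi> (- e) y) = k"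
    "\<And>x y. (x, y) \<in> U \<Longrightarrow> (\<phi> e x, \<phi> e y) \<notin> S \<and> W (\<phi> e x, \<phi> e y) = l"
proof -
  obtain d where d: "d > 0"
    "\<And>s. 0 < \<bar>s\<bar> \<Longrightarrow> \<bar>s\<bar> < d \<Longrightarrow> (\<phi> s p, \<phi> s q) \<notin> S"
    "\<And>s t. - d < s \<Longrightarrow> s < 0 \<Longrightarrow> 0 < t \<Longrightarrow> t < d \<Longrightarrow> W (\<phi> s p, \<phi> s q) > W (\<phi> t p, \<phi> t q)"
    using crossing[OF assms] by metis
  define e where "e = d / 2"
  define k where "k = W (\<phi> (- e) p, \<phi> (- e) q)"
  define l where "l = W (\<phi> e p, \<phi> e q)"
  let ?U = "{(x, y). (\<phi> (- e) x, \<phi> (- e) y) \<notin> S \<and> W (\<phi> (- e) x, \<phi> (- e) y) = k} \<inter>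
    {(x, y). (\<phi> e x, \<phi> e y) \<notin> S \<and> W (\<phi> e x, \<phi> e y) = l}"
  have "e > 0" using d by (simp add: e_def)
  show thesis
  proof (rule that[of ?U e l k])
    show "open ?U" by (intro open_Int open_pair_flow_level)
    show "(p, q) \<in> ?U"
      using d(1) d(2)[of "- e"] d(2)[of e] by (auto simp: e_def k_def l_def)
    show "l < k"
      unfolding k_def l_def using d(1) by (intro d(3)) (auto simp: e_def)
  qed (use \<open>e > 0\<close> in auto)
qed

text \<open>Near a pair in \<open>S\<close>, each approach leaves the value \<open>l\<close> behind
  and the next one has to start from \<open>k > l\<close>. A function that never increases cannot do
  this twice.\<close>

lemma cluster_pair_notin_S:
  assumes "(p, q) \<in> cluster_set (\<lambda>s. (\<phi> s u, \<phi> s v))" "u \<noteq> v" "p \<noteq> q"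
  shows "(p, q) \<notin> S"
proof
  assume "(p, q) \<in> S"
  then obtain U e k l where U: "open U" "(p, q) \<in> U" "e > 0" "k > l"
    "\<And>x y. (x, y) \<in> U \<Longrightarrow> (\<phi> (- e) x, \<phi> (- e) y) \<notin> S \<and> W (\<phi> (- e) x, \<phi> (- e) y) = k"
    "\<And>x y. (x, y) \<in> U \<Longrightarrow> (\<phi> e x, \<phi> e y) \<notin> S \<and> W (\<phi> e x, \<phi> e y) = l"
    using crossing_stable[OF _ assms(3)] by metis
  obtain s where s: "(\<phi> s u, \<phi> s v) \<in> U"
    using cluster_setD[OF assms(1) U(1,2)] by blast
  \<comment> \<open>The gap \<open>2 * e\<close> places the time \<open>s + e\<close> after the
    first approach no later than the time \<open>t - e\<close> before the second.\<close>
  obtain t where t: "t \<ge> s + 2 * e" "(\<phi> t u, \<phi> t v) \<in> U"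
    using cluster_setD[OF assms(1) U(1,2)] by blast
  have "W (\<phi> (s + e) u, \<phi> (s + e) v) \<ge> W (\<phi> (t - e) u, \<phi> (t - e) v)"
    using U(6)[OF s] U(5)[OF t(2)] t(1) by (intro W_mono[OF assms(2)]) (auto simp: add.commute)
  then show False
    using U(6)[OF s] U(5)[OF t(2)] U(4) by (auto simp: add.commute)
qed

text \<open>Such a pair is a cluster point of the pair formed by \<open>u\<close> and its time shift
  \<open>v\<close>. These differ, since otherwise \<open>t - s\<close> would be a period of
  \<open>u\<close> and, by continuity, of \<open>w\<close>.\<close>

lemma orbit_pairs:
  assumes "w \<in> \<Omega> u" "\<phi> s w \<noteq> \<phi> t w"
  shows "(\<phi> s w, \<phi> t w) \<notin> S"
proof -
  define v where "v = \<phi> (t - s) u"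
  have cl: "(\<phi> s w, \<phi> t w) \<in> cluster_set (\<lambda>r. (\<phi> r u, \<phi> r v))"
    unfolding mem_cluster_set_iff
  proof (intro allI impI)
    fix U N assume U: "open U" "(\<phi> s w, \<phi> t w) \<in> U"
    have "open ((\<lambda>x. (\<phi> s x, \<phi> t x)) -` U)"
      by (intro open_vimage U continuous_intros)
    from cluster_setD[OF assms(1) this, of "N - s"] U(2)
    obtain r where r: "r \<ge> N - s" "(\<phi> s (\<phi> r u), \<phi> t (\<phi> r u)) \<in> U"
      by auto
    then show "\<exists>s\<ge>N. (\<phi> s u, \<phi> s v) \<in> U"
      by (intro exI[of _ "r + s"]) (auto simp: v_def algebra_simps)
  qed
  have "u \<noteq> v"
  proof
    assume uv: "u = v"
    have "\<Omega> u \<subseteq> {x. \<phi> (t - s) x = x}"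
    proof (rule cluster_set_subset_closed)
      show "closed {x. \<phi> (t - s) x = x}"
        by (intro closed_Collect_eq continuous_intros)
      have "\<phi> (t - s) (\<phi> r u) = \<phi> r (\<phi> (t - s) u)" for r
        by (simp add: algebra_simps)
      then show "\<phi> r u \<in> {x. \<phi> (t - s) x = x}" for r
        using uv unfolding v_def by simp
    qed
    then have "\<phi> (t - s) w = w"
      using assms(1) by blast
    then have "\<phi> s (\<phi> (t - s) w) = \<phi> s w"
      by (rule arg_cong)
    then show False using assms(2) by simp
  qed
  with cluster_pair_notin_S[OF cl] assms(2) show ?thesis by blast
qed

text \<open>A pair in \<open>S\<close> would make nearby pairs on the orbit of \<open>w\<close> lose
  \<open>k - l\<close>. But those pairs never meet \<open>S\<close>, so \<open>W\<close> is constant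
  along them.\<close>

lemma closure_orbit_pairs:
  assumes "w \<in> \<Omega> u" "x \<in> closure (orbit \<phi> w)" "y \<in> closure (orbit \<phi> w)" "x \<noteq> y"
  shows "(x, y) \<notin> S"
proof
  assume "(x, y) \<in> S"
  then obtain U e k l where U: "open U" "(x, y) \<in> U" "e > 0" "k > l"
    "\<And>x y. (x, y) \<in> U \<Longrightarrow> (\<phi> (- e) x, \<phi> (- e) y) \<notin> S \<and> W (\<phi> (- e) x, \<phi> (- e) y) = k"
    "\<And>x y. (x, y) \<in> U \<Longrightarrow> (\<phi> e x, \<phi> e y) \<notin> S \<and> W (\<phi> e x, \<phi> e y) = l"
    using crossing_stable[OF _ assms(4)] by metis
  have "(x, y) \<in> closure (orbit \<phi> w \<times> orbit \<phi> w)"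
    using assms by (simp add: closure_Times)
  then have "U \<inter> (orbit \<phi> w \<times> orbit \<phi> w) \<noteq> {}"
    using open_Int_closure_eq_empty[OF U(1)] U(2) by blast
  then obtain s t where st: "(\<phi> s w, \<phi> t w) \<in> U"
    by (auto simp: orbit_def)
  have ne: "\<phi> s w \<noteq> \<phi> t w"
  proof
    assume "\<phi> s w = \<phi> t w"
    then have "(\<phi> (- e) (\<phi> s w), \<phi> (- e) (\<phi> t w)) \<in> Id" by (simp del: flow_flow)
    then show False using U(5)[OF st] diag_S by blast
  qed
  have "W (\<phi> (- e) (\<phi> s w), \<phi> (- e) (\<phi> t w)) = W (\<phi> e (\<phi> s w), \<phi> e (\<phi> t w))"
  proof (rule int_valued_constant_on_real[of UNIV "\<lambda>r. W (\<phi> r (\<phi> s w), \<phi> r (\<phi> t w))"])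
    have "(\<phi> r (\<phi> s w), \<phi> r (\<phi> t w)) \<notin> S" for r
    proof -
      have "\<phi> r (\<phi> s w) \<noteq> \<phi> r (\<phi> t w)" using ne by (simp del: flow_flow)
      then show ?thesis using orbit_pairs[OF assms(1), of "r + s" "r + t"] by simp
    qed
    then show "continuous_on UNIV (\<lambda>r. W (\<phi> r (\<phi> s w), \<phi> r (\<phi> t w)))"
      by (intro continuous_on_compose2[OF W_cont] continuous_intros) auto
  qed auto
  then show False
    using U(4) U(5)[OF st] U(6)[OF st] by auto
qed

lemma P_inj_closure_orbit:
  assumes "w \<in> \<Omega> u" "x \<in> closure (orbit \<phi> w)" "y \<in> closure (orbit \<phi> w)" "P x = P y"
  shows "x = y"
  using closure_orbit_pairs[OF assms(1-3)] P_eq[OF assms(4)] by blast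

text \<open>Distinct times give distinct points, so \<open>W (w, \<phi> T w)\<close> is constant in
  \<open>T > 0\<close>. A common time shift of both points does not change \<open>W\<close>,
  symmetry handles the other order, and openness of the levels handles the closure.\<close>

lemma W_level_closure_orbit:
  assumes w: "w \<in> \<Omega> u" and np: "\<And>T. T \<noteq> 0 \<Longrightarrow> \<phi> T w \<noteq> w"
  obtains k where "\<And>x y. x \<in> closure (orbit \<phi> w) \<Longrightarrow> y \<in> closure (orbit \<phi> w) \<Longrightarrow> x \<noteq> y \<Longrightarrow> W (x, y) = k"
proof -
  define k where "k = W (w, \<phi> 1 w)"
  have ne: "\<phi> s w \<noteq> \<phi> t w" if "s \<noteq> t" for s t
  proof
    assume "\<phi> s w = \<phi> t w"
    then have "\<phi> (- t) (\<phi> s w) = \<phi> (- t) (\<phi> t w)" by (simp del: flow_flow)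
    then show False using np[of "s - t"] that by simp
  qed
  have off: "(\<phi> s w, \<phi> t w) \<notin> S" if "s \<noteq> t" for s t
    using orbit_pairs[OF w ne[OF that]] .
  have pos: "W (w, \<phi> T w) = k" if "T > 0" for T
    unfolding k_def
  proof (rule int_valued_constant_on_real[of "{0<..}" "\<lambda>T. W (w, \<phi> T w)"])
    show "continuous_on {0<..} (\<lambda>T. W (w, \<phi> T w))"
      using off[of 0] by (intro continuous_on_compose2[OF W_cont] continuous_intros) auto
  qed (use that in auto)
  have shift: "W (\<phi> s w, \<phi> t w) = W (\<phi> (s + r) w, \<phi> (t + r) w)" if "s \<noteq> t" for s t r
  proof -
    have "W (\<phi> (s + 0) w, \<phi> (t + 0) w) = W (\<phi> (s + r) w, \<phi> (t + r) w)"
    proof (rule int_valued_constant_on_real[of UNIV "\<lambda>r. W (\<phi> (s + r) w, \<phi> (t + r) w)"])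
      show "continuous_on UNIV (\<lambda>r. W (\<phi> (s + r) w, \<phi> (t + r) w))"
        using off that by (intro continuous_on_compose2[OF W_cont] continuous_intros) auto
    qed auto
    then show ?thesis by simp
  qed
  have level: "W (\<phi> s w, \<phi> t w) = k" if "s \<noteq> t" for s t
  proof (cases "s < t")
    case True
    then show ?thesis using shift[OF that, of "- s"] pos[of "t - s"] by simp
  next
    case False
    then have "W (\<phi> t w, \<phi> s w) = k"
      using shift[of t s "- t"] pos[of "s - t"] that by simp
    then show ?thesis using W_sym(2)[OF off[OF that]] by simp
  qed
  show thesis
  proof (rule that)
    fix x y assume xy: "x \<in> closure (orbit \<phi> w)" "y \<in> closure (orbit \<phi> w)" "x \<noteq> y"
    let ?U = "{z. z \<notin> S \<and> W z = W (x, y)}"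
    have "(x, y) \<in> ?U" using closure_orbit_pairs[OF w xy] by simp
    moreover have "(x, y) \<in> closure (orbit \<phi> w \<times> orbit \<phi> w)"
      using xy by (simp add: closure_Times)
    ultimately have "?U \<inter> (orbit \<phi> w \<times> orbit \<phi> w) \<noteq> {}"
      using open_Int_closure_eq_empty[OF open_W_level] by blast
    then obtain s t where st: "(\<phi> s w, \<phi> t w) \<notin> S" "W (\<phi> s w, \<phi> t w) = W (x, y)"
      by (auto simp: orbit_def)
    then have "s \<noteq> t" using diag_S by auto
    then show "W (x, y) = k" using level st by simp
  qed
qed

text \<open>A pair of points of the orbit of \<open>u\<close> later comes close to a pair of the
  orbit of \<open>w\<close>, where \<open>W\<close> is \<open>k\<close>, so by monotonicity its
  value was at least \<open>k\<close>. Points of the orbit of \<open>w\<close> are in turn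
  approximated by points of the orbit of \<open>u\<close>.\<close>

lemma W_ge_level:
  assumes w: "w \<in> \<Omega> u" and np: "\<And>T. T \<noteq> 0 \<Longrightarrow> \<phi> T w \<noteq> w"
    and k: "\<And>x y. x \<in> closure (orbit \<phi> w) \<Longrightarrow> y \<in> closure (orbit \<phi> w) \<Longrightarrow> x \<noteq> y \<Longrightarrow> W (x, y) = k"
    and off: "(\<phi> s u, \<phi> t w) \<notin> S"
  shows "W (\<phi> s u, \<phi> t w) \<ge> k"
proof -
  have uu: "W (\<phi> s u, \<phi> t u) \<ge> k" if off: "(\<phi> s u, \<phi> t u) \<notin> S" for t
  proof -
    have ne: "\<phi> s u \<noteq> \<phi> t u" using off diag_S by auto
    define T where "T = t - s"
    have "T \<noteq> 0" using ne by (auto simp: T_def)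
    let ?U = "(\<lambda>x. (x, \<phi> T x)) -` {z. z \<notin> S \<and> W z = k}"
    have "open ?U"
      by (intro open_vimage open_W_level continuous_intros)
    moreover have "w \<in> ?U"
    proof -
      have "w \<in> orbit \<phi> w" "\<phi> T w \<in> orbit \<phi> w"
        unfolding orbit_def by (metis flow_0 rangeI) (rule rangeI)
      then have in_cl: "w \<in> closure (orbit \<phi> w)" "\<phi> T w \<in> closure (orbit \<phi> w)"
        using closure_subset by blast+
      have "w \<noteq> \<phi> T w" using np[OF \<open>T \<noteq> 0\<close>] by simp
      then show ?thesis
        using closure_orbit_pairs[OF w in_cl] k[OF in_cl] by simp
    qed
    ultimately obtain r where r: "r \<ge> s" "\<phi> r u \<in> ?U"
      using cluster_setD[OF w, of ?U s] by blast
    have "W (\<phi> 0 (\<phi> s u), \<phi> 0 (\<phi> t u)) \<ge> W (\<phi> (r - s) (\<phi> s u), \<phi> (r - s) (\<phi> t u))"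
      using r off by (intro W_mono[OF ne]) (auto simp: T_def algebra_simps)
    then show ?thesis
      using r by (auto simp: T_def algebra_simps)
  qed
  let ?U = "(\<lambda>x. (\<phi> s u, x)) -` {z. z \<notin> S \<and> W z = W (\<phi> s u, \<phi> t w)}"
  have "open ?U"
    by (intro open_vimage open_W_level continuous_intros)
  moreover have "\<phi> t w \<in> ?U" using off by simp
  ultimately obtain r where "\<phi> r u \<in> ?U"
    using cluster_setD[OF flow_cluster_set[OF w], of ?U t] by blast
  then show ?thesis using uu[of r] by auto
qed

text \<open>Since \<open>w\<close> keeps away from its backward tail \<open>?M\<close>, the value
  \<open>k\<close> on \<open>{w} \<times> ?M\<close> extends to \<open>V \<times> ?M\<close> by the
  tube lemma. Once \<open>u\<close> is in \<open>V\<close>, its pairs with points of the tail start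
  at \<open>k\<close>. They cannot fall below \<open>k\<close> by \<open>W_ge_level\<close>, so they
  never meet \<open>S\<close>.\<close>

lemma eventually_no_crossing:
  assumes w: "w \<in> \<Omega> u" and np: "\<And>T. T \<noteq> 0 \<Longrightarrow> \<phi> T w \<noteq> w"
    and k: "\<And>x y. x \<in> closure (orbit \<phi> w) \<Longrightarrow> y \<in> closure (orbit \<phi> w) \<Longrightarrow> x \<noteq> y \<Longrightarrow> W (x, y) = k"
    and alpha: "w \<notin> cluster_set (\<lambda>s. \<phi> (- s) w)"
  obtains C where
    "\<And>s t. s \<ge> C \<Longrightarrow> s \<ge> t + C \<Longrightarrow> (\<phi> s u, \<phi> t w) \<notin> S \<and> W (\<phi> s u, \<phi> t w) = k"
proof -
  obtain N where N: "w \<notin> closure ((\<lambda>s. \<phi> (- s) w) ` {N..})"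
    using alpha by (auto simp: cluster_set_def)
  let ?M = "closure ((\<lambda>s. \<phi> (- s) w) ` {N..})"
  let ?L = "{z. z \<notin> S \<and> W z = k}"
  have "w \<in> orbit \<phi> w"
    unfolding orbit_def by (metis flow_0 rangeI)
  then have w_cl: "w \<in> closure (orbit \<phi> w)"
    using closure_subset by blast
  have M_cl: "?M \<subseteq> closure (orbit \<phi> w)"
    by (intro closure_mono) (auto simp: orbit_def)
  have "{w} \<times> ?M \<subseteq> ?L"
  proof
    fix z assume "z \<in> {w} \<times> ?M"
    then obtain m where m: "z = (w, m)" "m \<in> ?M" by blast
    then have "w \<noteq> m" "m \<in> closure (orbit \<phi> w)" using N M_cl by auto
    then show "z \<in> ?L"
      using closure_orbit_pairs[OF w w_cl] k[OF w_cl] m by simp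
  qed
  then obtain V where V: "w \<in> V" "open V" "V \<times> ?M \<subseteq> ?L"
    using Elementary_Topology.tube_lemma[of ?M ?L w] compact_closed[of ?M] open_W_level by auto
  obtain s1 where s1: "\<phi> s1 u \<in> V"
    using cluster_setD[OF w V(2,1)] by blast
  define C where "C = max s1 (s1 + N)"
  show thesis
  proof (rule that[of C])
    fix s t assume st: "s \<ge> C" "s \<ge> t + C"
    \<comment> \<open>Here \<open>r\<close> is the time elapsed since \<open>u\<close> was in
      \<open>V\<close>, and \<open>m\<close> is the point that the flow carries to
      \<open>\<phi> t w\<close> in that time. The choice of \<open>C\<close> ensures
      \<open>r \<ge> 0\<close> and \<open>t - r \<le> - N\<close>, which puts \<open>m\<close> into
      the tail.\<close>
    define r where "r = s - s1"
    define x where "x = \<phi> s1 u"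
    define m where "m = \<phi> (t - r) w"
    have "r \<ge> 0" using st by (simp add: r_def C_def)
    have "t - r \<le> - N" using st by (simp add: r_def C_def)
    then have "m \<in> (\<lambda>s. \<phi> (- s) w) ` {N..}"
      unfolding m_def by (intro image_eqI[of _ _ "r - t"]) auto
    then have "m \<in> ?M" by (rule subsetD[OF closure_subset])
    then have xm: "(x, m) \<notin> S" "W (x, m) = k"
      using V(3) s1 by (auto simp: x_def)
    then have ne: "x \<noteq> m" using diag_S by auto
    have flow_xm: "\<phi> a x = \<phi> (s - r + a) u" "\<phi> a m = \<phi> (t - r + a) w" for a
      by (simp_all add: x_def m_def r_def algebra_simps)
    have lower: "W (\<phi> a x, \<phi> a m) \<ge> k" if "(\<phi> a x, \<phi> a m) \<notin> S" for a
      using W_ge_level[OF w np k] that unfolding flow_xm by blast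
    have off: "(\<phi> r x, \<phi> r m) \<notin> S"
    proof
      assume hit: "(\<phi> r x, \<phi> r m) \<in> S"
      then have "r > 0" using xm \<open>r \<ge> 0\<close> by (cases "r = 0") auto
      obtain e where e: "e > 0" "\<And>b. b \<noteq> r \<Longrightarrow> \<bar>b - r\<bar> < e \<Longrightarrow> (\<phi> b x, \<phi> b m) \<notin> S"
        using crossing_at[OF hit ne] by metis
      have off: "(\<phi> (r + e / 2) x, \<phi> (r + e / 2) m) \<notin> S"
        using e by (intro e(2)) auto
      have "W (\<phi> 0 x, \<phi> 0 m) > W (\<phi> (r + e / 2) x, \<phi> (r + e / 2) m)"
        by (rule W_drop[OF ne \<open>r > 0\<close> _ _ off hit]) (use e xm in auto)
      then show False using lower[OF off] xm by simp
    qed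
    have "W (\<phi> 0 x, \<phi> 0 m) \<ge> W (\<phi> r x, \<phi> r m)"
      by (rule W_mono[OF ne \<open>r \<ge> 0\<close> _ off]) (use xm in auto)
    then have "W (\<phi> r x, \<phi> r m) = k"
      using lower[OF off] xm by simp
    then show "(\<phi> s u, \<phi> t w) \<notin> S \<and> W (\<phi> s u, \<phi> t w) = k"
      using off by (simp add: flow_xm)
  qed
qed

text \<open>A pair in \<open>S\<close> would force the values \<open>k\<close> and \<open>l\<close>
  on pairs of the orbits of \<open>u\<close> and \<open>w\<close> with arbitrarily late time for
  \<open>u\<close>, where both values equal \<open>k'\<close>.\<close>

lemma cluster_closure_orbit_notin_S:
  assumes w: "w \<in> \<Omega> u" and np: "\<And>T. T \<noteq> 0 \<Longrightarrow> \<phi> T w \<noteq> w"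
    and alpha: "w \<notin> cluster_set (\<lambda>s. \<phi> (- s) w)"
    and px: "p \<in> \<Omega> u" "x \<in> closure (orbit \<phi> w)" "p \<noteq> x"
  shows "(p, x) \<notin> S"
proof
  assume "(p, x) \<in> S"
  then obtain U e k l where U: "open U" "(p, x) \<in> U" "e > 0" "k > l"
    "\<And>x y. (x, y) \<in> U \<Longrightarrow> (\<phi> (- e) x, \<phi> (- e) y) \<notin> S \<and> W (\<phi> (- e) x, \<phi> (- e) y) = k"
    "\<And>x y. (x, y) \<in> U \<Longrightarrow> (\<phi> e x, \<phi> e y) \<notin> S \<and> W (\<phi> e x, \<phi> e y) = l"
    using crossing_stable[OF _ px(3)] by metis
  obtain k' where k': "\<And>x y. x \<in> closure (orbit \<phi> w) \<Longrightarrow> y \<in> closure (orbit \<phi> w) \<Longrightarrow> x \<noteq> y \<Longrightarrow> W (x, y) = k'"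
    using W_level_closure_orbit[OF w np] by blast
  obtain C where C: "\<And>s t. s \<ge> C \<Longrightarrow> s \<ge> t + C \<Longrightarrow> (\<phi> s u, \<phi> t w) \<notin> S \<and> W (\<phi> s u, \<phi> t w) = k'"
    using eventually_no_crossing[OF w np k' alpha] by blast
  have "open (Pair p -` U)"
    by (intro open_vimage U continuous_intros)
  then have "Pair p -` U \<inter> orbit \<phi> w \<noteq> {}"
    using open_Int_closure_eq_empty[of "Pair p -` U" "orbit \<phi> w"] px(2) U(2) by blast
  then obtain t where t: "(p, \<phi> t w) \<in> U"
    by (auto simp: orbit_def)
  have "open ((\<lambda>y. (y, \<phi> t w)) -` U)"
    by (intro open_vimage U continuous_intros)
  from cluster_setD[OF px(1) this, of "max C (t + C) + e"] t
  obtain s where s: "s \<ge> max C (t + C) + e" "(\<phi> s u, \<phi> t w) \<in> U"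
    by auto
  have "W (\<phi> (s - e) u, \<phi> (t - e) w) = k'" "W (\<phi> (s + e) u, \<phi> (t + e) w) = k'"
    using s U(3) by (auto intro!: C[THEN conjunct2])
  then show False
    using U(5)[OF s(2)] U(6)[OF s(2)] U(4) by (simp add: add.commute)
qed

end

section \<open>Boxes in a vertical strip of the plane\<close>

lemma first_passage:
  fixes f :: "real \<Rightarrow> real"
  assumes cont: "continuous_on {a..b} f" and ab: "a < b" and f_ab: "f a < f b"
  obtains \<sigma> where "a < \<sigma>" "\<sigma> < b" "f a < f \<sigma>" "\<And>t. a \<le> t \<Longrightarrow> t < \<sigma> \<Longrightarrow> f t < f \<sigma>"
    "\<And>e. e > 0 \<Longrightarrow> \<exists>t. \<sigma> < t \<and> t < \<sigma> + e \<and> t \<le> b \<and> f t > f \<sigma>"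
proof -
  text \<open>A level for which the conclusion fails is the maximum of the function over an interval
    with rational right end point, so there are only countably many of them.\<close>
  define bad where "bad = (\<lambda>r. Sup (f ` {a..r})) ` (\<rat> \<inter> {a..b})"
  have "countable bad"
    unfolding bad_def using countable_rat by (intro countable_image countable_Int1)
  then have "{f a<..<f b} - bad \<noteq> {}"
    using uncountable_minus_countable[of "{f a<..<f b}" bad] f_ab
    by (metis countable_empty uncountable_open_interval)
  then obtain l where "l \<in> {f a<..<f b} - bad" by blast
  then have l: "f a < l" "l < f b" "l \<notin> bad" by auto
  let ?A = "{t \<in> {a..b}. f t \<ge> l}"
  have "compact ?A"
  proof -
    have "closed ({a..b} \<inter> f -` {l..})"
      using continuous_closed_preimage[OF cont] by simp
    then have "compact ({a..b} \<inter> ({a..b} \<inter> f -` {l..}))"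
      by (intro compact_Int_closed) auto
    moreover have "{a..b} \<inter> ({a..b} \<inter> f -` {l..}) = ?A" by auto
    ultimately show ?thesis by simp
  qed
  moreover have "b \<in> ?A" using l ab by simp
  ultimately obtain \<sigma> where \<sigma>: "\<sigma> \<in> ?A" "\<And>t. t \<in> ?A \<Longrightarrow> \<sigma> \<le> t"
    using compact_attains_inf[of ?A] by blast
  have below: "f t < l" if "a \<le> t" "t < \<sigma>" for t
  proof (rule ccontr)
    assume "\<not> f t < l"
    then have "t \<in> ?A" using that \<sigma>(1) by auto
    then show False using \<sigma>(2) that by force
  qed
  have "a < \<sigma>" using \<sigma>(1) l(1) by (cases "a = \<sigma>") auto
  have "f \<sigma> = l"
  proof (rule ccontr)
    assume "f \<sigma> \<noteq> l"
    then have "f a \<le> l" "l \<le> f \<sigma>" using \<sigma>(1) l by auto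
    then obtain t where "a \<le> t" "t \<le> \<sigma>" "f t = l"
      using IVT'[of f a l \<sigma>] \<sigma>(1) continuous_on_subset[OF cont, of "{a..\<sigma>}"] by auto
    with below[of t] \<open>f \<sigma> \<noteq> l\<close> show False by (cases "t = \<sigma>") auto
  qed
  have "\<sigma> < b" using \<sigma>(1) l \<open>f \<sigma> = l\<close> by (cases "\<sigma> = b") auto
  show thesis
  proof (rule that[of \<sigma>])
    fix e :: real assume "e > 0"
    show "\<exists>t. \<sigma> < t \<and> t < \<sigma> + e \<and> t \<le> b \<and> f t > f \<sigma>"
    proof (rule ccontr)
      assume neg: "\<not> ?thesis"
      obtain r where r: "r \<in> \<rat>" "\<sigma> < r" "r < min (\<sigma> + e) b"
        using Rats_dense_in_real[of \<sigma> "min (\<sigma> + e) b"] \<open>e > 0\<close> \<open>\<sigma> < b\<close> by auto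
      have "Sup (f ` {a..r}) = l"
      proof (rule cSup_eq_maximum)
        show "l \<in> f ` {a..r}" using \<open>f \<sigma> = l\<close> \<open>a < \<sigma>\<close> r by auto
        fix y assume "y \<in> f ` {a..r}"
        then obtain t where "a \<le> t" "t \<le> r" "y = f t" by auto
        moreover have "f t \<le> l" if "\<sigma> < t"
        proof -
          have "\<not> f t > f \<sigma>" using neg that \<open>t \<le> r\<close> r by auto
          then show ?thesis using \<open>f \<sigma> = l\<close> by simp
        qed
        ultimately show "y \<le> l"
          using below[of t] \<open>f \<sigma> = l\<close> by (cases t \<sigma> rule: linorder_cases) auto
      qed
      moreover have "r \<in> \<rat> \<inter> {a..b}" using r \<open>a < \<sigma>\<close> by auto
      ultimately have "l \<in> bad" unfolding bad_def by blast
      then show False using l by simp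
    qed
  qed (use \<open>f \<sigma> = l\<close> \<open>a < \<sigma>\<close> \<open>\<sigma> < b\<close> below l in auto)
qed

text \<open>The time \<open>\<tau>\<close> is a first passage of \<open>f\<close>, and
  \<open>\<sigma>\<close> is one of the reversed function before \<open>\<tau>\<close>, hence a last
  passage. The last two clauses exclude mere touching of the levels, so that the crossing survives
  small perturbations.\<close>

lemma generic_levels:
  fixes f :: "real \<Rightarrow> real"
  assumes cont: "continuous_on {a..b} f" and ab: "a < b" and f_ab: "f a < f b"
  obtains \<sigma> \<tau> where "a < \<sigma>" "\<sigma> < \<tau>" "\<tau> < b"
    "\<And>t. \<sigma> < t \<Longrightarrow> t \<le> \<tau> \<Longrightarrow> f \<sigma> < f t" "\<And>t. \<sigma> \<le> t \<Longrightarrow> t < \<tau> \<Longrightarrow> f t < f \<tau>"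
    "\<And>e. e > 0 \<Longrightarrow> \<exists>t. \<sigma> - e < t \<and> t < \<sigma> \<and> a \<le> t \<and> f t < f \<sigma>"
    "\<And>e. e > 0 \<Longrightarrow> \<exists>t. \<tau> < t \<and> t < \<tau> + e \<and> t \<le> b \<and> f t > f \<tau>"
proof -
  obtain \<tau> where \<tau>: "a < \<tau>" "\<tau> < b" "f a < f \<tau>" "\<And>t. a \<le> t \<Longrightarrow> t < \<tau> \<Longrightarrow> f t < f \<tau>"
    "\<And>e. e > 0 \<Longrightarrow> \<exists>t. \<tau> < t \<and> t < \<tau> + e \<and> t \<le> b \<and> f t > f \<tau>"
    using first_passage[OF assms] by metis
  let ?g = "\<lambda>s. - f (- s)"
  have "continuous_on {-\<tau>..-a} ?g"
    using \<tau> by (intro continuous_intros continuous_on_compose2[OF cont]) auto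
  moreover have "- \<tau> < - a" "?g (- \<tau>) < ?g (- a)" using \<tau> by auto
  ultimately obtain s where s: "- \<tau> < s" "s < - a" "\<And>t. - \<tau> \<le> t \<Longrightarrow> t < s \<Longrightarrow> ?g t < ?g s"
    "\<And>e. e > 0 \<Longrightarrow> \<exists>t. s < t \<and> t < s + e \<and> t \<le> - a \<and> ?g t > ?g s"
    using first_passage[of "- \<tau>" "- a" ?g] by metis
  show thesis
  proof (rule that[of "- s" \<tau>])
    show "f (- s) < f t" if "- s < t" "t \<le> \<tau>" for t
      using s(3)[of "- t"] that by auto
    show "f t < f \<tau>" if "- s \<le> t" "t < \<tau>" for t
      using \<tau>(4)[of t] that s by auto
    show "\<exists>t. - s - e < t \<and> t < - s \<and> a \<le> t \<and> f t < f (- s)" if e: "e > 0" for e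
    proof -
      obtain t where "s < t" "t < s + e" "t \<le> - a" "?g t > ?g s" using s(4)[OF e] by blast
      then show ?thesis by (intro exI[of _ "- t"]) auto
    qed
  qed (use s \<tau> in auto)
qed

section \<open>Arcs across a strip and the boxes they bound\<close>

lemma connected_subset_inside:
  fixes K :: "complex set"
  assumes "closed K" "connected C" "C \<inter> K = {}" "z \<in> C" "z \<in> inside K"
  shows "C \<subseteq> inside K"
proof (rule ccontr)
  assume "\<not> C \<subseteq> inside K"
  have "- K = inside K \<union> outside K"
    by (metis Un_commute inside_Un_outside double_compl)
  with assms(3) have C: "C \<subseteq> inside K \<union> outside K" by blast
  moreover have "outside K \<inter> C \<noteq> {}"
    using C \<open>\<not> C \<subseteq> inside K\<close> by blast
  moreover have "inside K \<inter> C \<noteq> {}" using assms by blast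
  ultimately show False
    using connectedD[OF assms(2) open_inside[OF assms(1)] open_outside[OF assms(1)]]
      inside_Int_outside[of K] by blast
qed

definition strip_arc :: "real \<Rightarrow> real \<Rightarrow> (real \<Rightarrow> complex) \<Rightarrow> bool" where
  "strip_arc l r \<gamma> \<longleftrightarrow> arc \<gamma> \<and> Re (\<gamma> 0) = l \<and> Re (\<gamma> 1) = r \<and>
     (\<forall>t. 0 < t \<and> t < 1 \<longrightarrow> l < Re (\<gamma> t) \<and> Re (\<gamma> t) < r)"

text \<open>For two strip arcs this is the boundary of a box: one arc forward, the exit side, the
  other arc backward, the entry side. The exit and entry sides are vertical segments.\<close>

definition box_path :: "(real \<Rightarrow> complex) \<Rightarrow> (real \<Rightarrow> complex) \<Rightarrow> real \<Rightarrow> complex" where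
  "box_path \<gamma> \<delta> = (\<gamma> +++ linepath (\<gamma> 1) (\<delta> 1)) +++ (reversepath \<delta> +++ linepath (\<delta> 0) (\<gamma> 0))"

lemma path_image_box_path:
  "path_image (box_path \<gamma> \<delta>) =
    path_image \<gamma> \<union> closed_segment (\<gamma> 1) (\<delta> 1) \<union> (path_image \<delta> \<union> closed_segment (\<delta> 0) (\<gamma> 0))"
proof -
  have "path_image (\<gamma> +++ linepath (\<gamma> 1) (\<delta> 1)) = path_image \<gamma> \<union> closed_segment (\<gamma> 1) (\<delta> 1)"
    by (subst path_image_join) (auto simp: pathfinish_def)
  moreover have "path_image (reversepath \<delta> +++ linepath (\<delta> 0) (\<gamma> 0)) = path_image \<delta> \<union> closed_segment (\<delta> 0) (\<gamma> 0)"
  proof -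
    have "pathstart \<delta> = \<delta> 0" by (simp add: pathstart_def)
    then show ?thesis by (subst path_image_join) auto
  qed
  moreover have "pathfinish \<delta> = \<delta> 1" by (simp add: pathfinish_def)
  ultimately show ?thesis
    unfolding box_path_def by (subst path_image_join) auto
qed

lemma pathfinish_box_path: "pathfinish (box_path \<gamma> \<delta>) = pathstart (box_path \<gamma> \<delta>)"
  unfolding box_path_def pathfinish_join pathstart_join pathfinish_linepath by (simp add: pathstart_def)

lemma strip_arc_Re:
  assumes "strip_arc l r \<gamma>" "l < r" "z \<in> path_image \<gamma>"
  shows "l \<le> Re z" "Re z \<le> r" "Re z = l \<Longrightarrow> z = \<gamma> 0" "Re z = r \<Longrightarrow> z = \<gamma> 1"
proof -
  obtain t where t: "0 \<le> t" "t \<le> 1" "z = \<gamma> t"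
    using assms(3) by (auto simp: path_image_def)
  consider "t = 0" | "t = 1" | "0 < t" "t < 1" using t by linarith
  then have "l \<le> Re z \<and> Re z \<le> r \<and> (Re z = l \<longrightarrow> z = \<gamma> 0) \<and> (Re z = r \<longrightarrow> z = \<gamma> 1)"
    using assms t by cases (auto simp: strip_arc_def)
  then show "l \<le> Re z" "Re z \<le> r" "Re z = l \<Longrightarrow> z = \<gamma> 0" "Re z = r \<Longrightarrow> z = \<gamma> 1"
    by auto
qed

lemma Re_closed_segment_const:
  assumes "z \<in> closed_segment a b" "Re a = l" "Re b = l"
  shows "Re z = l"
proof -
  obtain u where "z = (1 - u) *\<^sub>R a + u *\<^sub>R b"
    using assms(1) by (auto simp: in_segment)
  then have "Re z = (1 - u) * Re a + u * Re b"
    by simp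
  then show ?thesis
    using assms(2,3) by (simp add: algebra_simps)
qed

text \<open>The arcs meet the sides of the strip in their end points alone, so the four pieces meet
  at the corners and nowhere else.\<close>

lemma simple_path_box_path:
  assumes g: "strip_arc l r \<gamma>" and d: "strip_arc l r \<delta>" and lr: "l < r"
    and disj: "path_image \<gamma> \<inter> path_image \<delta> = {}"
  shows "simple_path (box_path \<gamma> \<delta>)"
proof -
  have arcs: "arc \<gamma>" "arc \<delta>" using g d by (auto simp: strip_arc_def)
  have pe: "pathstart \<gamma> = \<gamma> 0" "pathfinish \<gamma> = \<gamma> 1" "pathstart \<delta> = \<delta> 0" "pathfinish \<delta> = \<delta> 1"
    by (simp_all add: pathstart_def pathfinish_def)
  have ends: "\<gamma> 0 \<in> path_image \<gamma>" "\<gamma> 1 \<in> path_image \<gamma>" "\<delta> 0 \<in> path_image \<delta>" "\<delta> 1 \<in> path_image \<delta>"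
    by (auto simp: path_image_def)
  then have ne: "\<gamma> 1 \<noteq> \<delta> 1" "\<delta> 0 \<noteq> \<gamma> 0"
    using disj by (metis disjoint_iff)+
  have Re: "Re (\<gamma> 0) = l" "Re (\<delta> 0) = l" "Re (\<gamma> 1) = r" "Re (\<delta> 1) = r"
    using g d by (auto simp: strip_arc_def)
  have seg: "\<And>z. z \<in> closed_segment (\<gamma> 1) (\<delta> 1) \<Longrightarrow> Re z = r"
    "\<And>z. z \<in> closed_segment (\<delta> 0) (\<gamma> 0) \<Longrightarrow> Re z = l"
    using Re by (auto intro: Re_closed_segment_const)
  have 1: "arc (\<gamma> +++ linepath (\<gamma> 1) (\<delta> 1))"
  proof (rule arc_join)
    show "path_image \<gamma> \<inter> path_image (linepath (\<gamma> 1) (\<delta> 1)) \<subseteq> {pathstart (linepath (\<gamma> 1) (\<delta> 1))}"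
      using seg(1) strip_arc_Re(4)[OF g lr] by auto
  qed (use arcs ne in \<open>auto simp: pe\<close>)
  have 2: "arc (reversepath \<delta> +++ linepath (\<delta> 0) (\<gamma> 0))"
  proof (rule arc_join)
    show "path_image (reversepath \<delta>) \<inter> path_image (linepath (\<delta> 0) (\<gamma> 0)) \<subseteq> {pathstart (linepath (\<delta> 0) (\<gamma> 0))}"
      using seg(2) strip_arc_Re(3)[OF d lr] by auto
  qed (use arcs ne in \<open>auto simp: arc_reversepath pe\<close>)
  have im1: "path_image (\<gamma> +++ linepath (\<gamma> 1) (\<delta> 1)) = path_image \<gamma> \<union> closed_segment (\<gamma> 1) (\<delta> 1)"
    by (subst path_image_join) (auto simp: pe)
  have im2: "path_image (reversepath \<delta> +++ linepath (\<delta> 0) (\<gamma> 0)) = path_image \<delta> \<union> closed_segment (\<delta> 0) (\<gamma> 0)"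
    by (subst path_image_join) (auto simp: pe)
  show ?thesis
    unfolding box_path_def
  proof (rule simple_path_join_loop[OF 1 2])
    have "path_image \<gamma> \<inter> closed_segment (\<delta> 0) (\<gamma> 0) \<subseteq> {\<gamma> 0}"
      using seg(2) strip_arc_Re(3)[OF g lr] by auto
    moreover have "closed_segment (\<gamma> 1) (\<delta> 1) \<inter> path_image \<delta> \<subseteq> {\<delta> 1}"
      using seg(1) strip_arc_Re(4)[OF d lr] by auto
    moreover have "closed_segment (\<gamma> 1) (\<delta> 1) \<inter> closed_segment (\<delta> 0) (\<gamma> 0) = {}"
      using seg lr by fastforce
    ultimately show "path_image (\<gamma> +++ linepath (\<gamma> 1) (\<delta> 1)) \<inter> path_image (reversepath \<delta> +++ linepath (\<delta> 0) (\<gamma> 0))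
      \<subseteq> {pathstart (\<gamma> +++ linepath (\<gamma> 1) (\<delta> 1)), pathstart (reversepath \<delta> +++ linepath (\<delta> 0) (\<gamma> 0))}"
      unfolding im1 im2 using disj by (auto simp: pe)
  qed (auto simp: pe)
qed

text \<open>The closed strip is a convex set containing the boundary of the box, so its complement
  lies outside the box.\<close>

lemma outside_box_path:
  assumes g: "strip_arc l r \<gamma>" and d: "strip_arc l r \<delta>" and lr: "l < r"
    and z: "Re z < l \<or> r < Re z"
  shows "z \<in> outside (path_image (box_path \<gamma> \<delta>))"
proof -
  let ?B = "{z. l \<le> Re z} \<inter> {z. Re z \<le> r}"
  have "convex ?B"
    using convex_halfspace_Re_ge[of l] convex_halfspace_Re_le[of r] by (intro convex_Int) auto
  moreover have "path_image (box_path \<gamma> \<delta>) \<subseteq> ?B"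
  proof -
    have "Re w = r" if "w \<in> closed_segment (\<gamma> 1) (\<delta> 1)" for w
      using Re_closed_segment_const[OF that] g d by (auto simp: strip_arc_def)
    moreover have "Re w = l" if "w \<in> closed_segment (\<delta> 0) (\<gamma> 0)" for w
      using Re_closed_segment_const[OF that] g d by (auto simp: strip_arc_def)
    ultimately show ?thesis
      unfolding path_image_box_path
      using strip_arc_Re(1,2)[OF g lr] strip_arc_Re(1,2)[OF d lr] lr by fastforce
  qed
  ultimately have "- ?B \<subseteq> outside (path_image (box_path \<gamma> \<delta>))"
    by (rule outside_subset_convex)
  then show ?thesis using z by auto
qed

text \<open>Close to \<open>\<eta> 0\<close> the boundary of the box lies on the line
  \<open>Re z = l\<close>, and the inside accumulates at this point from the right. So the right
  half of a small ball lies inside; \<open>\<eta>\<close> starts into that half ball and never meets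
  the boundary afterwards.\<close>

lemma strip_arc_between_inside_box:
  assumes g: "strip_arc l r \<gamma>" and d: "strip_arc l r \<delta>" and e: "strip_arc l r \<eta>" and lr: "l < r"
    and disj: "path_image \<gamma> \<inter> path_image \<delta> = {}" "path_image \<gamma> \<inter> path_image \<eta> = {}"
      "path_image \<delta> \<inter> path_image \<eta> = {}"
    and between: "\<eta> 0 \<in> closed_segment (\<delta> 0) (\<gamma> 0)" and t: "0 < t" "t < 1"
  shows "\<eta> t \<in> inside (path_image (box_path \<gamma> \<delta>))"
proof -
  let ?Q = "path_image (box_path \<gamma> \<delta>)"
  let ?c = "\<eta> 0"
  define F where "F = path_image \<gamma> \<union> path_image \<delta> \<union> closed_segment (\<gamma> 1) (\<delta> 1)"
  have Q: "?Q = F \<union> closed_segment (\<delta> 0) (\<gamma> 0)"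
    unfolding path_image_box_path F_def by blast
  have simp: "simple_path (box_path \<gamma> \<delta>)"
    by (rule simple_path_box_path[OF g d lr disj(1)])
  have clQ: "closed ?Q"
    using simp by (intro closed_path_image simple_path_imp_path)
  have Re_c: "Re ?c = l" using e by (simp add: strip_arc_def)
  have seg: "\<And>z. z \<in> closed_segment (\<gamma> 1) (\<delta> 1) \<Longrightarrow> Re z = r"
    "\<And>z. z \<in> closed_segment (\<delta> 0) (\<gamma> 0) \<Longrightarrow> Re z = l"
    using g d by (auto intro: Re_closed_segment_const simp: strip_arc_def)
  have c_in: "?c \<in> path_image \<eta>" by (auto simp: path_image_def)
  have "path \<gamma>" "path \<delta>" using g d by (auto simp: strip_arc_def arc_imp_path)
  then have "open (- F)"
    unfolding F_def open_Compl by (intro open_Compl closed_Un closed_path_image) auto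
  moreover have "?c \<in> - F"
    using c_in disj seg(1) Re_c lr by (auto simp: F_def)
  ultimately obtain \<rho> where \<rho>: "\<rho> > 0" "ball ?c \<rho> \<subseteq> - F"
    using openE by blast
  have ballQ: "Re z = l" if "z \<in> ball ?c \<rho>" "z \<in> ?Q" for z
    using that \<rho>(2) seg(2) unfolding Q by blast
  note J = Jordan_inside_outside[OF simp pathfinish_box_path]
  have not_left: "Re z > l" if "z \<in> inside ?Q" for z
  proof (rule ccontr)
    assume "\<not> Re z > l"
    have "open (inside ?Q)" using J by blast
    then obtain e where e: "e > 0" "ball z e \<subseteq> inside ?Q"
      using \<open>z \<in> inside ?Q\<close> by (rule openE)
    \<comment> \<open>The inside is open, so with a point on or to the left of the line it would
      contain a point strictly to the left of the strip.\<close>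
    have "z - of_real (e / 2) \<in> ball z e"
      using e(1) by (simp add: dist_norm)
    moreover have "z - of_real (e / 2) \<in> outside ?Q"
      by (rule outside_box_path[OF g d lr]) (use e(1) \<open>\<not> Re z > l\<close> in auto)
    ultimately show False
      using e(2) inside_Int_outside[of ?Q] by blast
  qed
  have "?c \<in> frontier (inside ?Q)"
    using J between unfolding Q by auto
  then have "?c \<in> closure (inside ?Q)"
    by (simp add: frontier_def)
  then obtain z where z: "z \<in> inside ?Q" "z \<in> ball ?c \<rho>"
    using \<rho>(1) by (auto simp: closure_approachable dist_commute)
  let ?H = "ball ?c \<rho> \<inter> {z. Re z > l}"
  have H: "?H \<subseteq> inside ?Q"
  proof (rule connected_subset_inside[OF clQ])
    show "connected ?H"
      using convex_halfspace_Re_gt[of l] by (intro convex_connected convex_Int) auto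
    show "?H \<inter> ?Q = {}" using ballQ by fastforce
    show "z \<in> ?H" using z not_left by blast
  qed (rule z(1))
  have pe: "path \<eta>" using e by (auto simp: strip_arc_def arc_imp_path)
  have inner: "l < Re (\<eta> s) \<and> Re (\<eta> s) < r" if "0 < s" "s < 1" for s
    using e that by (auto simp: strip_arc_def)
  obtain s where s: "0 < s" "s < 1" "\<eta> s \<in> ball ?c \<rho>"
  proof -
    have "continuous_on {0..1} \<eta>" using pe unfolding path_def .
    then have "\<forall>e>0. \<exists>d>0. \<forall>x\<in>{0..1}. dist x 0 < d \<longrightarrow> dist (\<eta> x) (\<eta> 0) < e"
      unfolding continuous_on_iff by (rule bspec) simp
    then obtain h where h: "h > 0" "\<forall>x\<in>{0..1}. dist x 0 < h \<longrightarrow> dist (\<eta> x) (\<eta> 0) < \<rho>"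
      using \<rho>(1) by blast
    define s where "s = min (h / 2) (1 / 2)"
    have s: "0 < s" "s < 1" "s < h" using h(1) by (auto simp: s_def)
    then have "dist (\<eta> s) (\<eta> 0) < \<rho>" using h(2) by simp
    then show thesis using that[OF s(1,2)] by (simp add: dist_commute)
  qed
  have "\<eta> ` {0<..<1} \<subseteq> inside ?Q"
  proof (rule connected_subset_inside[OF clQ])
    have "continuous_on {0<..<1} \<eta>"
      by (rule continuous_on_subset[OF pe[unfolded path_def]]) auto
    then show "connected (\<eta> ` {0<..<1})"
      by (rule connected_continuous_image) simp
    have "\<eta> x \<notin> F" "\<eta> x \<notin> closed_segment (\<delta> 0) (\<gamma> 0)" if "0 < x" "x < 1" for x
    proof -
      have "\<eta> x \<in> path_image \<eta>" using that by (auto simp: path_image_def)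
      then show "\<eta> x \<notin> F" using disj seg(1) inner[OF that] by (fastforce simp: F_def)
      show "\<eta> x \<notin> closed_segment (\<delta> 0) (\<gamma> 0)" using seg(2) inner[OF that] by fastforce
    qed
    then show "\<eta> ` {0<..<1} \<inter> ?Q = {}" unfolding Q by auto
    show "\<eta> s \<in> \<eta> ` {0<..<1}" using s by auto
    show "\<eta> s \<in> inside ?Q" using H s inner by auto
  qed
  then show ?thesis using t by auto
qed

section \<open>Winding numbers of almost closed curves\<close>

definition arc_between :: "(real \<Rightarrow> complex) \<Rightarrow> real \<Rightarrow> real \<Rightarrow> real \<Rightarrow> complex" where
  "arc_between c a b = (\<lambda>x. c (a + (b - a) * x))"

lemma arc_between_simps [simp]:
  "pathstart (arc_between c a b) = c a" "pathfinish (arc_between c a b) = c b"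
  "arc_between c a b 0 = c a" "arc_between c a b 1 = c b"
  by (auto simp: arc_between_def pathstart_def pathfinish_def)

lemma path_arc_between: "continuous_on UNIV c \<Longrightarrow> path (arc_between c a b)"
  unfolding path_def arc_between_def
  by (rule continuous_on_compose2[of UNIV c]) (auto intro!: continuous_intros)

lemma path_image_arc_between: "a \<le> b \<Longrightarrow> path_image (arc_between c a b) = c ` {a..b}"
proof -
  assume "a \<le> b"
  have "path_image (arc_between c a b) = c ` ((\<lambda>x. (b - a) * x + a) ` {0..1})"
    by (simp add: path_image_def arc_between_def image_image add.commute)
  also have "(\<lambda>x. (b - a) * x + a) ` {0..1} = {a..b}"
    using \<open>a \<le> b\<close> by (subst image_affinity_atLeastAtMost) auto
  finally show ?thesis .
qed

lemma winding_number_arc_between_combine: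
  assumes "continuous_on UNIV c" "a \<le> b" "b \<le> d" "z \<notin> c ` {a..d}"
  shows "winding_number (arc_between c a b) z + winding_number (arc_between c b d) z =
    winding_number (arc_between c a d) z"
proof (cases "a = d")
  case True
  then have "arc_between c a d = linepath (c a) (c a)"
    by (auto simp: arc_between_def linepath_def algebra_simps scaleR_conv_of_real)
  then show ?thesis using assms True by auto
next
  case False
  define u where "u = (b - a) / (d - a)"
  have u: "u \<in> {0..1}" using assms False by (auto simp: u_def divide_simps)
  have "(d - a) * u = b - a" using False assms by (simp add: u_def)
  then have h: "a + (d - a) * ((u - 0) * x + 0) = a + (b - a) * x"
      "a + (d - a) * ((1 - u) * x + u) = b + (d - b) * x" for x
    by algebra+
  have *: "subpath 0 u (arc_between c a d) = arc_between c a b"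
    "subpath u 1 (arc_between c a d) = arc_between c b d"
    unfolding subpath_def arc_between_def h by (rule refl)+
  have "z \<notin> path_image (arc_between c a d)"
    using assms by (simp add: path_image_arc_between)
  from winding_number_subpath_combine[OF path_arc_between[OF assms(1)] this, of 0 u 1] u
  show ?thesis unfolding * by simp
qed

text \<open>This will be the long arc of the projected orbit between corresponding points of two
  passages, closed up by a short chord across the box.\<close>

definition chord_loop :: "(real \<Rightarrow> complex) \<Rightarrow> real \<Rightarrow> real \<Rightarrow> real \<Rightarrow> complex" where
  "chord_loop c a b = arc_between c a b +++ linepath (c b) (c a)"

lemma path_chord_loop: "continuous_on UNIV c \<Longrightarrow> path (chord_loop c a b)"
  by (simp add: chord_loop_def path_arc_between)

lemma chord_loop_ends: "pathfinish (chord_loop c a b) = pathstart (chord_loop c a b)"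
  by (simp add: chord_loop_def)

lemma path_image_chord_loop:
  "a \<le> b \<Longrightarrow> path_image (chord_loop c a b) = c ` {a..b} \<union> closed_segment (c b) (c a)"
  by (simp add: chord_loop_def path_image_join path_image_arc_between)

text \<open>The two loops share the arc from \<open>b\<close> to \<open>a'\<close>. After cancelling
  it, what remains runs once around the box.\<close>

lemma winding_number_chord_loops:
  assumes c: "continuous_on UNIV c" and le: "a \<le> b" "b \<le> a'" "a' \<le> b'"
    and z: "z \<notin> c ` {a..b'}" "z \<notin> closed_segment (c a') (c a)" "z \<notin> closed_segment (c b') (c b)"
  shows "winding_number (chord_loop c a a') z - winding_number (chord_loop c b b') z =
    winding_number (box_path (arc_between c a b) (arc_between c a' b')) z"
proof -
  have p: "path (arc_between c x y)" for x y by (rule path_arc_between[OF c])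
  have z': "z \<notin> path_image (arc_between c x y)" if "a \<le> x" "x \<le> y" "y \<le> b'" for x y
    using z(1) that by (auto simp: path_image_arc_between)
  have zs: "z \<notin> closed_segment (c a) (c a')" "z \<notin> closed_segment (c b) (c b')"
    using z by (auto simp: closed_segment_commute)
  let ?w = "\<lambda>x y. winding_number (arc_between c x y) z"
  let ?l = "\<lambda>x y. winding_number (linepath x y) z"
  have 1: "winding_number (chord_loop c a a') z = ?w a a' + ?l (c a') (c a)"
    unfolding chord_loop_def using le z z' by (subst winding_number_join) (auto simp: p)
  have 2: "winding_number (chord_loop c b b') z = ?w b b' + ?l (c b') (c b)"
    unfolding chord_loop_def using le z z' by (subst winding_number_join) (auto simp: p)
  have 3: "?l (c b') (c b) = - ?l (c b) (c b')"
    using winding_number_reversepath[of "linepath (c b) (c b')" z] zs by simp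
  have 4: "winding_number (reversepath (arc_between c a' b')) z = - ?w a' b'"
    using le by (intro winding_number_reversepath p z') auto
  have "winding_number (box_path (arc_between c a b) (arc_between c a' b')) z =
      (?w a b + ?l (c b) (c b')) + (- ?w a' b' + ?l (c a') (c a))"
    unfolding box_path_def using le z zs z'
    by (simp add: winding_number_join p path_image_join 4)
  moreover have "?w b b' = ?w a b' - ?w a b" "?w a a' = ?w a b' - ?w a' b'"
    unfolding eq_diff_eq
    using winding_number_arc_between_combine[OF c, of a b b' z]
      winding_number_arc_between_combine[OF c, of a a' b' z] le z(1)
    by (auto simp: add.commute)
  ultimately show ?thesis
    unfolding 1 2 3 by simp
qed

lemma winding_number_eq_along_curve:
  fixes z :: "real \<Rightarrow> complex"
  assumes "path \<gamma>" "pathfinish \<gamma> = pathstart \<gamma>" "continuous_on {a..b} z"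
    and "\<And>s. a \<le> s \<Longrightarrow> s \<le> b \<Longrightarrow> z s \<notin> path_image \<gamma>" "s \<in> {a..b}" "t \<in> {a..b}"
  shows "winding_number \<gamma> (z s) = winding_number \<gamma> (z t)"
proof -
  have "connected (z ` {a..b})"
    using assms(3) by (rule connected_continuous_image) (rule connected_Icc)
  then have "winding_number \<gamma> constant_on z ` {a..b}"
    using assms(4) by (intro winding_number_constant assms(1,2)) auto
  then obtain k where "\<And>x. x \<in> z ` {a..b} \<Longrightarrow> winding_number \<gamma> x = k"
    unfolding constant_on_def by blast
  then show ?thesis
    using assms(5,6) by simp
qed

text \<open>
  The loops \<open>\<gamma>\<close> and \<open>\<delta>\<close> are closed up by the entry chord \<open>G\<close> and the exit chord \<open>H\<close> of a box; \<open>c\<close> is the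
  model passage, which meets the exit side at time \<open>\<tau>\<close>. Near the exit side \<open>z\<close> may cross \<open>H\<close> back and forth,
  but there the winding number around \<open>\<gamma>\<close> stays constant, as the one around \<open>\<delta>\<close> does near the entry
  side. Only times at distance at least \<open>\<kappa>\<close> from the exit are therefore compared.
\<close>

locale chord_crossing =
  fixes z c :: "real \<Rightarrow> complex" and \<gamma> \<delta> :: "real \<Rightarrow> complex" and G H :: "complex set"
    and S1 m \<tau> R \<eta> \<rho> \<kappa> :: real and \<iota> :: complex
  assumes cont_z: "continuous_on UNIV z"
    and \<gamma>: "path \<gamma>" "pathfinish \<gamma> = pathstart \<gamma>" and \<delta>: "path \<delta>" "pathfinish \<delta> = pathstart \<delta>"
    and closed_H: "closed H"
    and avoid_\<gamma>: "\<And>s. s \<ge> S1 \<Longrightarrow> z s \<in> path_image \<gamma> \<Longrightarrow> z s \<in> G"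
    and avoid_\<delta>: "\<And>s. s \<ge> S1 \<Longrightarrow> z s \<in> path_image \<delta> \<Longrightarrow> z s \<in> H"
    and \<eta>: "0 < \<eta>" "\<eta> \<le> \<tau> - m" "\<eta> \<le> R - \<tau>"
    and G_far: "\<And>t y. m \<le> t \<Longrightarrow> t \<le> R \<Longrightarrow> dist y (c t) < \<rho> \<Longrightarrow> y \<notin> G"
    and H_far: "\<And>t y. m \<le> t \<Longrightarrow> t \<le> R \<Longrightarrow> \<bar>t - \<tau>\<bar> \<ge> \<eta> \<Longrightarrow> dist y (c t) < \<rho> \<Longrightarrow> y \<notin> H"
    and near: "\<And>t y. \<bar>t - \<tau>\<bar> < \<eta> \<Longrightarrow> dist y (c t) < \<rho> \<Longrightarrow> dist y (c \<tau>) < \<kappa>"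
    and R_far: "\<And>y. dist y (c R) < \<rho> \<Longrightarrow> dist y (c \<tau>) \<ge> \<kappa>"
    and R_eq: "\<And>s. s \<ge> S1 \<Longrightarrow> dist (z s) (c R) < \<rho> \<Longrightarrow> winding_number \<gamma> (z s) = winding_number \<delta> (z s)"
    and touch: "\<And>s t. s \<ge> S1 \<Longrightarrow> z s \<in> H \<Longrightarrow> m \<le> t \<Longrightarrow> t \<le> R \<Longrightarrow> dist (z (s - \<tau> + t)) (c t) < \<rho>"
    and diff: "\<And>s. s \<ge> S1 \<Longrightarrow> z s \<notin> G \<Longrightarrow> z s \<notin> H \<Longrightarrow>
      winding_number \<gamma> (z s) - winding_number \<delta> (z s) \<in> {0, \<iota>}"
begin

text \<open>While \<open>z\<close> shadows the passage it misses \<open>G\<close>, so its winding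
  number for \<open>\<gamma>\<close> stays the same from \<open>m\<close> to \<open>R\<close>, where
  it agrees with the one for \<open>\<delta>\<close>. The latter is constant before
  \<open>\<tau> - \<eta>\<close> and after \<open>\<tau> + \<eta>\<close>, as \<open>H\<close> is
  far away then.\<close>

lemma jump:
  assumes "s + m \<ge> S1" and close: "\<And>t. m \<le> t \<Longrightarrow> t \<le> R \<Longrightarrow> dist (z (s + t)) (c t) < \<rho>"
    and t: "m \<le> t" "t \<le> \<tau> - \<eta>" and t': "\<tau> + \<eta> \<le> t'" "t' \<le> R"
  shows "winding_number \<delta> (z (s + t')) - winding_number \<delta> (z (s + t)) =
    winding_number \<gamma> (z (s + m)) - winding_number \<delta> (z (s + m))"
proof -
  have cont: "continuous_on A (\<lambda>t. z (s + t))" for A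
    by (intro continuous_on_compose2[OF cont_z] continuous_intros) auto
  have "winding_number \<gamma> (z (s + m)) = winding_number \<gamma> (z (s + R))"
  proof (rule winding_number_eq_along_curve[OF \<gamma> cont])
    show "z (s + x) \<notin> path_image \<gamma>" if "m \<le> x" "x \<le> R" for x
      using avoid_\<gamma>[of "s + x"] G_far[OF that close[OF that]] that assms(1) by auto
  qed (use \<eta> in auto)
  also have "\<dots> = winding_number \<delta> (z (s + R))"
    using R_eq[of "s + R"] close[of R] assms(1) \<eta> by auto
  also have "\<dots> = winding_number \<delta> (z (s + t'))"
  proof (rule winding_number_eq_along_curve[OF \<delta> cont])
    show "z (s + x) \<notin> path_image \<delta>" if "\<tau> + \<eta> \<le> x" "x \<le> R" for x
      using avoid_\<delta>[of "s + x"] H_far[of x "z (s + x)"] close[of x] that assms(1) \<eta> by auto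
  qed (use \<eta> t' in auto)
  finally have "winding_number \<gamma> (z (s + m)) = winding_number \<delta> (z (s + t'))" .
  moreover have "winding_number \<delta> (z (s + m)) = winding_number \<delta> (z (s + t))"
  proof (rule winding_number_eq_along_curve[OF \<delta> cont])
    show "z (s + x) \<notin> path_image \<delta>" if "m \<le> x" "x \<le> \<tau> - \<eta>" for x
      using avoid_\<delta>[of "s + x"] H_far[of x "z (s + x)"] close[of x] that assms(1) \<eta> by auto
  qed (use \<eta> t in auto)
  ultimately show ?thesis by simp
qed

text \<open>The winding number for \<open>\<delta>\<close> changes only at visits to
  \<open>H\<close>, and by \<open>touch\<close> each visit belongs to a shadowed passage, across
  which the change is \<open>0\<close> or \<open>\<iota>\<close>. The induction is on the number of
  windows of length \<open>R - \<tau>\<close>; the lower bound on \<open>A\<close> leaves room for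
  the beginning of the first passage.\<close>

lemma winding_number_monotone:
  assumes "A \<ge> S1 + (\<tau> - m)" "A \<le> A'" "dist (z A) (c \<tau>) \<ge> \<kappa>" "dist (z A') (c \<tau>) \<ge> \<kappa>"
  shows "\<exists>n::nat. winding_number \<delta> (z A') - winding_number \<delta> (z A) = of_nat n * \<iota>"
proof -
  have "\<exists>n::nat. winding_number \<delta> (z A') - winding_number \<delta> (z A) = of_nat n * \<iota>"
    if "A' - A \<le> real k * (R - \<tau>)" "A \<ge> S1 + (\<tau> - m)" "A \<le> A'" "dist (z A) (c \<tau>) \<ge> \<kappa>" "dist (z A') (c \<tau>) \<ge> \<kappa>"
    for k A A'
    using that
  proof (induction k arbitrary: A)
    case 0
    then have "A' = A" by simp
    then show ?case by (intro exI[of _ 0]) simp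
  next
    case (Suc k)
    let ?D = "{s \<in> {A..A'}. z s \<in> H}"
    have cont: "continuous_on T z" for T
      using continuous_on_subset[OF cont_z] by blast
    show ?case
    proof (cases "?D = {}")
      case True
      have "winding_number \<delta> (z A) = winding_number \<delta> (z A')"
      proof (rule winding_number_eq_along_curve[OF \<delta> cont])
        show "z s \<notin> path_image \<delta>" if "A \<le> s" "s \<le> A'" for s
          using avoid_\<delta>[of s] True that Suc.prems \<eta> by auto
      qed (use Suc.prems in auto)
      then show ?thesis by (intro exI[of _ 0]) simp
    next
      case False
      have "compact ?D"
      proof -
        have "closed (z -` H)" using closed_H cont_z by (rule closed_vimage)
        then have "compact ({A..A'} \<inter> z -` H)" by (intro compact_Int_closed) auto
        moreover have "{A..A'} \<inter> z -` H = ?D" by auto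
        ultimately show ?thesis by simp
      qed
      then obtain s where s: "s \<in> ?D" "\<And>t. t \<in> ?D \<Longrightarrow> s \<le> t"
        using compact_attains_inf[OF _ False] by blast
      have sS: "s \<ge> S1" using s(1) Suc.prems \<eta> by auto
      have close: "dist (z (s - \<tau> + t)) (c t) < \<rho>" if "m \<le> t" "t \<le> R" for t
        using touch[OF sS _ that] s(1) by simp
      \<comment> \<open>A visit within \<open>\<eta>\<close> of an end of the interval would bring
        that end closer than \<open>\<kappa>\<close> to the exit point.\<close>
      have "A \<le> s - \<eta>"
      proof (rule ccontr)
        assume "\<not> A \<le> s - \<eta>"
        then have "dist (z A) (c \<tau>) < \<kappa>"
          using near[of "\<tau> + (A - s)" "z A"] close[of "\<tau> + (A - s)"] s(1) \<eta> by auto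
        then show False using Suc.prems by simp
      qed
      have "s + \<eta> \<le> A'"
      proof (rule ccontr)
        assume "\<not> s + \<eta> \<le> A'"
        then have "dist (z A') (c \<tau>) < \<kappa>"
          using near[of "\<tau> + (A' - s)" "z A'"] close[of "\<tau> + (A' - s)"] s(1) \<eta> by auto
        then show False using Suc.prems by simp
      qed
      have before: "winding_number \<delta> (z A) = winding_number \<delta> (z (s - \<eta>))"
      proof (rule winding_number_eq_along_curve[OF \<delta> cont])
        show "z t \<notin> path_image \<delta>" if "A \<le> t" "t \<le> s - \<eta>" for t
        proof
          assume "z t \<in> path_image \<delta>"
          then have "t \<in> ?D"
            using avoid_\<delta>[of t] that s(1) Suc.prems \<eta> by auto
          then show False using s(2)[of t] that \<eta> by auto
        qed
      qed (use \<open>A \<le> s - \<eta>\<close> in auto)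
      have start: "s - \<tau> + m \<ge> S1"
        using s(1) Suc.prems by auto
      have across: "winding_number \<delta> (z (s - \<tau> + t')) - winding_number \<delta> (z A) \<in> {0, \<iota>}"
        if "\<tau> + \<eta> \<le> t'" "t' \<le> R" for t'
      proof -
        have "winding_number \<delta> (z (s - \<tau> + t')) - winding_number \<delta> (z (s - \<tau> + (\<tau> - \<eta>))) =
            winding_number \<gamma> (z (s - \<tau> + m)) - winding_number \<delta> (z (s - \<tau> + m))"
          by (rule jump[OF start close]) (use \<eta> that in auto)
        moreover have "winding_number \<gamma> (z (s - \<tau> + m)) - winding_number \<delta> (z (s - \<tau> + m)) \<in> {0, \<iota>}"
        proof (rule diff[OF start])
          show "z (s - \<tau> + m) \<notin> G"
            using G_far[of m "z (s - \<tau> + m)"] close[of m] \<eta> by simp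
          show "z (s - \<tau> + m) \<notin> H"
            using H_far[of m "z (s - \<tau> + m)"] close[of m] \<eta> by simp
        qed
        ultimately show ?thesis using before by simp
      qed
      have nat01: "\<exists>n::nat. x = of_nat n * \<iota>" if "x \<in> {0, \<iota>}" for x
        using that by (metis insertE lambda_zero mult_1 of_nat_0 of_nat_1 singletonD)
      show ?thesis
      proof (cases "A' \<le> s + (R - \<tau>)")
        case True
        then show ?thesis
          using across[of "A' - s + \<tau>"] \<open>s + \<eta> \<le> A'\<close> by (intro nat01) auto
      next
        case False
        \<comment> \<open>The induction restarts at the end \<open>B\<close> of the shadowed
          passage, which is again at distance at least \<open>\<kappa>\<close> from the exit
          point.\<close>
        define B where "B = s - \<tau> + R"
        have "\<exists>n::nat. winding_number \<delta> (z A') - winding_number \<delta> (z B) = of_nat n * \<iota>"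
        proof (rule Suc.IH)
          show "A' - B \<le> real k * (R - \<tau>)"
            using Suc.prems(1) s(1) by (auto simp: B_def algebra_simps)
          show "S1 + (\<tau> - m) \<le> B" using s(1) Suc.prems \<eta> by (auto simp: B_def)
          show "\<kappa> \<le> dist (z B) (c \<tau>)"
            using R_far close[of R] \<eta> by (simp add: B_def)
        qed (use False Suc.prems in \<open>auto simp: B_def\<close>)
        moreover have "\<exists>n::nat. winding_number \<delta> (z B) - winding_number \<delta> (z A) = of_nat n * \<iota>"
          using across[of R] \<eta> by (intro nat01) (auto simp: B_def)
        ultimately obtain n n' :: nat where
          "winding_number \<delta> (z A') - winding_number \<delta> (z B) = of_nat n * \<iota>"
          "winding_number \<delta> (z B) - winding_number \<delta> (z A) = of_nat n' * \<iota>"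
          by blast
        then show ?thesis
          by (intro exI[of _ "n + n'"]) (simp add: algebra_simps)
      qed
    qed
  qed
  moreover obtain k :: nat where "(A' - A) / (R - \<tau>) \<le> real k"
    using real_arch_simple by blast
  then have "A' - A \<le> real k * (R - \<tau>)"
    using \<eta> by (simp add: pos_divide_le_eq)
  ultimately show ?thesis
    using assms by blast
qed

end

section \<open>Crossings of a strip that persist under perturbation\<close>

lemma upper_gap:
  fixes f :: "real \<Rightarrow> real"
  assumes "continuous_on {a..b} f" "\<And>t. a \<le> t \<Longrightarrow> t \<le> b \<Longrightarrow> f t < r"
  shows "\<exists>d>0. \<forall>t. a \<le> t \<longrightarrow> t \<le> b \<longrightarrow> f t \<le> r - d"
proof (cases "a \<le> b")
  case True
  then obtain x where x: "x \<in> {a..b}" "\<And>t. t \<in> {a..b} \<Longrightarrow> f t \<le> f x"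
    using continuous_attains_sup[OF _ _ assms(1)] by auto
  show ?thesis
  proof (intro exI[of _ "r - f x"] conjI allI impI)
    show "r - f x > 0" using assms(2) x(1) by simp
    show "f t \<le> r - (r - f x)" if "a \<le> t" "t \<le> b" for t
      using x(2)[of t] that by simp
  qed
qed (auto intro: exI[of _ 1])

lemma lower_gap:
  fixes f :: "real \<Rightarrow> real"
  assumes "continuous_on {a..b} f" "\<And>t. a \<le> t \<Longrightarrow> t \<le> b \<Longrightarrow> r < f t"
  shows "\<exists>d>0. \<forall>t. a \<le> t \<longrightarrow> t \<le> b \<longrightarrow> r + d \<le> f t"
proof -
  have "continuous_on {a..b} (\<lambda>t. - f t)"
    using assms(1) by (rule continuous_on_minus)
  then obtain d where "d > 0" "\<And>t. a \<le> t \<Longrightarrow> t \<le> b \<Longrightarrow> - f t \<le> - r - d"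
    using upper_gap[of a b "\<lambda>t. - f t" "- r"] assms(2) by auto
  then show ?thesis by (intro exI[of _ d]) force
qed

text \<open>By \<open>left\<close> and \<open>right\<close> there are times \<open>r1\<close> and
  \<open>r2\<close>, just before \<open>\<sigma>\<close> and just after \<open>\<tau>\<close>, at
  which \<open>f\<close> is strictly beyond the two levels. A function close to \<open>f\<close> is
  beyond them there too, so it has a last passage \<open>s\<close> before \<open>m\<close> and a
  first passage \<open>e\<close> after \<open>m\<close>.\<close>

lemma stable_crossing:
  fixes f :: "real \<Rightarrow> real"
  assumes cont: "continuous_on UNIV f" and m: "\<sigma> < m" "m < \<tau>" and \<eta>: "\<eta> > 0"
    and above: "\<And>t. \<sigma> < t \<Longrightarrow> t \<le> \<tau> \<Longrightarrow> f \<sigma> < f t" and below: "\<And>t. \<sigma> \<le> t \<Longrightarrow> t < \<tau> \<Longrightarrow> f t < f \<tau>"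
    and left: "\<And>e. e > 0 \<Longrightarrow> \<exists>t. \<sigma> - e < t \<and> t < \<sigma> \<and> f t < f \<sigma>"
    and right: "\<And>e. e > 0 \<Longrightarrow> \<exists>t. \<tau> < t \<and> t < \<tau> + e \<and> f t > f \<tau>"
  obtains d where "d > 0" "\<And>g. continuous_on UNIV g \<Longrightarrow>
      (\<And>t. \<sigma> - \<eta> \<le> t \<Longrightarrow> t \<le> \<tau> + \<eta> \<Longrightarrow> \<bar>g t - f t\<bar> < d) \<Longrightarrow>
      \<exists>s e. \<bar>s - \<sigma>\<bar> < \<eta> \<and> \<bar>e - \<tau>\<bar> < \<eta> \<and> s < m \<and> m < e \<and> g s = f \<sigma> \<and> g e = f \<tau> \<and>
        (\<forall>t. s < t \<and> t < e \<longrightarrow> f \<sigma> < g t \<and> g t < f \<tau>)"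
proof -
  have lt: "f \<sigma> < f \<tau>" using above m by auto
  have c: "continuous_on A f" for A using continuous_on_subset[OF cont] by blast
  have nearby: "\<exists>e>0. \<forall>t. \<bar>t - x\<bar> < e \<longrightarrow> \<bar>f t - f x\<bar> < h" if "h > 0" for x h
    using cont that unfolding continuous_on_iff dist_real_def by blast
  \<comment> \<open>The bounds \<open>e1\<close> and \<open>e2\<close> keep \<open>r1\<close> and
    \<open>r2\<close> so close that \<open>f\<close> does not reach the opposite level on the added
    pieces.\<close>
  obtain e1 where e1: "e1 > 0" "\<And>t. \<bar>t - \<sigma>\<bar> < e1 \<Longrightarrow> \<bar>f t - f \<sigma>\<bar> < f \<tau> - f \<sigma>"
    using nearby[of "f \<tau> - f \<sigma>" \<sigma>] lt by auto
  obtain e2 where e2: "e2 > 0" "\<And>t. \<bar>t - \<tau>\<bar> < e2 \<Longrightarrow> \<bar>f t - f \<tau>\<bar> < f \<tau> - f \<sigma>"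
    using nearby[of "f \<tau> - f \<sigma>" \<tau>] lt by auto
  obtain r1 where r1: "\<sigma> - min \<eta> e1 < r1" "r1 < \<sigma>" "f r1 < f \<sigma>"
    using left[of "min \<eta> e1"] \<eta> e1(1) by auto
  obtain r2 where r2: "\<tau> < r2" "r2 < \<tau> + min \<eta> e2" "f r2 > f \<tau>"
    using right[of "min \<eta> e2"] \<eta> e2(1) by auto
  have r: "\<sigma> - \<eta> < r1" "\<sigma> - e1 < r1" "r2 < \<tau> + \<eta>" "r2 < \<tau> + e2"
    using r1(1) r2(2) min.cobounded1[of \<eta> e1] min.cobounded2[of \<eta> e1]
      min.cobounded1[of \<eta> e2] min.cobounded2[of \<eta> e2] by linarith+
  note r1 = r(1,2) r1(2,3) and r2 = r2(1) r(3,4) r2(3)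
  have K1: "f t < f \<tau>" if "r1 \<le> t" "t \<le> m" for t
  proof (cases "t < \<sigma>")
    case True
    then have "\<bar>t - \<sigma>\<bar> < e1" using that r1 by linarith
    then show ?thesis using e1(2)[of t] by linarith
  qed (use below[of t] that m in auto)
  have K2: "f \<sigma> < f t" if "m \<le> t" "t \<le> r2" for t
  proof (cases "t > \<tau>")
    case True
    then have "\<bar>t - \<tau>\<bar> < e2" using that r2 by linarith
    then show ?thesis using e2(2)[of t] by linarith
  qed (use above[of t] that m in auto)
  obtain d1 where d1: "d1 > 0" "\<And>t. r1 \<le> t \<Longrightarrow> t \<le> m \<Longrightarrow> f t \<le> f \<tau> - d1"
    using upper_gap[OF c, of r1 m "f \<tau>"] K1 by blast
  obtain d2 where d2: "d2 > 0" "\<And>t. m \<le> t \<Longrightarrow> t \<le> r2 \<Longrightarrow> f t \<ge> f \<sigma> + d2"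
    using lower_gap[OF c, of m r2 "f \<sigma>"] K2 by blast
  obtain d3 where d3: "d3 > 0" "\<And>t. \<sigma> + \<eta> \<le> t \<Longrightarrow> t \<le> m \<Longrightarrow> f t \<ge> f \<sigma> + d3"
    using lower_gap[OF c, of "\<sigma> + \<eta>" m "f \<sigma>"] above m \<eta> by auto
  obtain d4 where d4: "d4 > 0" "\<And>t. m \<le> t \<Longrightarrow> t \<le> \<tau> - \<eta> \<Longrightarrow> f t \<le> f \<tau> - d4"
    using upper_gap[OF c, of m "\<tau> - \<eta>" "f \<tau>"] below m \<eta> by auto
  \<comment> \<open>The gaps \<open>d1\<close> and \<open>d2\<close> keep \<open>g\<close> from the
    opposite level, \<open>d3\<close> and \<open>d4\<close> confine \<open>s\<close> and
    \<open>e\<close> to within \<open>\<eta>\<close> of \<open>\<sigma>\<close> and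
    \<open>\<tau>\<close>, and the last two put \<open>g\<close> beyond the levels at
    \<open>r1\<close> and \<open>r2\<close>.\<close>
  define d where "d = Min {d1, d2, d3, d4, f \<sigma> - f r1, f r2 - f \<tau>}"
  have "d > 0"
    unfolding d_def using d1(1) d2(1) d3(1) d4(1) r1(4) r2(4) by (subst Min_gr_iff) auto
  moreover have "d \<le> d1" "d \<le> d2" "d \<le> d3" "d \<le> d4" "d \<le> f \<sigma> - f r1" "d \<le> f r2 - f \<tau>"
    unfolding d_def by (rule Min_le; simp)+
  ultimately have d: "d > 0" "d \<le> d1" "d \<le> d2" "d \<le> d3" "d \<le> d4" "d \<le> f \<sigma> - f r1" "d \<le> f r2 - f \<tau>"
    by blast+
  show thesis
  proof (rule that[OF d(1)])
    fix g :: "real \<Rightarrow> real"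
    assume g: "continuous_on UNIV g" and close: "\<And>t. \<sigma> - \<eta> \<le> t \<Longrightarrow> t \<le> \<tau> + \<eta> \<Longrightarrow> \<bar>g t - f t\<bar> < d"
    have cg: "continuous_on A g" for A using continuous_on_subset[OF g] by blast
    have G1: "g r1 < f \<sigma>" using close[of r1] r1 d m \<eta> by auto
    have G2: "g r2 > f \<tau>" using close[of r2] r2 d m \<eta> by auto
    have G3: "g t < f \<tau>" if "r1 \<le> t" "t \<le> m" for t
      using close[of t] d1(2)[OF that] that d r1 m \<eta> by auto
    have G4: "f \<sigma> < g t" if "m \<le> t" "t \<le> r2" for t
      using close[of t] d2(2)[OF that] that d r2 m \<eta> by auto
    have cl: "compact {t \<in> {a..b}. g t \<le> l}" "compact {t \<in> {a..b}. l \<le> g t}" for a b l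
    proof -
      have "closed {t. g t \<le> l}" "closed {t. l \<le> g t}"
        using g by (auto intro!: closed_Collect_le continuous_intros)
      then have "compact ({a..b} \<inter> {t. g t \<le> l})" "compact ({a..b} \<inter> {t. l \<le> g t})"
        by (auto intro!: compact_Int_closed)
      then show "compact {t \<in> {a..b}. g t \<le> l}" "compact {t \<in> {a..b}. l \<le> g t}"
        by (simp_all add: Int_def)
    qed
    have "r1 \<in> {t \<in> {r1..m}. g t \<le> f \<sigma>}" using G1 r1 m by auto
    then obtain s where s: "s \<in> {t \<in> {r1..m}. g t \<le> f \<sigma>}" "\<And>t. t \<in> {t \<in> {r1..m}. g t \<le> f \<sigma>} \<Longrightarrow> t \<le> s"
      using compact_attains_sup[OF cl(1)[of r1 m "f \<sigma>"]] by blast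
    have "r2 \<in> {t \<in> {m..r2}. f \<tau> \<le> g t}" using G2 r2 m by auto
    then obtain e where e: "e \<in> {t \<in> {m..r2}. f \<tau> \<le> g t}" "\<And>t. t \<in> {t \<in> {m..r2}. f \<tau> \<le> g t} \<Longrightarrow> e \<le> t"
      using compact_attains_inf[OF cl(2)[of m r2 "f \<tau>"]] by blast
    have s_gt: "f \<sigma> < g t" if "s < t" "t \<le> m" for t
    proof (rule ccontr)
      assume "\<not> f \<sigma> < g t"
      then have "t \<le> s" using s(1) that by (intro s(2)) auto
      then show False using that by simp
    qed
    have e_lt: "g t < f \<tau>" if "m \<le> t" "t < e" for t
    proof (rule ccontr)
      assume "\<not> g t < f \<tau>"
      then have "e \<le> t" using e(1) that by (intro e(2)) auto
      then show False using that by simp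
    qed
    have "s \<noteq> m" "e \<noteq> m"
      using s(1) e(1) G4[of m] G3[of m] r1 r2 m by auto
    then have sm: "s < m" "m < e" using s(1) e(1) by auto
    have gs: "g s = f \<sigma>"
    proof (rule ccontr)
      assume "g s \<noteq> f \<sigma>"
      then have "g s \<le> f \<sigma>" "f \<sigma> \<le> g m" using s(1) G4[of m] r2 m by auto
      then obtain t where "s \<le> t" "t \<le> m" "g t = f \<sigma>"
        using IVT'[of g s "f \<sigma>" m] cg sm by auto
      then show False using s_gt[of t] \<open>g s \<noteq> f \<sigma>\<close> by (cases "s = t") auto
    qed
    have ge: "g e = f \<tau>"
    proof (rule ccontr)
      assume "g e \<noteq> f \<tau>"
      then have "g m \<le> f \<tau>" "f \<tau> \<le> g e" using e(1) G3[of m] r1 m by auto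
      then obtain t where "m \<le> t" "t \<le> e" "g t = f \<tau>"
        using IVT'[of g m "f \<tau>" e] cg sm by auto
      then show False using e_lt[of t] \<open>g e \<noteq> f \<tau>\<close> by (cases "e = t") auto
    qed
    have "s < \<sigma> + \<eta>"
    proof (rule ccontr)
      assume "\<not> s < \<sigma> + \<eta>"
      then show False using d3(2)[of s] close[of s] sm gs d m \<eta> by auto
    qed
    moreover have "e > \<tau> - \<eta>"
    proof (rule ccontr)
      assume "\<not> e > \<tau> - \<eta>"
      then show False using d4(2)[of e] close[of e] sm ge d m \<eta> by auto
    qed
    moreover have "f \<sigma> < g t \<and> g t < f \<tau>" if "s < t" "t < e" for t
      using s_gt[of t] e_lt[of t] G3[of t] G4[of t] that s(1) e(1) by (cases "t \<le> m") auto
    ultimately show "\<exists>s e. \<bar>s - \<sigma>\<bar> < \<eta> \<and> \<bar>e - \<tau>\<bar> < \<eta> \<and> s < m \<and> m < e \<and> g s = f \<sigma> \<and> g e = f \<tau> \<and>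
        (\<forall>t. s < t \<and> t < e \<longrightarrow> f \<sigma> < g t \<and> g t < f \<tau>)"
      using s(1) e(1) sm gs ge r1 r2 by (intro exI[of _ s] exI[of _ e]) auto
  qed
qed

section \<open>Three passages near a common point\<close>

lemma compact_image_away:
  fixes f :: "'b::topological_space \<Rightarrow> complex"
  assumes "compact T" "continuous_on T f" "\<And>t. t \<in> T \<Longrightarrow> f t \<noteq> x"
  obtains d where "d > 0" "\<And>t. t \<in> T \<Longrightarrow> d \<le> dist (f t) x"
proof (cases "T = {}")
  case False
  have "continuous_on T (\<lambda>t. dist (f t) x)"
    using assms(2) by (intro continuous_intros)
  then obtain t where "t \<in> T" "\<And>s. s \<in> T \<Longrightarrow> dist (f t) x \<le> dist (f s) x"
    using continuous_attains_inf[OF assms(1) False] by blast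
  then show thesis using that[of "dist (f t) x"] assms(3) by auto
qed (use that[of 1] in auto)

lemma real_middle:
  fixes a b c :: real
  shows "a \<in> closed_segment c b \<or> b \<in> closed_segment c a \<or> c \<in> closed_segment b a"
  by (auto simp: closed_segment_eq_real_ivl)

lemma closed_segment_subset_ball:
  fixes a b x :: complex
  assumes "dist a x < r" "dist b x < r" "y \<in> closed_segment a b"
  shows "dist y x < r"
proof -
  have "closed_segment a b \<subseteq> ball x r"
    using assms(1,2) by (intro closed_segment_subset convex_ball) (auto simp: dist_commute)
  then show ?thesis using assms(3) by (auto simp: dist_commute)
qed

context compact_flow
begin

text \<open>The curve \<open>c\<close> is the model passage, from left to right through a strip
  between generic levels. By \<open>uniq\<close>, the projection of \<open>u\<close> comes near the
  exit point only when \<open>u\<close> itself is near \<open>\<phi> \<tau> q\<close>, so every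
  visit to the exit chord is part of a passage in the model direction. Thus the winding number moves
  only by multiples of one \<open>\<iota>\<close> with natural coefficients.\<close>

lemma no_three_passages_oriented:
  fixes P :: "'a \<Rightarrow> complex"
  assumes cP: "continuous_on UNIV P"
    and w: "w \<in> \<Omega> u"
    and nocoll: "\<And>b. \<exists>C. \<forall>t s. t \<le> b \<longrightarrow> C \<le> s \<longrightarrow> P (\<phi> s u) \<noteq> P (\<phi> t w)"
    and uniq: "\<And>p t. p \<in> \<Omega> u \<Longrightarrow> P p = P (\<phi> t q) \<Longrightarrow> p = \<phi> t q"
    and inj: "\<And>s t. s \<noteq> t \<Longrightarrow> P (\<phi> s w) \<noteq> P (\<phi> t w)"
    and qinj: "\<And>s t. - a \<le> s \<Longrightarrow> s \<le> a \<Longrightarrow> - a \<le> t \<Longrightarrow> t \<le> a \<Longrightarrow> s \<noteq> t \<Longrightarrow> P (\<phi> s q) \<noteq> P (\<phi> t q)"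
    and a: "a > 0"
    and dir: "Re (P (\<phi> (- a) q)) < Re (P (\<phi> a q))"
    and ret: "\<And>U L. open U \<Longrightarrow> q \<in> U \<Longrightarrow>
      \<exists>t1 t2 t3. t1 + L \<le> t2 \<and> t2 + L \<le> t3 \<and> \<phi> t1 w \<in> U \<and> \<phi> t2 w \<in> U \<and> \<phi> t3 w \<in> U"
  shows False
proof -
  define c where "c = (\<lambda>t. P (\<phi> t q))"
  define cw where "cw = (\<lambda>t. P (\<phi> t w))"
  define z where "z = (\<lambda>t. P (\<phi> t u))"
  have contP: "continuous_on A (\<lambda>t. P (\<phi> t x))" for A x
    by (intro continuous_on_compose2[OF cP] continuous_intros) auto
  have cont: "continuous_on A c" "continuous_on A cw" "continuous_on A z" for A
    unfolding c_def cw_def z_def by (rule contP)+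
  have Re_cont: "continuous_on A (\<lambda>t. Re (c t))" for A
    by (intro continuous_intros cont)
  obtain \<sigma> \<tau> where \<sigma>\<tau>: "- a < \<sigma>" "\<sigma> < \<tau>" "\<tau> < a"
    "\<And>t. \<sigma> < t \<Longrightarrow> t \<le> \<tau> \<Longrightarrow> Re (c \<sigma>) < Re (c t)" "\<And>t. \<sigma> \<le> t \<Longrightarrow> t < \<tau> \<Longrightarrow> Re (c t) < Re (c \<tau>)"
    "\<And>e. e > 0 \<Longrightarrow> \<exists>t. \<sigma> - e < t \<and> t < \<sigma> \<and> - a \<le> t \<and> Re (c t) < Re (c \<sigma>)"
    "\<And>e. e > 0 \<Longrightarrow> \<exists>t. \<tau> < t \<and> t < \<tau> + e \<and> t \<le> a \<and> Re (c t) > Re (c \<tau>)"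
    using generic_levels[OF Re_cont, of "- a" a] a dir by (auto simp: c_def)
  define l where "l = Re (c \<sigma>)"
  define r where "r = Re (c \<tau>)"
  have lr: "l < r" using \<sigma>\<tau> by (simp add: l_def r_def)
  define m where "m = (\<sigma> + \<tau>) / 2"
  have m: "\<sigma> < m" "m < \<tau>" using \<sigma>\<tau> by (auto simp: m_def)
  obtain R where R: "\<tau> < R" "R \<le> a" "Re (c R) > r"
    using \<sigma>\<tau>(7)[of 1] by (auto simp: r_def)
  have c_ne: "c s \<noteq> c t" if "- a \<le> s" "s \<le> a" "- a \<le> t" "t \<le> a" "s \<noteq> t" for s t
    unfolding c_def by (rule qinj[OF that])
  \<comment> \<open>Points within \<open>\<kappa> / 2\<close> of \<open>c m\<close> or
    \<open>c R\<close> are still farther than \<open>\<kappa>\<close> from the exit point, so these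
    times qualify for comparing winding numbers.\<close>
  define \<kappa> where "\<kappa> = min (dist (c m) (c \<tau>)) (dist (c R) (c \<tau>)) / 2"
  have \<kappa>: "\<kappa> > 0" "2 * \<kappa> \<le> dist (c m) (c \<tau>)" "2 * \<kappa> \<le> dist (c R) (c \<tau>)"
    using c_ne[of m \<tau>] c_ne[of R \<tau>] \<sigma>\<tau>(1-3) m R unfolding \<kappa>_def by auto
  have nearby: "\<exists>e>0. \<forall>t. \<bar>t - x\<bar> < e \<longrightarrow> dist (c t) (c x) < h" if "h > 0" for x h
    using cont(1)[of UNIV] that unfolding continuous_on_iff dist_real_def by blast
  obtain \<eta>0 where \<eta>0: "\<eta>0 > 0" "\<And>t. \<bar>t - \<tau>\<bar> < \<eta>0 \<Longrightarrow> dist (c t) (c \<tau>) < \<kappa> / 2"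
    using nearby[of "\<kappa> / 2" \<tau>] \<kappa>(1) by auto
  define \<eta> where "\<eta> = min \<eta>0 (min (\<tau> - m) (R - \<tau>))"
  have \<eta>: "\<eta> > 0" "\<eta> \<le> \<eta>0" "\<eta> \<le> \<tau> - m" "\<eta> \<le> R - \<tau>"
    using \<eta>0(1) m R by (auto simp: \<eta>_def)
  have c_ne\<tau>: "c t \<noteq> c \<tau>" if "t \<in> {m..\<tau> - \<eta>} \<union> {\<tau> + \<eta>..R}" for t
    using that \<sigma>\<tau>(1-3) m R \<eta> by (intro c_ne) auto
  have c_ne\<sigma>: "c t \<noteq> c \<sigma>" if "t \<in> {m..R}" for t
    using that \<sigma>\<tau>(1-3) m R by (intro c_ne) auto
  obtain d1 where d1: "d1 > 0" "\<And>t. t \<in> {m..\<tau> - \<eta>} \<union> {\<tau> + \<eta>..R} \<Longrightarrow> d1 \<le> dist (c t) (c \<tau>)"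
    using compact_image_away[OF _ cont(1) c_ne\<tau>] compact_Un[OF compact_Icc compact_Icc] by metis
  obtain d2 where d2: "d2 > 0" "\<And>t. t \<in> {m..R} \<Longrightarrow> d2 \<le> dist (c t) (c \<sigma>)"
    using compact_image_away[OF compact_Icc cont(1) c_ne\<sigma>] by metis
  \<comment> \<open>The last three terms separate whatever shadows \<open>c\<close> within
    \<open>\<rho>\<close> from the exit chord away from \<open>\<tau>\<close>, from the entry chord
    after \<open>m\<close>, and from the whole box at time \<open>R\<close>.\<close>
  define \<rho> where "\<rho> = min (min (\<kappa> / 2) (d1 / 2)) (min (d2 / 2) (Re (c R) - r))"
  have "\<rho> \<le> \<kappa> / 2" "\<rho> \<le> d1 / 2" "\<rho> \<le> d2 / 2" "\<rho> \<le> Re (c R) - r"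
    by (simp_all only: \<rho>_def min_le_iff_disj order_refl simp_thms)
  moreover have "\<rho> > 0"
    using \<kappa>(1) d1(1) d2(1) R(3) by (simp add: \<rho>_def)
  ultimately have \<rho>: "\<rho> > 0" "2 * \<rho> \<le> \<kappa>" "2 * \<rho> \<le> d1" "2 * \<rho> \<le> d2" "\<rho> \<le> Re (c R) - r"
    by linarith+
  obtain V where V: "open V" "\<phi> \<tau> q \<in> V"
    "\<And>y t. y \<in> V \<Longrightarrow> t \<in> {m - \<tau>..R - \<tau>} \<Longrightarrow> dist (P (\<phi> t y)) (P (\<phi> t (\<phi> \<tau> q))) < \<rho>"
    using nbhd_shadowing[OF cP \<rho>(1)] by metis
  \<comment> \<open>By \<open>uniq\<close>, \<open>\<phi> \<tau> q\<close> is the one point of the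
    limit set above \<open>c \<tau>\<close>. Hence by compactness the part of the limit set outside
    \<open>V\<close> projects to a set at positive distance from \<open>c \<tau>\<close>.\<close>
  have "compact (\<Omega> u - V)"
    by (intro compact_closed closed_Diff closed_cluster_set V(1))
  moreover have "continuous_on (\<Omega> u - V) P"
    using continuous_on_subset[OF cP] by blast
  moreover have "P x \<noteq> c \<tau>" if "x \<in> \<Omega> u - V" for x
    using uniq[of x \<tau>] that V(2) by (auto simp: c_def)
  ultimately obtain e0 where e0: "e0 > 0" "\<And>x. x \<in> \<Omega> u - V \<Longrightarrow> e0 \<le> dist (P x) (c \<tau>)"
    using compact_image_away[of "\<Omega> u - V" P "c \<tau>"] by metis
  define \<rho>' where "\<rho>' = min \<rho> (e0 / 2)"
  have \<rho>': "\<rho>' > 0" "\<rho>' \<le> \<rho>" "\<rho>' \<le> e0 / 2" using \<rho>(1) e0(1) by (auto simp: \<rho>'_def)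
  \<comment> \<open>The orbit of \<open>u\<close> is eventually close to its limit set, so the
    implication just obtained for limit points carries over to late points of the orbit.\<close>
  obtain S0 where S0: "\<And>s. s \<ge> S0 \<Longrightarrow> dist (z s) (c \<tau>) < \<rho>' \<Longrightarrow> \<phi> s u \<in> V"
  proof -
    let ?O = "V \<union> {x. e0 / 2 < dist (P x) (c \<tau>)}"
    have "open ?O"
      by (intro open_Un V(1) open_Collect_less continuous_intros cP)
    moreover have "\<Omega> u \<subseteq> ?O"
      using e0 by force
    ultimately obtain N where "\<forall>s\<ge>N. \<phi> s u \<in> ?O"
      using eventually_in_nbhd_cluster_set[OF compact_UNIV] by blast
    then show thesis
      using that[of N] \<rho>'(3) by (force simp: z_def)
  qed
  obtain \<eta>1 where \<eta>1: "\<eta>1 > 0" "\<And>t. \<bar>t - \<sigma>\<bar> < \<eta>1 \<Longrightarrow> dist (c t) (c \<sigma>) < \<rho> / 2"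
    using nearby[of "\<rho> / 2" \<sigma>] \<rho>(1) by auto
  obtain \<eta>2 where \<eta>2: "\<eta>2 > 0" "\<And>t. \<bar>t - \<tau>\<bar> < \<eta>2 \<Longrightarrow> dist (c t) (c \<tau>) < \<rho>' / 2"
    using nearby[of "\<rho>' / 2" \<tau>] \<rho>'(1) by auto
  define \<eta>' where "\<eta>' = min (min \<eta>1 \<eta>2) (R - \<tau>)"
  have \<eta>': "\<eta>' > 0" "\<eta>' \<le> \<eta>1" "\<eta>' \<le> \<eta>2" "\<eta>' \<le> R - \<tau>"
    using \<eta>1(1) \<eta>2(1) R(1) by (auto simp: \<eta>'_def)
  obtain d0 where d0: "d0 > 0" "\<And>g. continuous_on UNIV g \<Longrightarrow>
      (\<And>t. \<sigma> - \<eta>' \<le> t \<Longrightarrow> t \<le> \<tau> + \<eta>' \<Longrightarrow> \<bar>g t - Re (c t)\<bar> < d0) \<Longrightarrow>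
      \<exists>s e. \<bar>s - \<sigma>\<bar> < \<eta>' \<and> \<bar>e - \<tau>\<bar> < \<eta>' \<and> s < m \<and> m < e \<and> g s = Re (c \<sigma>) \<and> g e = Re (c \<tau>) \<and>
        (\<forall>t. s < t \<and> t < e \<longrightarrow> Re (c \<sigma>) < g t \<and> g t < Re (c \<tau>))"
  proof (rule stable_crossing[OF Re_cont m \<eta>'(1)])
    show "\<exists>t. \<sigma> - e < t \<and> t < \<sigma> \<and> Re (c t) < Re (c \<sigma>)" if "e > 0" for e
      using \<sigma>\<tau>(6)[OF that] by blast
    show "\<exists>t. \<tau> < t \<and> t < \<tau> + e \<and> Re (c t) > Re (c \<tau>)" if "e > 0" for e
      using \<sigma>\<tau>(7)[OF that] by blast
  qed (use \<sigma>\<tau>(4,5) in auto)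
  define d where "d = min d0 (\<rho>' / 2)"
  have d: "d > 0" "d \<le> d0" "d \<le> \<rho>' / 2" using d0(1) \<rho>'(1) by (auto simp: d_def)
  obtain N where N: "open N" "q \<in> N"
    "\<And>y t. y \<in> N \<Longrightarrow> t \<in> {\<sigma> - \<eta>'..R} \<Longrightarrow> dist (P (\<phi> t y)) (P (\<phi> t q)) < d"
    using nbhd_shadowing[OF cP d(1)] by metis
  \<comment> \<open>This exceeds the duration of a passage, so passages that begin \<open>L\<close>
    apart use disjoint intervals of time.\<close>
  define L where "L = R - \<sigma> + \<eta>' + 1"
  define Pas where "Pas = {t. \<phi> t w \<in> N}"
  have close: "dist (cw (x + t)) (c t) < d" if "x \<in> Pas" "\<sigma> - \<eta>' \<le> t" "t \<le> R" for x t
    using N(3)[of "\<phi> x w" t] that by (simp add: Pas_def cw_def c_def add.commute)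
  have "\<exists>s e. \<bar>s - \<sigma>\<bar> < \<eta>' \<and> \<bar>e - \<tau>\<bar> < \<eta>' \<and> s < m \<and> m < e \<and> Re (cw (x + s)) = l \<and> Re (cw (x + e)) = r \<and>
      (\<forall>t. s < t \<and> t < e \<longrightarrow> l < Re (cw (x + t)) \<and> Re (cw (x + t)) < r)" if x: "x \<in> Pas" for x
    unfolding l_def r_def
  proof (rule d0(2))
    show "continuous_on UNIV (\<lambda>t. Re (cw (x + t)))"
      by (intro continuous_intros continuous_on_compose2[OF cont(2)]) auto
    show "\<bar>Re (cw (x + t)) - Re (c t)\<bar> < d0" if "\<sigma> - \<eta>' \<le> t" "t \<le> \<tau> + \<eta>'" for t
    proof -
      have "\<bar>Re (cw (x + t) - c t)\<bar> \<le> dist (cw (x + t)) (c t)"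
        unfolding dist_norm by (rule abs_Re_le_cmod)
      also have "\<dots> < d0"
        using close[OF x, of t] that \<eta>'(4) d(2) by auto
      finally show ?thesis by simp
    qed
  qed
  then obtain sf ef where se: "\<And>x. x \<in> Pas \<Longrightarrow> \<bar>sf x - \<sigma>\<bar> < \<eta>' \<and> \<bar>ef x - \<tau>\<bar> < \<eta>' \<and> sf x < m \<and> m < ef x \<and>
      Re (cw (x + sf x)) = l \<and> Re (cw (x + ef x)) = r \<and>
      (\<forall>t. sf x < t \<and> t < ef x \<longrightarrow> l < Re (cw (x + t)) \<and> Re (cw (x + t)) < r)"
    by metis
  define \<alpha> where "\<alpha> x = x + sf x" for x
  define \<beta> where "\<beta> x = x + ef x" for x
  have Re_\<alpha>: "Re (cw (\<alpha> x)) = l" and Re_\<beta>: "Re (cw (\<beta> x)) = r"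
    and \<alpha>\<beta>: "\<alpha> x < x + m" "x + m < \<beta> x" and \<alpha>_ge: "\<alpha> x > x + \<sigma> - \<eta>'" and \<beta>_le: "\<beta> x < x + R"
    if "x \<in> Pas" for x
    using se[OF that] \<eta>'(4) by (auto simp: \<alpha>_def \<beta>_def abs_less_iff)
  have near_\<sigma>: "dist (cw (\<alpha> x)) (c \<sigma>) < \<rho>" if "x \<in> Pas" for x
  proof -
    have "dist (cw (\<alpha> x)) (c (sf x)) < d"
      using close[OF that, of "sf x"] se[OF that] m R \<eta>' by (auto simp: \<alpha>_def abs_less_iff)
    moreover have "dist (c (sf x)) (c \<sigma>) < \<rho> / 2"
      using \<eta>1(2) se[OF that] \<eta>'(2) by auto
    ultimately show ?thesis
      using dist_triangle[of "cw (\<alpha> x)" "c \<sigma>" "c (sf x)"] d(3) \<rho>'(2) by linarith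
  qed
  have near_\<tau>: "dist (cw (\<beta> x)) (c \<tau>) < \<rho>'" if "x \<in> Pas" for x
  proof -
    have "dist (cw (\<beta> x)) (c (ef x)) < d"
      using close[OF that, of "ef x"] se[OF that] m R \<eta>' by (auto simp: \<beta>_def abs_less_iff)
    moreover have "dist (c (ef x)) (c \<tau>) < \<rho>' / 2"
      using \<eta>2(2) se[OF that] \<eta>'(3) by auto
    ultimately show ?thesis
      using dist_triangle[of "cw (\<beta> x)" "c \<tau>" "c (ef x)"] d(3) by linarith
  qed
  have cw_inj: "cw s \<noteq> cw t" if "s \<noteq> t" for s t
    unfolding cw_def by (rule inj[OF that])
  have strip: "strip_arc l r (arc_between cw (\<alpha> x) (\<beta> x))" if "x \<in> Pas" for x
  proof -
    have lt: "\<alpha> x < \<beta> x" using \<alpha>\<beta>[OF that] by linarith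
    have "arc (arc_between cw (\<alpha> x) (\<beta> x))"
      unfolding arc_def
    proof
      show "inj_on (arc_between cw (\<alpha> x) (\<beta> x)) {0..1}"
      proof (rule inj_onI)
        fix s t assume "arc_between cw (\<alpha> x) (\<beta> x) s = arc_between cw (\<alpha> x) (\<beta> x) t"
        then have "\<alpha> x + (\<beta> x - \<alpha> x) * s = \<alpha> x + (\<beta> x - \<alpha> x) * t"
          unfolding arc_between_def using cw_inj by blast
        then show "s = t" using lt by simp
      qed
    qed (rule path_arc_between[OF cont(2)])
    moreover have "l < Re (arc_between cw (\<alpha> x) (\<beta> x) t) \<and> Re (arc_between cw (\<alpha> x) (\<beta> x) t) < r"
      if t: "0 < t" "t < 1" for t
    proof -
      have "(ef x - sf x) * t < (ef x - sf x) * 1" "(ef x - sf x) * t > 0"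
        using lt t by (auto simp: \<alpha>_def \<beta>_def intro!: mult_strict_left_mono)
      then have "sf x < sf x + (ef x - sf x) * t" "sf x + (ef x - sf x) * t < ef x" by auto
      moreover have "arc_between cw (\<alpha> x) (\<beta> x) t = cw (x + (sf x + (ef x - sf x) * t))"
        by (simp add: arc_between_def \<alpha>_def \<beta>_def algebra_simps)
      ultimately show ?thesis using se[OF \<open>x \<in> Pas\<close>] by simp
    qed
    ultimately show ?thesis
      using Re_\<alpha>[OF that] Re_\<beta>[OF that] by (simp add: strip_arc_def)
  qed
  have disjoint: "path_image (arc_between cw (\<alpha> x) (\<beta> x)) \<inter> path_image (arc_between cw (\<alpha> y) (\<beta> y)) = {}"
    if xy: "x \<in> Pas" "y \<in> Pas" "x + L \<le> y \<or> y + L \<le> x" for x y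
  proof -
    have "\<alpha> x \<le> \<beta> x" "\<alpha> y \<le> \<beta> y" "\<beta> x < \<alpha> y \<or> \<beta> y < \<alpha> x"
      using \<alpha>\<beta>[OF xy(1)] \<alpha>\<beta>[OF xy(2)] \<alpha>_ge[OF xy(1)] \<alpha>_ge[OF xy(2)] \<beta>_le[OF xy(1)] \<beta>_le[OF xy(2)] xy(3)
      by (auto simp: L_def)
    then show ?thesis
      using cw_inj by (auto simp: path_image_arc_between)
  qed
  \<comment> \<open>The passages \<open>i\<close> and \<open>j\<close> bound the box and
    \<open>k\<close> enters between them. The earliest passage \<open>x0\<close> supplies the
    reference point at which winding numbers are compared on two rounds of shadowing.\<close>
  have key: False
    if Pas: "i \<in> Pas" "j \<in> Pas" "k \<in> Pas" "x0 \<in> Pas"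
      and order: "i + L \<le> j" "k + L \<le> i \<or> i + L \<le> k" "k + L \<le> j \<or> j + L \<le> k" "x0 \<le> i" "x0 \<le> k"
      and between: "cw (\<alpha> k) \<in> closed_segment (cw (\<alpha> j)) (cw (\<alpha> i))" for i j k x0
  proof -
    let ?Q = "box_path (arc_between cw (\<alpha> i) (\<beta> i)) (arc_between cw (\<alpha> j) (\<beta> j))"
    define G where "G = closed_segment (cw (\<alpha> j)) (cw (\<alpha> i))"
    define H where "H = closed_segment (cw (\<beta> j)) (cw (\<beta> i))"
    let ?\<gamma> = "chord_loop cw (\<alpha> i) (\<alpha> j)"
    let ?\<delta> = "chord_loop cw (\<beta> i) (\<beta> j)"
    have ord: "\<alpha> i < \<beta> i" "\<beta> i < \<alpha> j" "\<alpha> j < \<beta> j"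
      using \<alpha>\<beta>[OF Pas(1)] \<alpha>\<beta>[OF Pas(2)] \<alpha>_ge[OF Pas(2)] \<beta>_le[OF Pas(1)] order(1)
      by (auto simp: L_def)
    have disj_ij: "path_image (arc_between cw (\<alpha> i) (\<beta> i)) \<inter> path_image (arc_between cw (\<alpha> j) (\<beta> j)) = {}"
      using disjoint[OF Pas(1,2)] order(1) by blast
    have disj_ik: "path_image (arc_between cw (\<alpha> i) (\<beta> i)) \<inter> path_image (arc_between cw (\<alpha> k) (\<beta> k)) = {}"
      using disjoint[OF Pas(1,3)] order(2) by blast
    have disj_jk: "path_image (arc_between cw (\<alpha> j) (\<beta> j)) \<inter> path_image (arc_between cw (\<alpha> k) (\<beta> k)) = {}"
      using disjoint[OF Pas(2,3)] order(3) by blast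
    have simp_Q: "simple_path ?Q"
      by (rule simple_path_box_path[OF strip[OF Pas(1)] strip[OF Pas(2)] lr disj_ij])
    have G_ball: "dist y (c \<sigma>) < \<rho>" if "y \<in> G" for y
      using closed_segment_subset_ball[OF near_\<sigma>[OF Pas(2)] near_\<sigma>[OF Pas(1)]] that by (simp add: G_def)
    have H_ball: "dist y (c \<tau>) < \<rho>'" if "y \<in> H" for y
      using closed_segment_subset_ball[OF near_\<tau>[OF Pas(2)] near_\<tau>[OF Pas(1)]] that by (simp add: H_def)
    obtain C0 where C0: "\<And>t s. t \<le> \<beta> j \<Longrightarrow> C0 \<le> s \<Longrightarrow> z s \<noteq> cw t"
      using nocoll[of "\<beta> j"] unfolding z_def cw_def by blast
    define S1 where "S1 = max S0 C0"
    have no_hit: "z s \<notin> cw ` {x..y}" if "s \<ge> S1" "y \<le> \<beta> j" for s x y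
    proof
      assume "z s \<in> cw ` {x..y}"
      then obtain t where "t \<le> y" "z s = cw t" by auto
      then show False using C0[of t s] that by (auto simp: S1_def)
    qed
    have diff_Q: "winding_number ?\<gamma> (z s) - winding_number ?\<delta> (z s) = winding_number ?Q (z s)"
      if "s \<ge> S1" "z s \<notin> G" "z s \<notin> H" for s
      using ord no_hit[OF that(1)] that(2,3) unfolding G_def H_def
      by (intro winding_number_chord_loops cont(2)) auto
    have out_Q: "z s \<notin> path_image ?Q" if "s \<ge> S1" "z s \<notin> G" "z s \<notin> H" for s
      using ord no_hit[OF that(1)] that(2,3) unfolding G_def H_def
      by (auto simp: path_image_box_path path_image_arc_between closed_segment_commute)
    \<comment> \<open>The value is \<open>1\<close> or \<open>-1\<close> according to the
      orientation of the box.\<close>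
    obtain \<iota> :: complex where \<iota>: "\<iota> \<noteq> 0" "\<And>y. y \<in> inside (path_image ?Q) \<Longrightarrow> winding_number ?Q y = \<iota>"
      using simple_closed_path_winding_number_inside[OF simp_Q] by (metis one_neq_zero neg_equal_0_iff_equal)
    have zero: "winding_number ?Q y = 0" if "y \<in> outside (path_image ?Q)" for y
      by (rule winding_number_zero_in_outside[OF simple_path_imp_path[OF simp_Q] pathfinish_box_path that])
    interpret X: chord_crossing z c ?\<gamma> ?\<delta> G H S1 m \<tau> R \<eta> \<rho> \<kappa> \<iota>
    proof
      show "continuous_on UNIV z" by (rule cont)
      show "path ?\<gamma>" "path ?\<delta>" by (rule path_chord_loop[OF cont(2)])+
      show "pathfinish ?\<gamma> = pathstart ?\<gamma>" "pathfinish ?\<delta> = pathstart ?\<delta>" by (rule chord_loop_ends)+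
      show "closed H" by (simp add: H_def)
      show "z s \<in> G" if "s \<ge> S1" "z s \<in> path_image ?\<gamma>" for s
        using that no_hit[of s "\<alpha> j" "\<alpha> i"] ord by (simp add: path_image_chord_loop G_def)
      show "z s \<in> H" if "s \<ge> S1" "z s \<in> path_image ?\<delta>" for s
        using that no_hit[of s "\<beta> j" "\<beta> i"] ord by (simp add: path_image_chord_loop H_def)
      show "0 < \<eta>" "\<eta> \<le> \<tau> - m" "\<eta> \<le> R - \<tau>" by (rule \<eta>)+
      show "y \<notin> G" if "m \<le> t" "t \<le> R" "dist y (c t) < \<rho>" for t y
      proof
        assume "y \<in> G"
        then show False
          using G_ball[of y] d2(2)[of t] that \<rho>(4) dist_triangle3[of "c t" "c \<sigma>" y] by auto
      qed
      show "y \<notin> H" if "m \<le> t" "t \<le> R" "\<eta> \<le> \<bar>t - \<tau>\<bar>" "dist y (c t) < \<rho>" for t y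
      proof
        assume "y \<in> H"
        moreover have "t \<in> {m..\<tau> - \<eta>} \<union> {\<tau> + \<eta>..R}" using that by auto
        ultimately show False
          using H_ball[of y] d1(2)[of t] that \<rho>(3) \<rho>'(2) dist_triangle3[of "c t" "c \<tau>" y] by linarith
      qed
      show "dist y (c \<tau>) < \<kappa>" if "\<bar>t - \<tau>\<bar> < \<eta>" "dist y (c t) < \<rho>" for t y
      proof -
        have "dist (c t) (c \<tau>) < \<kappa> / 2" using \<eta>0(2) that(1) \<eta>(2) by auto
        then show ?thesis using that(2) \<rho>(2) dist_triangle[of y "c \<tau>" "c t"] by linarith
      qed
      show "\<kappa> \<le> dist y (c \<tau>)" if "dist y (c R) < \<rho>" for y
        using \<kappa>(3) \<rho>(2) that dist_triangle3[of "c R" "c \<tau>" y] \<kappa>(1) by linarith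
      show "winding_number ?\<gamma> (z s) = winding_number ?\<delta> (z s)" if s: "s \<ge> S1" "dist (z s) (c R) < \<rho>" for s
      proof -
        \<comment> \<open>By the last bound on \<open>\<rho>\<close> the point is to the right of
          the strip, hence outside the box, where the two winding numbers coincide.\<close>
        have "\<bar>Re (c R - z s)\<bar> \<le> dist (c R) (z s)"
          unfolding dist_norm by (rule abs_Re_le_cmod)
        then have Re: "Re (z s) > r" using s(2) \<rho>(5) by (simp add: dist_commute)
        have "z s \<notin> G" "z s \<notin> H"
          using Re lr Re_closed_segment_const[of "z s"] Re_\<alpha>[OF Pas(1)] Re_\<alpha>[OF Pas(2)]
            Re_\<beta>[OF Pas(1)] Re_\<beta>[OF Pas(2)] unfolding G_def H_def by fastforce+
        then show ?thesis
          using diff_Q[OF s(1)] zero[OF outside_box_path[OF strip[OF Pas(1)] strip[OF Pas(2)] lr]] Re by simp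
      qed
      show "dist (z (s - \<tau> + t)) (c t) < \<rho>" if s: "s \<ge> S1" "z s \<in> H" "m \<le> t" "t \<le> R" for s t
      proof -
        have "\<phi> s u \<in> V" using S0[of s] H_ball[OF s(2)] s(1) by (auto simp: S1_def)
        from V(3)[OF this, of "t - \<tau>"] s show ?thesis
          by (simp add: z_def c_def algebra_simps)
      qed
      show "winding_number ?\<gamma> (z s) - winding_number ?\<delta> (z s) \<in> {0, \<iota>}"
        if s: "s \<ge> S1" "z s \<notin> G" "z s \<notin> H" for s
      proof -
        have "z s \<in> inside (path_image ?Q) \<or> z s \<in> outside (path_image ?Q)"
          using out_Q[OF s] inside_Un_outside[of "path_image ?Q"] by blast
        then show ?thesis unfolding diff_Q[OF s] using \<iota>(2) zero by auto
      qed
    qed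
    have k_inside: "cw (k + m) \<in> inside (path_image ?Q)"
    proof -
      define v where "v = (k + m - \<alpha> k) / (\<beta> k - \<alpha> k)"
      have v: "0 < v" "v < 1" using \<alpha>\<beta>[OF Pas(3)] by (auto simp: v_def divide_simps)
      have "(\<beta> k - \<alpha> k) * v = k + m - \<alpha> k" using \<alpha>\<beta>[OF Pas(3)] by (simp add: v_def)
      then have "arc_between cw (\<alpha> k) (\<beta> k) v = cw (k + m)" by (simp add: arc_between_def)
      moreover have "arc_between cw (\<alpha> k) (\<beta> k) v \<in> inside (path_image ?Q)"
        by (rule strip_arc_between_inside_box[OF strip[OF Pas(1)] strip[OF Pas(2)] strip[OF Pas(3)] lr disj_ij disj_ik disj_jk])
           (use between v in auto)
      ultimately show ?thesis by simp
    qed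
    \<comment> \<open>The time \<open>x0 + m\<close> precedes the arc of \<open>?\<delta>\<close>,
      and the point is far from the exit chord. So the winding number is constant near the reference
      point.\<close>
    have x0_off: "cw (x0 + m) \<notin> path_image ?\<delta>"
    proof -
      have "x0 + m < \<beta> i" using \<alpha>\<beta>[OF Pas(1)] order(4) by linarith
      then have "cw (x0 + m) \<notin> cw ` {\<beta> i..\<beta> j}"
        using cw_inj by (metis atLeastAtMost_iff imageE leD)
      moreover have "cw (x0 + m) \<notin> H"
      proof
        assume "cw (x0 + m) \<in> H"
        from H_ball[OF this] close[OF Pas(4), of m] m R \<eta>'(1) show False
          using \<kappa>(1,2) \<rho>(2) \<rho>'(2) d(3) dist_triangle3[of "c m" "c \<tau>" "cw (x0 + m)"] by auto
      qed
      ultimately show ?thesis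
        using ord by (simp add: path_image_chord_loop H_def)
    qed
    obtain k1 where k1: "k1 > 0" "ball (cw (k + m)) k1 \<subseteq> inside (path_image ?Q)"
      using k_inside open_inside[OF closed_path_image[OF simple_path_imp_path[OF simp_Q]]] openE by metis
    have "open (- path_image ?\<delta>)"
      by (intro open_Compl closed_path_image X.\<delta>)
    then obtain k2 where k2: "k2 > 0" "ball (cw (x0 + m)) k2 \<subseteq> - path_image ?\<delta>"
      using x0_off openE by (metis ComplI)
    \<comment> \<open>With this accuracy, shadowing \<open>w\<close> brings \<open>u\<close> into
      the box at the \<open>k\<close>-th passage, back to the neighbourhood of the reference point,
      and, since \<open>d\<close> is at most \<open>\<rho> / 2\<close>, within \<open>\<rho>\<close>
      of the model passage.\<close>
    define h where "h = min (min k1 k2) (\<rho> / 2)"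
    have h: "h > 0" "h \<le> k1" "h \<le> k2" "h \<le> \<rho> / 2" using k1(1) k2(1) \<rho>(1) by (auto simp: h_def)
    obtain M where M: "open M" "w \<in> M"
      "\<And>y t. y \<in> M \<Longrightarrow> t \<in> {x0 + m..k + R} \<Longrightarrow> dist (P (\<phi> t y)) (P (\<phi> t w)) < h"
      using nbhd_shadowing[OF cP h(1)] by metis
    \<comment> \<open>Two rounds of shadowing are chosen: the first after all the avoidance
      conditions have set in, the second after the first has completed the \<open>k\<close>-th
      passage.\<close>
    obtain s1 where s1: "s1 \<ge> S1 + (\<tau> - m) - x0 - m" "\<phi> s1 u \<in> M"
      using cluster_setD[OF w M(1,2)] by blast
    obtain s2 where s2: "s2 \<ge> s1 + k - x0 + R - m" "\<phi> s2 u \<in> M"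
      using cluster_setD[OF w M(1,2)] by blast
    have shadow: "dist (z (s + t)) (cw t) < h" if "\<phi> s u \<in> M" "x0 + m \<le> t" "t \<le> k + R" for s t
      using M(3)[OF that(1), of t] that by (simp add: z_def cw_def add.commute)
    have mR: "m \<le> R" using m R by linarith
    have close_k: "dist (z (s1 + k + t)) (c t) < \<rho>" if "m \<le> t" "t \<le> R" for t
    proof -
      have "dist (z (s1 + (k + t))) (cw (k + t)) < h"
        using shadow[OF s1(2), of "k + t"] that order(5) by auto
      moreover have "dist (cw (k + t)) (c t) < d"
        using close[OF Pas(3), of t] that m \<eta>' by auto
      ultimately show ?thesis
        using dist_triangle[of "z (s1 + (k + t))" "c t" "cw (k + t)"] h(4) d(3) \<rho>'(2)
        by (simp add: add.assoc)
    qed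
    have close_x0: "dist (z (s + x0 + m)) (c m) < \<rho>" "dist (z (s + x0 + m)) (cw (x0 + m)) < k2"
      if "\<phi> s u \<in> M" for s
    proof -
      have *: "dist (z (s + (x0 + m))) (cw (x0 + m)) < h"
        using shadow[OF that, of "x0 + m"] order(5) mR by auto
      moreover have "dist (cw (x0 + m)) (c m) < d"
        using close[OF Pas(4), of m] m \<eta>' mR by auto
      ultimately show "dist (z (s + x0 + m)) (c m) < \<rho>"
        using dist_triangle[of "z (s + (x0 + m))" "c m" "cw (x0 + m)"] h(4) d(3) \<rho>'(2)
        by (simp add: add.assoc)
      show "dist (z (s + x0 + m)) (cw (x0 + m)) < k2"
        using * h(3) by (simp add: add.assoc)
    qed
    have m_far: "\<kappa> \<le> dist y (c \<tau>)" if "dist y (c m) < \<rho>" for y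
      using \<kappa>(1,2) \<rho>(2) that dist_triangle3[of "c m" "c \<tau>" y] by linarith
    let ?w = "\<lambda>s. winding_number ?\<delta> (z s)"
    define A where "A = s1 + x0 + m"
    define B1 where "B1 = s1 + k + m"
    define B2 where "B2 = s1 + k + R"
    define A' where "A' = s2 + x0 + m"
    have far: "\<kappa> \<le> dist (z A) (c \<tau>)" "\<kappa> \<le> dist (z B1) (c \<tau>)" "\<kappa> \<le> dist (z B2) (c \<tau>)" "\<kappa> \<le> dist (z A') (c \<tau>)"
      using m_far close_x0(1)[OF s1(2)] close_x0(1)[OF s2(2)] close_k[of m] X.R_far close_k[of R] mR
      by (auto simp: A_def B1_def B2_def A'_def)
    have le: "A \<ge> S1 + (\<tau> - m)" "A \<le> B1" "B1 \<le> B2" "B2 \<le> A'"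
      using s1(1) s2(1) order(5) mR by (auto simp: A_def B1_def B2_def A'_def)
    obtain n1 :: nat where n1: "?w B1 - ?w A = of_nat n1 * \<iota>"
      using X.winding_number_monotone[of A B1] le far by auto
    obtain n2 :: nat where n2: "?w A' - ?w B2 = of_nat n2 * \<iota>"
      using X.winding_number_monotone[of B2 A'] le far by auto
    \<comment> \<open>At time \<open>s1 + k + m\<close> the curve is inside the box, so this passage
      contributes \<open>\<iota>\<close> and not \<open>0\<close>.\<close>
    have jump: "?w B2 - ?w B1 = \<iota>"
    proof -
      have S1k: "s1 + k + m \<ge> S1" using le m by (auto simp: B1_def)
      have "?w (s1 + k + R) - ?w (s1 + k + m) =
          winding_number ?\<gamma> (z (s1 + k + m)) - winding_number ?\<delta> (z (s1 + k + m))"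
        by (rule X.jump[OF S1k close_k]) (use \<eta> mR in auto)
      also have "\<dots> = winding_number ?Q (z (s1 + k + m))"
        by (rule diff_Q[OF S1k]) (use X.G_far[of m] X.H_far[of m] close_k[of m] mR \<eta> in auto)
      also have "\<dots> = \<iota>"
      proof (rule \<iota>(2))
        have "dist (z (s1 + (k + m))) (cw (k + m)) < h"
          using shadow[OF s1(2), of "k + m"] order(5) mR by auto
        then show "z (s1 + k + m) \<in> inside (path_image ?Q)"
          using k1(2) h(2) by (auto simp: subset_iff dist_commute add.assoc)
      qed
      finally show ?thesis by (simp add: B1_def B2_def)
    qed
    have "?w A = ?w A'"
    proof -
      have "winding_number ?\<delta> constant_on ball (cw (x0 + m)) k2"
        using k2(2) by (intro winding_number_constant X.\<delta>) auto
      moreover have "z A \<in> ball (cw (x0 + m)) k2" "z A' \<in> ball (cw (x0 + m)) k2"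
        using close_x0(2)[OF s1(2)] close_x0(2)[OF s2(2)] by (auto simp: A_def A'_def dist_commute)
      ultimately show ?thesis by (metis constant_on_def)
    qed
    \<comment> \<open>The three changes between the two visits to the reference point add up to
      zero, although they are \<open>n1\<close>, \<open>1\<close> and \<open>n2\<close> times the
      same nonzero \<open>\<iota>\<close>.\<close>
    then have "(?w B1 - ?w A) + (?w B2 - ?w B1) + (?w A' - ?w B2) = 0"
      by simp
    then have "of_nat (n1 + n2 + 1) * \<iota> = 0"
      unfolding n1 n2 jump by (simp add: algebra_simps)
    then show False using \<iota>(1) by (metis Suc_eq_plus1 mult_eq_0_iff of_nat_eq_0_iff nat.distinct(1))
  qed
  obtain t1 t2 t3 where t: "t1 + L \<le> t2" "t2 + L \<le> t3" "t1 \<in> Pas" "t2 \<in> Pas" "t3 \<in> Pas"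
    using ret[OF N(1,2), of L] by (auto simp: Pas_def)
  have "L > 0" using m R \<eta>' by (auto simp: L_def)
  \<comment> \<open>The entry points of all passages lie on the line \<open>Re z = l\<close>, so
    their imaginary parts tell which one is in the middle.\<close>
  have seg: "cw (\<alpha> y) \<in> closed_segment (cw (\<alpha> x)) (cw (\<alpha> x'))"
    if "x \<in> Pas" "y \<in> Pas" "x' \<in> Pas" "Im (cw (\<alpha> y)) \<in> closed_segment (Im (cw (\<alpha> x))) (Im (cw (\<alpha> x')))" for x y x'
    using Re_\<alpha>[OF that(1)] Re_\<alpha>[OF that(2)] Re_\<alpha>[OF that(3)] that(4) by (subst closed_segment_same_Re) auto
  consider "Im (cw (\<alpha> t1)) \<in> closed_segment (Im (cw (\<alpha> t3))) (Im (cw (\<alpha> t2)))"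
    | "Im (cw (\<alpha> t2)) \<in> closed_segment (Im (cw (\<alpha> t3))) (Im (cw (\<alpha> t1)))"
    | "Im (cw (\<alpha> t3)) \<in> closed_segment (Im (cw (\<alpha> t2))) (Im (cw (\<alpha> t1)))"
    using real_middle by blast
  then show False
  proof cases
    case 1
    then show False using key[of t2 t3 t1 t1] seg t \<open>L > 0\<close> by auto
  next
    case 2
    then show False using key[of t1 t3 t2 t1] seg t \<open>L > 0\<close> by auto
  next
    case 3
    then show False using key[of t1 t2 t3 t1] seg t \<open>L > 0\<close> by auto
  qed
qed

end

section \<open>Non-equilibrium limit points force periodicity\<close>

lemma cluster_set_image:
  assumes "continuous_on UNIV h" "p \<in> cluster_set f"
  shows "h p \<in> cluster_set (\<lambda>s. h (f s))"
  unfolding mem_cluster_set_iff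
proof (intro allI impI)
  fix U N assume U: "open U" "h p \<in> U"
  have "open (h -` U)" using open_vimage[OF U(1) assms(1)] .
  then show "\<exists>s\<ge>N. h (f s) \<in> U"
    using cluster_setD[OF assms(2), of "h -` U" N] U(2) by auto
qed

lemma periodic_reduce:
  fixes f :: "real \<Rightarrow> 'b"
  assumes "\<And>t. f (t + T) = f t" "T > 0"
  obtains y where "0 \<le> y" "y \<le> T" "f x = f y"
proof -
  have nat: "f (t + real n * T) = f t" for n t
  proof (induction n)
    case (Suc n)
    have "f (t + real (Suc n) * T) = f ((t + real n * T) + T)"
      by (simp add: algebra_simps)
    then show ?case using Suc assms(1) by simp
  qed simp
  have int: "f (t + of_int k * T) = f t" for k t
  proof (cases "k \<ge> 0")
    case True
    then show ?thesis using nat[of t "nat k"] by simp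
  next
    case False
    then show ?thesis using nat[of "t + of_int k * T" "nat (- k)"] by simp
  qed
  define y where "y = x - of_int \<lfloor>x / T\<rfloor> * T"
  have "of_int \<lfloor>x / T\<rfloor> * T \<le> x"
    using assms(2) by (metis of_int_floor_le pos_le_divide_eq)
  moreover have "x < (of_int \<lfloor>x / T\<rfloor> + 1) * T"
    using assms(2) by (metis floor_divide_upper)
  ultimately have "0 \<le> y" "y \<le> T" by (simp_all add: y_def algebra_simps)
  moreover have "f x = f y" using int[of y "\<lfloor>x / T\<rfloor>"] by (simp add: y_def)
  ultimately show thesis by (rule that)
qed

context compact_flow
begin

text \<open>A non-equilibrium \<open>q\<close> has no small periods, so by \<open>uniq\<close> its
  projection is injective for a short time. A rotation and scaling of the plane then makes it move
  to the right.\<close>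

lemma no_three_passages:
  fixes P :: "'a \<Rightarrow> complex"
  assumes cP: "continuous_on UNIV P"
    and w: "w \<in> \<Omega> u"
    and nocoll: "\<And>b. \<exists>C. \<forall>t s. t \<le> b \<longrightarrow> C \<le> s \<longrightarrow> P (\<phi> s u) \<noteq> P (\<phi> t w)"
    and uniq: "\<And>p t. p \<in> \<Omega> u \<Longrightarrow> P p = P (\<phi> t q) \<Longrightarrow> p = \<phi> t q"
    and inj: "\<And>s t. s \<noteq> t \<Longrightarrow> P (\<phi> s w) \<noteq> P (\<phi> t w)"
    and q: "q \<in> \<Omega> u" "q \<notin> equilibria \<phi>"
    and ret: "\<And>U L. open U \<Longrightarrow> q \<in> U \<Longrightarrow>
      \<exists>t1 t2 t3. t1 + L \<le> t2 \<and> t2 + L \<le> t3 \<and> \<phi> t1 w \<in> U \<and> \<phi> t2 w \<in> U \<and> \<phi> t3 w \<in> U"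
  shows False
proof -
  obtain d where d: "d > 0" "\<And>t. 0 < \<bar>t\<bar> \<Longrightarrow> \<bar>t\<bar> < d \<Longrightarrow> \<phi> t q \<noteq> q"
    using no_small_periods[OF q(2)] by blast
  \<comment> \<open>Two times in \<open>{-a..a}\<close> differ by less than
    \<open>d\<close>.\<close>
  define a where "a = d / 3"
  have a: "a > 0" using d(1) by (simp add: a_def)
  have qinj: "P (\<phi> s q) \<noteq> P (\<phi> t q)" if "- a \<le> s" "s \<le> a" "- a \<le> t" "t \<le> a" "s \<noteq> t" for s t
  proof
    assume "P (\<phi> s q) = P (\<phi> t q)"
    then have "\<phi> s q = \<phi> t q" by (rule uniq[OF flow_cluster_set[OF q(1)]])
    then have "\<phi> (- t) (\<phi> s q) = \<phi> (- t) (\<phi> t q)" by (simp del: flow_flow)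
    then have "\<phi> (s - t) q = q" by simp
    moreover have "0 < \<bar>s - t\<bar>" "\<bar>s - t\<bar> < d" using that a by (auto simp: a_def abs_less_iff)
    ultimately show False using d(2) by blast
  qed
  \<comment> \<open>Multiplication by the conjugate sends the displacement from \<open>- a\<close>
    to \<open>a\<close> to a positive real number.\<close>
  define \<zeta> where "\<zeta> = cnj (P (\<phi> a q) - P (\<phi> (- a) q))"
  have \<zeta>: "\<zeta> \<noteq> 0" using qinj[of a "- a"] a by (simp add: \<zeta>_def)
  show False
  proof (rule no_three_passages_oriented[of "\<lambda>x. \<zeta> * P x" w u q a])
    show "continuous_on UNIV (\<lambda>x. \<zeta> * P x)"
      by (intro continuous_intros cP)
    have "\<zeta> * (P (\<phi> a q) - P (\<phi> (- a) q)) = of_real ((cmod \<zeta>)\<^sup>2)"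
      unfolding complex_norm_square by (simp add: \<zeta>_def)
    then have "Re (\<zeta> * (P (\<phi> a q) - P (\<phi> (- a) q))) = (cmod \<zeta>)\<^sup>2"
      by (metis Re_complex_of_real)
    moreover have "(cmod \<zeta>)\<^sup>2 > 0" using \<zeta> by simp
    ultimately show "Re (\<zeta> * P (\<phi> (- a) q)) < Re (\<zeta> * P (\<phi> a q))"
      unfolding right_diff_distrib minus_complex.sel by linarith
    show "\<exists>C. \<forall>t s. t \<le> b \<longrightarrow> C \<le> s \<longrightarrow> \<zeta> * P (\<phi> s u) \<noteq> \<zeta> * P (\<phi> t w)" for b
      using nocoll[of b] \<zeta> by simp
    show "p = \<phi> t q" if "p \<in> \<Omega> u" "\<zeta> * P p = \<zeta> * P (\<phi> t q)" for p t
      using uniq[OF that(1)] that(2) \<zeta> by simp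
    show "\<zeta> * P (\<phi> s w) \<noteq> \<zeta> * P (\<phi> t w)" if "s \<noteq> t" for s t
      using inj[OF that] \<zeta> by simp
    show "\<zeta> * P (\<phi> s q) \<noteq> \<zeta> * P (\<phi> t q)" if "- a \<le> s" "s \<le> a" "- a \<le> t" "t \<le> a" "s \<noteq> t" for s t
      using qinj[OF that] \<zeta> by simp
  qed (use w a ret in auto)
qed

lemma orbit_periodic:
  assumes "T > 0" "\<phi> T q = q"
  shows "orbit \<phi> q = (\<lambda>s. \<phi> s q) ` {0..T}"
proof -
  have "\<phi> (t + T) q = \<phi> t q" for t
    using flow_flow[of t T q] assms(2) by simp
  then have "\<phi> s q \<in> (\<lambda>s. \<phi> s q) ` {0..T}" for s
  proof -
    obtain y where "0 \<le> y" "y \<le> T" "\<phi> s q = \<phi> y q"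
      using periodic_reduce[of "\<lambda>s. \<phi> s q" T s, OF \<open>\<And>t. \<phi> (t + T) q = \<phi> t q\<close> assms(1)] by metis
    then show ?thesis by auto
  qed
  then show ?thesis by (auto simp: orbit_def)
qed

lemma compact_orbit_periodic:
  assumes "T > 0" "\<phi> T q = q"
  shows "compact (orbit \<phi> q)"
  unfolding orbit_periodic[OF assms]
  by (intro compact_continuous_image continuous_intros compact_Icc)

lemma self_in_orbit: "x \<in> orbit \<phi> x"
  unfolding orbit_def by (metis flow_0 rangeI)

lemma flow_in_orbit: "x \<in> orbit \<phi> q \<Longrightarrow> \<phi> t x \<in> orbit \<phi> q"
  by (auto simp: orbit_def)

lemma reverse_cluster_set_subset: "cluster_set (\<lambda>s. \<phi> (- s) w) \<subseteq> closure (orbit \<phi> w)"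
  by (rule cluster_set_subset_closed[OF closed_closure]) (rule subsetD[OF closure_subset], simp add: orbit_def)

end

context pb_flow
begin

text \<open>Everything reduces to the hypotheses of \<open>no_three_passages\<close>. If
  \<open>w\<close> is recurrent in backward time, avoidance and uniqueness follow from injectivity
  of \<open>P\<close> on the closure of its own orbit. Otherwise they come from
  \<open>eventually_no_crossing\<close> and \<open>cluster_closure_orbit_notin_S\<close>.\<close>

lemma periodic_if_limit_not_equilibrium:
  assumes w: "w \<in> \<Omega> u" and x: "x \<in> \<Omega> w \<union> cluster_set (\<lambda>s. \<phi> (- s) w)" "x \<notin> equilibria \<phi>"
  shows "\<exists>T>0. \<phi> T w = w"
proof (rule ccontr)
  assume neg: "\<not> (\<exists>T>0. \<phi> T w = w)"
  have np: "\<phi> T w \<noteq> w" if "T \<noteq> 0" for T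
  proof
    assume eq: "\<phi> T w = w"
    then have "\<phi> (- T) (\<phi> T w) = \<phi> (- T) w" by (rule arg_cong)
    then have "\<phi> (- T) w = w" by simp
    then have "\<phi> \<bar>T\<bar> w = w" using eq by (simp add: abs_if)
    then show False using neg that by (metis zero_less_abs_iff)
  qed
  let ?K = "closure (orbit \<phi> w)"
  have inj: "P (\<phi> s w) \<noteq> P (\<phi> t w)" if "s \<noteq> t" for s t
  proof
    assume "P (\<phi> s w) = P (\<phi> t w)"
    then have "\<phi> s w = \<phi> t w"
      by (intro P_inj_closure_orbit[OF w] subsetD[OF closure_subset]) (auto simp: orbit_def)
    then have "\<phi> (- t) (\<phi> s w) = \<phi> (- t) (\<phi> t w)" by (simp del: flow_flow)
    then show False using np[of "s - t"] that by simp
  qed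
  have x_K: "x \<in> ?K"
    using x(1) cluster_set_subset_closure_orbit reverse_cluster_set_subset by blast
  show False
  proof (cases "w \<in> cluster_set (\<lambda>s. \<phi> (- s) w)")
    case True
    interpret R: compact_flow "\<lambda>s. \<phi> (- s)" by (rule reverse)
    show False
    proof (rule R.no_three_passages[OF continuous_P True])
      show "\<exists>C. \<forall>t s. t \<le> b \<longrightarrow> C \<le> s \<longrightarrow> P (\<phi> (- s) w) \<noteq> P (\<phi> (- t) w)" for b
        by (intro exI[of _ "b + 1"] allI impI inj) auto
      show "p = \<phi> (- t) w" if "p \<in> cluster_set (\<lambda>s. \<phi> (- s) w)" "P p = P (\<phi> (- t) w)" for p t
      proof (rule P_inj_closure_orbit[OF w _ _ that(2)])
        show "p \<in> closure (orbit \<phi> w)" using that(1) reverse_cluster_set_subset by blast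
        show "\<phi> (- t) w \<in> closure (orbit \<phi> w)"
          by (rule subsetD[OF closure_subset]) (simp add: orbit_def)
      qed
      show "P (\<phi> (- s) w) \<noteq> P (\<phi> (- t) w)" if "s \<noteq> t" for s t
        using inj that by simp
      show "w \<notin> equilibria (\<lambda>s. \<phi> (- s))"
        using np[of "- 1"] by (auto simp: equilibria_def)
      fix U :: "'a set" and L :: real assume U: "open U" "w \<in> U"
      obtain t1 where t1: "\<phi> (- t1) w \<in> U" using cluster_setD[OF True U] by blast
      obtain t2 where t2: "t1 + L \<le> t2" "\<phi> (- t2) w \<in> U" using cluster_setD[OF True U] by blast
      obtain t3 where t3: "t2 + L \<le> t3" "\<phi> (- t3) w \<in> U" using cluster_setD[OF True U] by blast
      show "\<exists>t1 t2 t3. t1 + L \<le> t2 \<and> t2 + L \<le> t3 \<and> \<phi> (- t1) w \<in> U \<and> \<phi> (- t2) w \<in> U \<and> \<phi> (- t3) w \<in> U"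
        using t1 t2 t3 by blast
    qed (rule True)
  next
    case False
    obtain k where k: "\<And>x y. x \<in> ?K \<Longrightarrow> y \<in> ?K \<Longrightarrow> x \<noteq> y \<Longrightarrow> W (x, y) = k"
      using W_level_closure_orbit[OF w np] by blast
    obtain C where C: "\<And>s t. s \<ge> C \<Longrightarrow> s \<ge> t + C \<Longrightarrow> (\<phi> s u, \<phi> t w) \<notin> S \<and> W (\<phi> s u, \<phi> t w) = k"
      using eventually_no_crossing[OF w np k False] by blast
    show False
    proof (rule no_three_passages[OF continuous_P w _ _ inj _ x(2)])
      show "\<exists>C. \<forall>t s. t \<le> b \<longrightarrow> C \<le> s \<longrightarrow> P (\<phi> s u) \<noteq> P (\<phi> t w)" for b
      proof (intro exI[of _ "max C (b + C)"] allI impI)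
        fix t s assume "t \<le> b" "max C (b + C) \<le> s"
        then have "(\<phi> s u, \<phi> t w) \<notin> S" using C[of s t] by auto
        then show "P (\<phi> s u) \<noteq> P (\<phi> t w)" using P_eq by blast
      qed
      show "p = \<phi> t x" if "p \<in> \<Omega> u" "P p = P (\<phi> t x)" for p t
        using cluster_closure_orbit_notin_S[OF w np False that(1) flow_closure_orbit[OF x_K]] P_eq[OF that(2)]
        by blast
      show "x \<in> \<Omega> u" using x_K closure_orbit_subset_cluster_set[OF w] by blast
      fix U :: "'a set" and L :: real assume U: "open U" "x \<in> U"
      show "\<exists>t1 t2 t3. t1 + L \<le> t2 \<and> t2 + L \<le> t3 \<and> \<phi> t1 w \<in> U \<and> \<phi> t2 w \<in> U \<and> \<phi> t3 w \<in> U"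
      proof (cases "x \<in> \<Omega> w")
        case True
        obtain t1 where t1: "\<phi> t1 w \<in> U" using cluster_setD[OF True U] by blast
        obtain t2 where t2: "t1 + L \<le> t2" "\<phi> t2 w \<in> U" using cluster_setD[OF True U] by blast
        obtain t3 where t3: "t2 + L \<le> t3" "\<phi> t3 w \<in> U" using cluster_setD[OF True U] by blast
        show ?thesis using t1 t2 t3 by blast
      next
        case False
        then have x': "x \<in> cluster_set (\<lambda>s. \<phi> (- s) w)" using x(1) by blast
        \<comment> \<open>Backward times are found in reverse order, so the passage found first is
          the last one in forward time.\<close>
        obtain t3 where t3: "\<phi> (- t3) w \<in> U" using cluster_setD[OF x' U] by blast
        obtain t2 where t2: "t3 + L \<le> t2" "\<phi> (- t2) w \<in> U" using cluster_setD[OF x' U] by blast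
        obtain t1 where t1: "t2 + L \<le> t1" "\<phi> (- t1) w \<in> U" using cluster_setD[OF x' U] by blast
        show ?thesis using t1 t2 t3 by (intro exI[of _ "- t1"] exI[of _ "- t2"] exI[of _ "- t3"]) auto
      qed
    qed
  qed
qed

section \<open>Periodic orbits in the limit set\<close>

text \<open>Pairing the orbit of \<open>u\<close> with that of \<open>q\<close> gives a limit pair
  \<open>(p, x0)\<close> with \<open>x0\<close> on the periodic orbit, and a change of phase moves
  \<open>x0\<close> to any other point of it. If \<open>u\<close> itself is on this orbit,
  \<open>orbit_pairs\<close> applies.\<close>

lemma periodic_orbit_pairs:
  assumes q: "q \<in> \<Omega> u" "T > 0" "\<phi> T q = q" and px: "p \<in> \<Omega> u" "x \<in> orbit \<phi> q" "p \<noteq> x"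
  shows "(p, x) \<notin> S"
proof (cases "u \<in> orbit \<phi> q")
  case True
  have closed: "closed (orbit \<phi> q)"
    using compact_orbit_periodic[OF q(2,3)] by (rule compact_imp_closed)
  have "\<Omega> u \<subseteq> orbit \<phi> q"
    by (rule cluster_set_subset_closed[OF closed]) (rule flow_in_orbit[OF True])
  then have "p \<in> orbit \<phi> q" using px(1) by blast
  then show ?thesis
    using orbit_pairs[OF q(1)] px(2,3) by (auto simp: orbit_def)
next
  case False
  obtain x0 where x0: "(p, x0) \<in> cluster_set (\<lambda>s. (\<phi> s u, \<phi> s q))"
    using cluster_set_Pair[OF compact_UNIV compact_UNIV px(1), of "\<lambda>s. \<phi> s q"] by blast
  have closed: "closed (UNIV \<times> orbit \<phi> q)"
    using compact_orbit_periodic[OF q(2,3)] by (intro closed_Times closed_UNIV compact_imp_closed)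
  have "cluster_set (\<lambda>s. (\<phi> s u, \<phi> s q)) \<subseteq> UNIV \<times> orbit \<phi> q"
    by (rule cluster_set_subset_closed[OF closed]) (auto simp: orbit_def)
  then obtain a where a: "x0 = \<phi> a q" using x0 by (auto simp: orbit_def)
  obtain b where b: "x = \<phi> b q" using px(2) by (auto simp: orbit_def)
  define v where "v = \<phi> (b - a) q"
  have x: "\<phi> (b - a) x0 = x" by (simp add: a b)
  have "(\<lambda>z. (fst z, \<phi> (b - a) (snd z))) (p, x0) \<in>
      cluster_set (\<lambda>s. (\<lambda>z. (fst z, \<phi> (b - a) (snd z))) (\<phi> s u, \<phi> s q))"
    by (rule cluster_set_image[OF _ x0]) (intro continuous_intros)
  then have "(p, x) \<in> cluster_set (\<lambda>s. (\<phi> s u, \<phi> s v))"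
    by (simp add: x v_def add.commute)
  moreover have "u \<noteq> v" using False by (auto simp: v_def orbit_def)
  ultimately show ?thesis
    using cluster_pair_notin_S px(3) by blast
qed

text \<open>\<open>W\<close> has one value \<open>k\<close> on all pairs of \<open>p\<close> with
  the periodic orbit, and by the tube lemma on their neighbours. As \<open>u\<close> returns near
  \<open>p\<close> again and again, \<open>W\<close> is \<open>k\<close> before and after any later
  time, which leaves no drop.\<close>

lemma eventually_off_periodic_orbit:
  assumes q: "q \<in> \<Omega> u" "T > 0" "\<phi> T q = q" and p: "p \<in> \<Omega> u" "p \<notin> orbit \<phi> q"
  obtains C where "\<And>s x. s \<ge> C \<Longrightarrow> x \<in> orbit \<phi> q \<Longrightarrow> (\<phi> s u, x) \<notin> S"
proof -
  define k where "k = W (p, q)"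
  have off: "(p, x) \<notin> S" if "x \<in> orbit \<phi> q" for x
    using periodic_orbit_pairs[OF q p(1) that] that p(2) by blast
  let ?L = "{z. z \<notin> S \<and> W z = k}"
  have "W (p, \<phi> t q) = W (p, \<phi> 0 q)" for t
  proof (rule int_valued_constant_on_real[of UNIV "\<lambda>t. W (p, \<phi> t q)"])
    show "continuous_on UNIV (\<lambda>t. W (p, \<phi> t q))"
      using off by (intro continuous_on_compose2[OF W_cont] continuous_intros) (auto simp: orbit_def)
  qed auto
  then have "W (p, x) = k" if "x \<in> orbit \<phi> q" for x
    using that by (auto simp: orbit_def k_def)
  then have "{p} \<times> orbit \<phi> q \<subseteq> ?L"
    using off by auto
  then obtain V where V: "p \<in> V" "open V" "V \<times> orbit \<phi> q \<subseteq> ?L"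
    using Elementary_Topology.tube_lemma[of "orbit \<phi> q" ?L p] compact_orbit_periodic[OF q(2,3)]
      open_W_level by auto
  obtain s1 where s1: "\<phi> s1 u \<in> V"
    using cluster_setD[OF p(1) V(2,1)] by blast
  show thesis
  proof (rule that[of s1])
    fix s x assume s: "s \<ge> s1" and x: "x \<in> orbit \<phi> q"
    \<comment> \<open>This is the point of the periodic orbit that the flow carries to
      \<open>x\<close> between the times \<open>s1\<close> and \<open>s\<close>.\<close>
    define y where "y = \<phi> (s1 - s) x"
    have y: "y \<in> orbit \<phi> q" unfolding y_def by (rule flow_in_orbit[OF x])
    obtain s2 where s2: "s2 \<ge> s + 1" "\<phi> s2 u \<in> V"
      using cluster_setD[OF p(1) V(2,1)] by blast
    have L1: "(\<phi> s1 u, y) \<in> ?L" using V(3) s1 y by blast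
    have "(\<phi> s2 u, \<phi> (s2 - s1) y) \<in> ?L" using V(3) s2(2) flow_in_orbit[OF y] by blast
    then have L2: "(\<phi> (s2 - s1) (\<phi> s1 u), \<phi> (s2 - s1) y) \<in> ?L" by simp
    have ne: "\<phi> s1 u \<noteq> y" using L1 diag_S by auto
    show "(\<phi> s u, x) \<notin> S"
    proof
      assume hit: "(\<phi> s u, x) \<in> S"
      have "s \<noteq> s1" using hit L1 by (auto simp: y_def)
      then have "0 < s - s1" "s - s1 < s2 - s1" using s s2(1) by auto
      moreover have "(\<phi> (s - s1) (\<phi> s1 u), \<phi> (s - s1) y) \<in> S"
        using hit by (simp add: y_def)
      ultimately have "W (\<phi> 0 (\<phi> s1 u), \<phi> 0 y) > W (\<phi> (s2 - s1) (\<phi> s1 u), \<phi> (s2 - s1) y)"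
        using L1 L2 by (intro W_drop[OF ne, of 0 "s - s1" "s2 - s1"]) auto
      then show False using L1 L2 by simp
    qed
  qed
qed

text \<open>A late part of the projected orbit of \<open>u\<close> is connected and misses the
  closed curve, so it cannot come near points on both sides of it.\<close>

lemma periodic_orbit_same_side:
  assumes q: "q \<in> \<Omega> u" "T > 0" "\<phi> T q = q"
    and p: "p \<in> \<Omega> u" "p \<notin> orbit \<phi> q" and p': "p' \<in> \<Omega> u" "p' \<notin> orbit \<phi> q"
    and inside: "P p \<in> inside (P ` orbit \<phi> q)"
  shows "P p' \<in> inside (P ` orbit \<phi> q)"
proof (rule ccontr)
  let ?G = "P ` orbit \<phi> q"
  assume neg: "P p' \<notin> inside ?G"
  have "compact ?G"
    using compact_orbit_periodic[OF q(2,3)] continuous_on_subset[OF continuous_P]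
    by (intro compact_continuous_image) auto
  then have G: "closed ?G" by (rule compact_imp_closed)
  obtain C where C: "\<And>s x. s \<ge> C \<Longrightarrow> x \<in> orbit \<phi> q \<Longrightarrow> (\<phi> s u, x) \<notin> S"
    using eventually_off_periodic_orbit[OF q p] by blast
  let ?R = "(\<lambda>s. P (\<phi> s u)) ` {C..}"
  have conn: "connected ?R"
    by (intro connected_continuous_image continuous_on_compose2[OF continuous_P] continuous_intros) auto
  have off: "?R \<inter> ?G = {}"
    using C P_eq by force
  have "P p' \<notin> ?G"
    using periodic_orbit_pairs[OF q p'(1)] p'(2) P_eq by blast
  then have out: "P p' \<in> outside ?G"
    using neg inside_Un_outside[of ?G] by blast
  have vim: "open (P -` inside ?G)" "open (P -` outside ?G)"
    using open_inside[OF G] open_outside[OF G] continuous_P by (auto intro!: open_vimage)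
  obtain s where s: "s \<ge> C" "\<phi> s u \<in> P -` inside ?G"
    using cluster_setD[OF p(1) vim(1)] inside by blast
  obtain t where t: "t \<ge> C" "\<phi> t u \<in> P -` outside ?G"
    using cluster_setD[OF p'(1) vim(2)] out by blast
  have "?R \<subseteq> inside ?G"
    by (rule connected_subset_inside[OF G conn off, of "P (\<phi> s u)"]) (use s in auto)
  then have "P (\<phi> t u) \<in> inside ?G" using t(1) by auto
  then show False using t(2) inside_Int_outside[of ?G] by blast
qed

text \<open>\<open>P\<close> is injective on the orbit, so a coincidence other than at the end
  points would give a period smaller than \<open>T\<close>.\<close>

lemma periodic_orbit_simple_path:
  assumes q: "q \<in> \<Omega> u" and T: "T > 0" "\<phi> T q = q" "\<And>t. 0 < t \<Longrightarrow> t < T \<Longrightarrow> \<phi> t q \<noteq> q"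
  defines "g \<equiv> arc_between (\<lambda>t. P (\<phi> t q)) 0 T"
  shows "simple_path g" "pathfinish g = pathstart g" "path_image g = P ` orbit \<phi> q"
proof -
  have cont: "continuous_on UNIV (\<lambda>t. P (\<phi> t q))"
    by (intro continuous_on_compose2[OF continuous_P] continuous_intros) auto
  have same: "a = b \<or> a = 0 \<and> b = T \<or> a = T \<and> b = 0"
    if "0 \<le> a" "a \<le> T" "0 \<le> b" "b \<le> T" "P (\<phi> a q) = P (\<phi> b q)" for a b
  proof -
    have eq: "\<phi> a q = \<phi> b q"
      by (rule P_inj_closure_orbit[OF q _ _ that(5)])
         (auto intro!: subsetD[OF closure_subset] simp: orbit_def)
    then have "\<phi> (- a) (\<phi> a q) = \<phi> (- a) (\<phi> b q)" "\<phi> (- b) (\<phi> a q) = \<phi> (- b) (\<phi> b q)"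
      by (simp_all del: flow_flow)
    then have "\<phi> (b - a) q = q" "\<phi> (a - b) q = q" by simp_all
    then show ?thesis
      using T(3)[of "b - a"] T(3)[of "a - b"] that(1-4) by (cases a b rule: linorder_cases) force+
  qed
  show "simple_path g"
    unfolding simple_path_def loop_free_def g_def
  proof (intro conjI ballI impI path_arc_between[OF cont])
    fix x y :: real assume xy: "x \<in> {0..1}" "y \<in> {0..1}"
      "arc_between (\<lambda>t. P (\<phi> t q)) 0 T x = arc_between (\<lambda>t. P (\<phi> t q)) 0 T y"
    have "T * x \<le> T" "T * y \<le> T" "0 \<le> T * x" "0 \<le> T * y"
      using xy(1,2) T(1) by (auto simp: mult_left_le)
    then show "x = y \<or> x = 0 \<and> y = 1 \<or> x = 1 \<and> y = 0"
      using same[of "T * x" "T * y"] xy(3) T(1) by (auto simp: arc_between_def)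
  qed
  show "pathfinish g = pathstart g"
    using T(2) by (simp add: g_def)
  show "path_image g = P ` orbit \<phi> q"
    using T(1) by (simp add: g_def path_image_arc_between orbit_periodic[OF T(1,2)] image_image)
qed

end

section \<open>Nearby periodic orbits\<close>

text \<open>The function takes values in the multiples of \<open>2 * pi * \<i>\<close>, a discrete
  set.\<close>

lemma exp_eq_1_constant_on:
  fixes h :: "'b::topological_space \<Rightarrow> complex"
  assumes "connected S" "continuous_on S h" "\<And>x. x \<in> S \<Longrightarrow> exp (h x) = 1"
  shows "h constant_on S"
proof (rule continuous_discrete_range_constant[OF assms(1,2)])
  fix x assume x: "x \<in> S"
  have "1 \<le> norm (h y - h x)" if "y \<in> S" "h y \<noteq> h x" for y
  proof -
    have "exp (h y) = exp (h x)" using assms(3) x that by simp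
    then obtain n :: int where n: "h y = h x + (of_int (2 * n) * pi) * \<i>"
      unfolding exp_eq by blast
    then have "n \<noteq> 0" using that(2) by auto
    have "norm (h y - h x) = \<bar>of_int (2 * n)\<bar> * pi"
      unfolding n by (simp add: norm_mult)
    moreover have "\<bar>of_int (2 * n)\<bar> \<ge> (1::real)" using \<open>n \<noteq> 0\<close> by linarith
    ultimately show ?thesis using pi_ge_two mult_mono[of 1 "\<bar>of_int (2 * n)\<bar>" 1 pi] by simp
  qed
  then show "\<exists>e>0. \<forall>y. y \<in> S \<and> h y \<noteq> h x \<longrightarrow> e \<le> norm (h y - h x)"
    by (intro exI[of _ 1]) auto
qed

text \<open>Two continuous logarithms of one curve differ by a constant, so any of them measures the
  winding number.\<close>

lemma winding_number_arc_between_log: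
  assumes c: "continuous_on UNIV c" and L: "continuous_on UNIV L" "\<And>t. c t = \<zeta> + exp (L t)"
  shows "L b - L a = 2 * of_real pi * \<i> * winding_number (arc_between c a b) \<zeta>"
proof -
  let ?p = "arc_between c a b"
  have "\<zeta> \<notin> path_image ?p"
    using L(2) by (auto simp: path_image_def arc_between_def)
  then obtain g where g: "path g" "pathfinish g - pathstart g = 2 * of_real pi * \<i> * winding_number ?p \<zeta>"
    "\<And>t. t \<in> {0..1} \<Longrightarrow> ?p t = \<zeta> + exp (g t)"
    using winding_number_as_continuous_log[OF path_arc_between[OF c]] by metis
  let ?h = "\<lambda>t. L (a + (b - a) * t) - g t"
  have "continuous_on {0..1} ?h"
    using g(1) unfolding path_def
    by (intro continuous_intros continuous_on_compose2[OF L(1)]) auto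
  moreover have "exp (?h t) = 1" if "t \<in> {0..1}" for t
  proof -
    have "exp (L (a + (b - a) * t)) = exp (g t)"
      using g(3)[OF that] L(2)[of "a + (b - a) * t"] by (simp add: arc_between_def)
    then show ?thesis by (simp add: exp_diff)
  qed
  ultimately have "?h constant_on {0..1}"
    by (intro exp_eq_1_constant_on) auto
  then obtain k where k: "\<And>t. t \<in> {0..1} \<Longrightarrow> ?h t = k"
    unfolding constant_on_def by blast
  have "L b - L a = g 1 - g 0" using k[of 0] k[of 1] by (simp add: algebra_simps)
  then show ?thesis using g(2) by (simp add: pathstart_def pathfinish_def)
qed

text \<open>Along a curve shadowing one turn of a loop that winds around the point, the argument
  increases by at least a half turn; hence it cannot be periodic.\<close>

lemma winding_number_shadowing_nonzero:
  fixes g v :: "real \<Rightarrow> complex"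
  assumes g: "continuous_on UNIV g" "\<And>t. g (t + T) = g t" "T > 0" "\<And>t. g t \<noteq> \<zeta>"
    and v: "continuous_on UNIV v" "\<And>t. v (t + T') = v t" "T' > 0"
    and close: "\<And>t. \<exists>\<theta>. \<forall>s\<in>{0..T}. dist (v (t + s)) (g (\<theta> + s)) < dist (g (\<theta> + s)) \<zeta>"
    and \<iota>: "winding_number (arc_between g 0 T) \<zeta> = of_real \<iota>" "\<bar>\<iota>\<bar> = 1"
  shows "winding_number (arc_between v 0 T') \<zeta> \<noteq> 0"
proof
  assume zero: "winding_number (arc_between v 0 T') \<zeta> = 0"
  have v_ne: "v t \<noteq> \<zeta>" for t
  proof
    assume "v t = \<zeta>"
    then show False using close[of t] g(3) by (auto dest!: bspec[of _ _ 0] simp: dist_commute)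
  qed
  have lift: "\<exists>L. continuous_on UNIV L \<and> (\<forall>t. c t = \<zeta> + exp (L t))"
    if c: "continuous_on UNIV c" and ne: "\<And>t. c t \<noteq> \<zeta>" for c :: "real \<Rightarrow> complex"
  proof -
    have 1: "continuous_on UNIV (\<lambda>t. c t - \<zeta>)" by (intro continuous_intros c)
    have 2: "contractible (UNIV :: real set)" by (rule convex_imp_contractible[OF convex_UNIV])
    have 3: "c t - \<zeta> \<noteq> 0" for t using ne by simp
    obtain L where "continuous_on UNIV L" "\<And>t. t \<in> UNIV \<Longrightarrow> c t - \<zeta> = exp (L t)"
      using continuous_logarithm_on_contractible[OF 1 2 3] by metis
    then show ?thesis by (intro exI[of _ L]) (auto simp: algebra_simps)
  qed
  obtain G where G: "continuous_on UNIV G" "\<And>t. g t = \<zeta> + exp (G t)"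
    using lift[OF g(1) g(4)] by blast
  obtain L where L: "continuous_on UNIV L" "\<And>t. v t = \<zeta> + exp (L t)"
    using lift[OF v(1) v_ne] by blast
  have shift: "h (t + p) - h t = h p - h 0"
    if h: "continuous_on UNIV h" "\<And>t. exp (h (t + p)) = exp (h t)" for h :: "real \<Rightarrow> complex" and t p
  proof -
    have "(\<lambda>t. h (t + p) - h t) constant_on UNIV"
    proof (rule exp_eq_1_constant_on)
      show "continuous_on UNIV (\<lambda>t. h (t + p) - h t)"
        by (intro continuous_intros continuous_on_compose2[OF h(1)] h(1)) auto
    qed (auto simp: exp_diff h(2))
    then obtain k where "\<And>t. h (t + p) - h t = k"
      unfolding constant_on_def by auto
    from this[of t] this[of 0] show ?thesis by simp
  qed
  have G_shift: "Im (G (t + T) - G t) = 2 * pi * \<iota>" for t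
  proof -
    have "exp (G (s + T)) = exp (G s)" for s
      using g(2)[of s] G(2)[of s] G(2)[of "s + T"] by simp
    then have "G (t + T) - G t = G T - G 0"
      by (rule shift[OF G(1)])
    also have "\<dots> = 2 * of_real pi * \<i> * of_real \<iota>"
      using winding_number_arc_between_log[OF g(1) G, of T 0] \<iota>(1) by simp
    finally show ?thesis by simp
  qed
  have L_shift: "L (t + T') = L t" for t
  proof -
    have "exp (L (s + T')) = exp (L s)" for s
      using v(2)[of s] L(2)[of s] L(2)[of "s + T'"] by simp
    then have "L (t + T') - L t = L T' - L 0"
      by (rule shift[OF L(1)])
    also have "\<dots> = 0"
      using winding_number_arc_between_log[OF v(1) L, of T' 0] zero by simp
    finally show ?thesis by simp
  qed
  have turn: "\<bar>Im (L (t + T) - L t) - 2 * pi * \<iota>\<bar> < pi" for t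
  proof -
    obtain \<theta> where \<theta>: "\<And>s. s \<in> {0..T} \<Longrightarrow> dist (v (t + s)) (g (\<theta> + s)) < dist (g (\<theta> + s)) \<zeta>"
      using close[of t] by blast
    \<comment> \<open>The closeness assumption places this quotient in the right half-plane. There
      the principal logarithm is continuous with imaginary part between \<open>- pi / 2\<close> and
      \<open>pi / 2\<close>, so the two arguments change by amounts that differ by less than
      \<open>pi\<close>.\<close>
    define \<rho> where "\<rho> s = (v (t + s) - \<zeta>) / (g (\<theta> + s) - \<zeta>)" for s
    have Re_pos: "Re (\<rho> s) > 0" if "s \<in> {0..T}" for s
    proof -
      have ne: "g (\<theta> + s) - \<zeta> \<noteq> 0" using g(4) by simp
      have "\<rho> s - 1 = (v (t + s) - g (\<theta> + s)) / (g (\<theta> + s) - \<zeta>)"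
        unfolding \<rho>_def using ne by (simp add: field_simps)
      then have "norm (\<rho> s - 1) < 1"
        using \<theta>[OF that] ne by (simp add: norm_divide dist_norm)
      then have "\<bar>Re (\<rho> s - 1)\<bar> < 1" using abs_Re_le_cmod[of "\<rho> s - 1"] by linarith
      then show ?thesis by simp
    qed
    have cont_\<rho>: "continuous_on {0..T} \<rho>"
      unfolding \<rho>_def using g(4)
      by (intro continuous_intros continuous_on_compose2[OF v(1)] continuous_on_compose2[OF g(1)]) auto
    let ?h = "\<lambda>s. L (t + s) - G (\<theta> + s) - Ln (\<rho> s)"
    have "?h constant_on {0..T}"
    proof (rule exp_eq_1_constant_on)
      show "continuous_on {0..T} ?h"
        using Re_pos
        by (intro continuous_intros continuous_on_compose2[OF L(1)] continuous_on_compose2[OF G(1)] cont_\<rho>)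
           (force simp: complex_nonpos_Reals_iff)+
      show "exp (?h s) = 1" if "s \<in> {0..T}" for s
      proof -
        have "\<rho> s \<noteq> 0" using Re_pos[OF that] by auto
        moreover have "\<rho> s = exp (L (t + s)) / exp (G (\<theta> + s))"
          by (simp add: \<rho>_def L(2) G(2))
        ultimately show ?thesis by (simp add: exp_diff)
      qed
    qed simp
    then obtain k where k: "\<And>s. s \<in> {0..T} \<Longrightarrow> ?h s = k"
      unfolding constant_on_def by blast
    have "?h T = ?h 0" using k[of 0] k[of T] g(3) by simp
    then have "L (t + T) - L t = G (\<theta> + T) - G \<theta> + (Ln (\<rho> T) - Ln (\<rho> 0))"
      by (simp add: algebra_simps)
    then have "Im (L (t + T) - L t) - 2 * pi * \<iota> = Im (Ln (\<rho> T)) - Im (Ln (\<rho> 0))"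
      using G_shift[of \<theta>] by simp
    moreover have "\<bar>Im (Ln (\<rho> s))\<bar> < pi / 2" if "s \<in> {0..T}" for s
    proof -
      have "\<rho> s \<noteq> 0" using Re_pos[OF that] by (metis less_irrefl zero_complex.sel(1))
      then show ?thesis using Re_Ln_pos_lt[of "\<rho> s"] Re_pos[OF that] by simp
    qed
    then have "\<bar>Im (Ln (\<rho> T))\<bar> < pi / 2" "\<bar>Im (Ln (\<rho> 0))\<bar> < pi / 2"
      using g(3) by auto
    ultimately show ?thesis by linarith
  qed
  \<comment> \<open>The factor \<open>\<iota>\<close> makes the argument increase by more than
    \<open>pi\<close> over each time \<open>T\<close>, while zero winding makes it periodic; so it
    attains a maximum, which the next turn exceeds.\<close>
  let ?f = "\<lambda>t. \<iota> * Im (L t)"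
  have step: "?f (t + T) > ?f t" for t
  proof -
    have "\<iota> = 1 \<or> \<iota> = -1" using \<iota>(2) by linarith
    then show ?thesis using turn[of t] pi_gt_zero by (auto simp: abs_less_iff)
  qed
  have "continuous_on {0..T'} ?f"
    by (intro continuous_intros continuous_on_subset[OF L(1)]) auto
  then obtain x where x: "x \<in> {0..T'}" "\<And>y. y \<in> {0..T'} \<Longrightarrow> ?f y \<le> ?f x"
    using continuous_attains_sup[of "{0..T'}" ?f] v(3) by auto
  obtain y where "0 \<le> y" "y \<le> T'" "L (x + T) = L y"
    using periodic_reduce[of L T', OF L_shift v(3)] by metis
  then show False using x(2)[of y] step[of x] by auto
qed

text \<open>If one curve lies inside another, the outside of the latter is connected, unbounded and
  disjoint from the former, hence outside it. In both directions this gives equal outsides and so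
  equal frontiers, but no curve lies inside itself.\<close>

lemma not_mutually_inside:
  fixes g h :: "real \<Rightarrow> complex"
  assumes g: "simple_path g" "pathfinish g = pathstart g" and h: "simple_path h" "pathfinish h = pathstart h"
    and gh: "path_image g \<subseteq> inside (path_image h)" and hg: "path_image h \<subseteq> inside (path_image g)"
  shows False
proof -
  have "outside (path_image a) \<subseteq> outside (path_image b)"
    if a: "simple_path a" "pathfinish a = pathstart a" and b: "simple_path b"
      and ba: "path_image b \<subseteq> inside (path_image a)" for a b :: "real \<Rightarrow> complex"
  proof (rule ccontr)
    from Jordan_inside_outside[OF a]
    have J: "connected (outside (path_image a))" "\<not> bounded (outside (path_image a))"
      by blast+
    have b_cl: "closed (path_image b)" "bounded (inside (path_image b))"
      using b by (auto intro!: closed_path_image bounded_inside bounded_path_image simple_path_imp_path)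
    have disj: "outside (path_image a) \<inter> path_image b = {}"
      using ba inside_Int_outside[of "path_image a"] by blast
    assume "\<not> outside (path_image a) \<subseteq> outside (path_image b)"
    then obtain z where z: "z \<in> outside (path_image a)" "z \<notin> outside (path_image b)" by blast
    then have "z \<in> inside (path_image b)"
      using disj inside_Un_outside[of "path_image b"] by blast
    from connected_subset_inside[OF b_cl(1) J(1) disj z(1) this]
    show False using J(2) b_cl(2) bounded_subset by blast
  qed
  then have "outside (path_image g) = outside (path_image h)"
    using assms by blast
  then have "path_image g = path_image h"
    using Jordan_inside_outside[OF g] Jordan_inside_outside[OF h] by metis
  then have "pathstart g \<in> inside (path_image g)"
    using gh pathstart_in_path_image[of g] by auto
  then show False
    using inside_no_overlap[of "path_image g"] pathstart_in_path_image[of g] by blast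
qed

section \<open>A periodic orbit fills the limit set\<close>

context pb_flow
begin

text \<open>Starting close to \<open>q\<close>, \<open>u\<close> remains for a long time where
  \<open>D < r\<close>, since \<open>D\<close> vanishes along the orbit of \<open>q\<close>. When
  \<open>D\<close> next reaches \<open>r\<close>, a long backward piece of the orbit lies in
  \<open>D \<le> r\<close>; compactness turns arbitrarily long pieces into a whole backward
  orbit.\<close>

lemma last_exit:
  fixes D :: "'a \<Rightarrow> real"
  assumes D: "continuous_on UNIV D" and inv: "\<And>t. D (\<phi> t q) = 0"
    and q: "q \<in> \<Omega> u" and p: "p \<in> \<Omega> u" "D p > r" and r: "r > 0"
  obtains w where "w \<in> \<Omega> u" "D w = r" "\<And>t. t \<ge> 0 \<Longrightarrow> D (\<phi> (- t) w) \<le> r"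
proof -
  have contD: "continuous_on A (\<lambda>s. D (\<phi> (f s) x))" if "continuous_on A f" for A :: "real set" and f x
    by (intro continuous_on_compose2[OF D] continuous_intros that) auto
  let ?F = "\<lambda>N::real. {x. D x = r \<and> (\<forall>t\<in>{0..N}. D (\<phi> (- t) x) \<le> r)} \<inter> closure ((\<lambda>s. \<phi> s u) ` {N..})"
  have "(\<Inter>N. ?F N) \<noteq> {}"
  proof (rule Inter_antimono_closed_nonempty[OF compact_UNIV])
    fix N
    have "{x. D x = r \<and> (\<forall>t\<in>{0..N}. D (\<phi> (- t) x) \<le> r)} =
        {x. D x = r} \<inter> (\<Inter>t\<in>{0..N}. {x. D (\<phi> (- t) x) \<le> r})"
      by auto
    moreover have "closed \<dots>"
      by (intro closed_Int closed_INT ballI closed_Collect_eq closed_Collect_le continuous_intros D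
          continuous_on_compose2[OF D]) auto
    ultimately show "closed (?F N)" by (intro closed_Int) auto
    show "?F N \<noteq> {}"
    proof -
      \<comment> \<open>The maximum with \<open>0\<close> also makes sense of negative
        \<open>N\<close>, with a nonempty interval of times.\<close>
      define N' where "N' = max N 0"
      let ?W = "{(x, t). D (\<phi> t x) < r}"
      have "open ?W"
        unfolding case_prod_unfold
        by (intro open_Collect_less continuous_intros continuous_on_compose2[OF D]) auto
      moreover have "{q} \<times> {0..N'} \<subseteq> ?W" using inv r by auto
      ultimately obtain V where V: "q \<in> V" "open V" "V \<times> {0..N'} \<subseteq> ?W"
        using Elementary_Topology.tube_lemma[of "{0..N'}" ?W q] by auto
      obtain a where a: "a \<ge> N'" "\<phi> a u \<in> V"
        using cluster_setD[OF q V(2,1)] by blast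
      have stay: "D (\<phi> s u) < r" if "a \<le> s" "s \<le> a + N'" for s
      proof -
        have "(\<phi> a u, s - a) \<in> V \<times> {0..N'}" using a that by auto
        then have "(\<phi> a u, s - a) \<in> ?W" using V(3) by blast
        then show ?thesis by simp
      qed
      have "open {x. r < D x}" by (intro open_Collect_less continuous_intros D)
      from cluster_setD[OF p(1) this, of a] p(2)
      obtain b where b: "b \<ge> a" "D (\<phi> b u) > r" by auto
      let ?E = "{s \<in> {a..b}. r \<le> D (\<phi> s u)}"
      have "compact ?E"
      proof -
        have "closed {s. r \<le> D (\<phi> s u)}"
          by (intro closed_Collect_le contD continuous_intros)
        then have "compact ({a..b} \<inter> {s. r \<le> D (\<phi> s u)})" by (intro compact_Int_closed) auto
        then show ?thesis by (simp add: Int_def)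
      qed
      moreover have "b \<in> ?E" using b by auto
      ultimately obtain e where e: "e \<in> ?E" "\<And>s. s \<in> ?E \<Longrightarrow> e \<le> s"
        using compact_attains_inf[of ?E] by blast
      have before: "D (\<phi> s u) < r" if "a \<le> s" "s < e" for s
      proof (rule ccontr)
        assume "\<not> D (\<phi> s u) < r"
        then have "s \<in> ?E" using that e(1) by auto
        then show False using e(2) that by force
      qed
      \<comment> \<open>The level is reached after the stay near the orbit of \<open>q\<close>, so
        the backward orbit from \<open>e\<close> remains below it for a time of at least
        \<open>N'\<close>.\<close>
      have e_gt: "e > a + N'"
        using stay[of e] e(1) by (force simp: not_less)
      have "D (\<phi> a u) < r" using stay[of a] a(1) by (simp add: N'_def)
      have "D (\<phi> e u) = r"
      proof (rule ccontr)
        assume ne: "D (\<phi> e u) \<noteq> r"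
        obtain s where "a \<le> s" "s \<le> e" "D (\<phi> s u) = r"
          using IVT'[of "\<lambda>s. D (\<phi> s u)" a r e] \<open>D (\<phi> a u) < r\<close> e(1) contD[OF continuous_on_id] by auto
        then show False using before[of s] ne by (cases "s = e") auto
      qed
      moreover have "D (\<phi> (- t) (\<phi> e u)) \<le> r" if "t \<in> {0..N}" for t
      proof (cases "t = 0")
        case False
        then have "D (\<phi> (e - t) u) < r"
          using that e_gt by (intro before) (auto simp: N'_def)
        then show ?thesis by simp
      qed (use \<open>D (\<phi> e u) = r\<close> in simp)
      moreover have "\<phi> e u \<in> closure ((\<lambda>s. \<phi> s u) ` {N..})"
        using e_gt a(1) by (intro subsetD[OF closure_subset] imageI) (auto simp: N'_def)
      ultimately show ?thesis by blast
    qed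
    show "?F N \<subseteq> ?F M" if "M \<le> N" for M
    proof -
      have "closure ((\<lambda>s. \<phi> s u) ` {N..}) \<subseteq> closure ((\<lambda>s. \<phi> s u) ` {M..})"
        using that by (intro closure_mono image_mono) auto
      then show ?thesis using that by auto
    qed
  qed
  then obtain w where w: "\<And>N. w \<in> ?F N" by blast
  show thesis
  proof (rule that[of w])
    show "w \<in> \<Omega> u" using w by (auto simp: cluster_set_def)
    show "D w = r" using w[of 0] by auto
    show "D (\<phi> (- t) w) \<le> r" if "t \<ge> 0" for t
      using w[of t] that by auto
  qed
qed

text \<open>A point \<open>p\<close> off the orbit of \<open>q\<close> would make \<open>u\<close>
  leave its neighbourhoods again and again, and \<open>last_exit\<close> yields a nearby periodic
  orbit of some \<open>w\<close>. This winds around \<open>z0\<close>, so it encloses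
  \<open>z0\<close>. For \<open>p\<close> inside \<open>G\<close> the two curves would lie inside
  each other; for \<open>p\<close> outside, \<open>p\<close> would be enclosed by the thin curve
  near \<open>G\<close>.\<close>

lemma cluster_set_periodic_orbit:
  assumes q: "q \<in> \<Omega> u" "q \<notin> equilibria \<phi>" "T > 0" "\<phi> T q = q"
  shows "\<Omega> u \<subseteq> orbit \<phi> q"
proof (rule ccontr)
  assume "\<not> \<Omega> u \<subseteq> orbit \<phi> q"
  then obtain p where p: "p \<in> \<Omega> u" "p \<notin> orbit \<phi> q" by blast
  obtain T0 where T0: "T0 > 0" "\<phi> T0 q = q" "\<And>t. 0 < t \<Longrightarrow> t < T0 \<Longrightarrow> \<phi> t q \<noteq> q"
    using minimal_period[OF q(2-4)] by metis
  define g where "g = (\<lambda>t. P (\<phi> t q))"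
  define \<gamma> where "\<gamma> = arc_between g 0 T0"
  define G where "G = P ` orbit \<phi> q"
  have contP: "continuous_on A (\<lambda>t. P (\<phi> t x))" for A x
    by (intro continuous_on_compose2[OF continuous_P] continuous_intros) auto
  have \<gamma>: "simple_path \<gamma>" "pathfinish \<gamma> = pathstart \<gamma>" "path_image \<gamma> = G"
    using periodic_orbit_simple_path[OF q(1) T0] by (auto simp: \<gamma>_def g_def G_def)
  note J = Jordan_inside_outside[OF \<gamma>(1,2), unfolded \<gamma>(3)]
  have closed_G: "closed G" "G \<noteq> {}"
    using \<gamma>(1) closed_path_image[OF simple_path_imp_path] path_image_nonempty[of \<gamma>] by (auto simp flip: \<gamma>(3))
  have off_G: "P x \<notin> G" if "x \<in> \<Omega> u" "x \<notin> orbit \<phi> q" for x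
  proof
    assume "P x \<in> G"
    then obtain y where y: "y \<in> orbit \<phi> q" "P x = P y" by (auto simp: G_def)
    then show False
      using periodic_orbit_pairs[OF q(1,3,4) that(1) y(1)] P_eq[OF y(2)] that(2) by blast
  qed
  define D where "D = (\<lambda>x. infdist (P x) G)"
  have D: "continuous_on UNIV D"
    unfolding D_def by (intro continuous_intros continuous_P)
  have D_0: "D x = 0" if "x \<in> orbit \<phi> q" for x
    using that by (auto simp: D_def G_def)
  have D_pos: "D x > 0" if "x \<in> \<Omega> u" "x \<notin> orbit \<phi> q" for x
    unfolding D_def using off_G[OF that] closed_G
    by (simp add: infdist_pos_not_in_closed)
  \<comment> \<open>The point around which winding numbers are taken is the projection of
    \<open>p\<close> whenever that lies inside \<open>G\<close>.\<close>
  obtain z0 where z0: "z0 \<in> inside G" "P p \<in> inside G \<Longrightarrow> z0 = P p"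
    using J by (cases "P p \<in> inside G") auto
  have z0_G: "z0 \<notin> G" using z0(1) inside_no_overlap[of G] by blast
  define \<delta> where "\<delta> = infdist z0 G"
  have \<delta>: "\<delta> > 0" unfolding \<delta>_def using z0_G closed_G by (simp add: infdist_pos_not_in_closed)
  \<comment> \<open>Points of this open set shadow a full turn of the periodic orbit with an error
    below the distance from \<open>z0\<close> to \<open>G\<close>.\<close>
  define O1 where "O1 = {x. \<exists>\<theta>. \<exists>V. open V \<and> x \<in> V \<and> (\<forall>y\<in>V. \<forall>s\<in>{0..T0}. dist (P (\<phi> s y)) (P (\<phi> s (\<phi> \<theta> q))) < \<delta>)}"
  have "open O1"
    unfolding O1_def by (subst open_subopen) blast
  have "orbit \<phi> q \<subseteq> O1"
  proof
    fix x assume "x \<in> orbit \<phi> q"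
    then obtain \<theta> where "x = \<phi> \<theta> q" by (auto simp: orbit_def)
    then show "x \<in> O1"
      unfolding O1_def using nbhd_shadowing[OF continuous_P \<delta>, of "\<phi> \<theta> q" 0 T0] by blast
  qed
  have orbit_E: "orbit \<phi> q \<inter> equilibria \<phi> = {}"
  proof -
    have False if "\<phi> a q \<in> equilibria \<phi>" for a
    proof -
      have "\<phi> s q = q" for s
      proof -
        have "\<phi> s (\<phi> a q) = \<phi> a q" using that by (auto simp: equilibria_def)
        then have "\<phi> (- a) (\<phi> s (\<phi> a q)) = \<phi> (- a) (\<phi> a q)" by (rule arg_cong)
        then show ?thesis by simp
      qed
      then show False using q(2) by (simp add: equilibria_def)
    qed
    then show ?thesis by (auto simp: orbit_def)
  qed
  \<comment> \<open>On the limit set \<open>D\<close> vanishes on the orbit of \<open>q\<close> and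
    nowhere else, so by compactness it has a positive lower bound off the open set
    \<open>O1 - equilibria \<phi>\<close>.\<close>
  obtain d0 where d0: "d0 > 0" "\<And>x. x \<in> \<Omega> u \<Longrightarrow> D x < d0 \<Longrightarrow> x \<in> O1 \<and> x \<notin> equilibria \<phi>"
  proof (cases "\<Omega> u - (O1 - equilibria \<phi>) = {}")
    case True
    then show thesis using that[of 1] by auto
  next
    case False
    have "open (O1 - equilibria \<phi>)" using \<open>open O1\<close> closed_equilibria by (rule open_Diff)
    then have "compact (\<Omega> u - (O1 - equilibria \<phi>))"
      by (intro compact_closed closed_Diff closed_cluster_set)
    then obtain x where x: "x \<in> \<Omega> u - (O1 - equilibria \<phi>)" "\<And>y. y \<in> \<Omega> u - (O1 - equilibria \<phi>) \<Longrightarrow> D x \<le> D y"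
      using continuous_attains_inf[OF _ False continuous_on_subset[OF D]] by blast
    have "D x > 0"
      using D_pos[of x] x(1) \<open>orbit \<phi> q \<subseteq> O1\<close> orbit_E by blast
    then show thesis using that[of "D x"] x(2) by force
  qed
  obtain B where B: "B > 0" "\<And>x. norm (P x) < B"
  proof -
    have "bounded (range P)"
      by (intro compact_imp_bounded compact_continuous_image continuous_P compact_UNIV)
    then obtain B where B: "B > 0" "range P \<subseteq> ball 0 B"
      using bounded_subset_ballD by blast
    have "norm (P x) < B" for x using subsetD[OF B(2), of "P x"] by simp
    then show thesis using that[of B] B(1) by blast
  qed
  \<comment> \<open>This point stands for infinity: it is outside every set projected from the
    space.\<close>
  define far where "far = complex_of_real B"
  have far: "far \<in> outside (P ` A)" for A
  proof -
    have "P ` A \<subseteq> ball 0 B" using B(2) by auto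
    then have "- ball 0 B \<subseteq> outside (P ` A)"
      by (intro outside_subset_convex convex_ball)
    then show ?thesis using B(1) by (auto simp: far_def)
  qed
  \<comment> \<open>If \<open>p\<close> projects outside \<open>G\<close>, a path from there to
    \<open>far\<close> keeps a positive distance from \<open>G\<close>.\<close>
  obtain dp where dp: "dp > 0" "P p \<in> outside G \<Longrightarrow>
    \<exists>C. connected C \<and> P p \<in> C \<and> far \<in> C \<and> (\<forall>y\<in>C. dp \<le> infdist y G)"
  proof (cases "P p \<in> outside G")
    case True
    have "path_connected (outside G)"
      using J connected_open_path_connected by blast
    then obtain h where h: "path h" "path_image h \<subseteq> outside G" "pathstart h = P p" "pathfinish h = far"
      using True far[of "orbit \<phi> q"] unfolding path_connected_def G_def by blast
    have "continuous_on (path_image h) (\<lambda>y. infdist y G)" by (intro continuous_intros)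
    then obtain y where y: "y \<in> path_image h" "\<And>x. x \<in> path_image h \<Longrightarrow> infdist y G \<le> infdist x G"
      using continuous_attains_inf[OF compact_path_image[OF h(1)] path_image_nonempty] by blast
    have "y \<notin> G" using y(1) h(2) outside_no_overlap[of G] by blast
    then have "infdist y G > 0" using closed_G by (simp add: infdist_pos_not_in_closed)
    then show thesis
      using that[of "infdist y G"] connected_path_image[OF h(1)] h(3,4) y(2)
        pathstart_in_path_image[of h] pathfinish_in_path_image[of h] by metis
  qed (use that[of 1] in auto)
  \<comment> \<open>The nearby orbit must shadow that of \<open>q\<close> and avoid equilibria, stay
    away from \<open>p\<close>, and miss the path to \<open>far\<close>; halving makes all
    inequalities strict.\<close>
  define r where "r = min d0 (min (D p) dp) / 2"
  have r: "r > 0" "r < d0" "r < D p" "r < dp"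
    using d0(1) dp(1) D_pos[OF p] by (auto simp: r_def min_def)
  have "D (\<phi> t q) = 0" for t by (rule D_0) (auto simp: orbit_def)
  then obtain w where w: "w \<in> \<Omega> u" "D w = r" "\<And>t. t \<ge> 0 \<Longrightarrow> D (\<phi> (- t) w) \<le> r"
    using last_exit[OF D _ q(1) p(1) r(3,1)] by metis
  have w_E: "w \<notin> equilibria \<phi>" using d0(2)[OF w(1)] w(2) r(2) by simp
  obtain x where x: "x \<in> cluster_set (\<lambda>s. \<phi> (- s) w)"
    using cluster_set_nonempty[OF compact_UNIV] by blast
  have "cluster_set (\<lambda>s. \<phi> (- s) w) \<subseteq> {x. D x \<le> r}"
    by (rule cluster_set_subset_closed[of _ 0]) (use w(3) D in \<open>auto intro!: closed_Collect_le continuous_intros\<close>)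
  moreover have "x \<in> \<Omega> u"
    using x reverse_cluster_set_subset closure_orbit_subset_cluster_set[OF w(1)] by blast
  ultimately have "x \<notin> equilibria \<phi>" using d0(2)[of x] x r(2) by auto
  then obtain T' where T': "T' > 0" "\<phi> T' w = w"
    using periodic_if_limit_not_equilibrium[OF w(1), of x] x by blast
  obtain T1 where T1: "T1 > 0" "\<phi> T1 w = w" "\<And>t. 0 < t \<Longrightarrow> t < T1 \<Longrightarrow> \<phi> t w \<noteq> w"
    using minimal_period[OF w_E T'] by metis
  define v where "v = (\<lambda>t. P (\<phi> t w))"
  define \<gamma>' where "\<gamma>' = arc_between v 0 T1"
  define G' where "G' = P ` orbit \<phi> w"
  have \<gamma>': "simple_path \<gamma>'" "pathfinish \<gamma>' = pathstart \<gamma>'" "path_image \<gamma>' = G'"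
    using periodic_orbit_simple_path[OF w(1) T1] by (auto simp: \<gamma>'_def v_def G'_def)
  have closed_G': "closed G'"
    using \<gamma>'(1) closed_path_image[OF simple_path_imp_path] by (auto simp flip: \<gamma>'(3))
  \<comment> \<open>Every point of a periodic orbit is also reached in backward time, so the bound
    on the backward orbit holds everywhere.\<close>
  have D_w: "D y \<le> r" if y: "y \<in> orbit \<phi> w" for y
  proof -
    obtain s where s: "y = \<phi> s w" using y by (auto simp: orbit_def)
    have "\<phi> (- (t + T1)) w = \<phi> (- t) w" for t
    proof -
      have "\<phi> (- (t + T1)) (\<phi> T1 w) = \<phi> (- t) w" by (simp del: flow_inj) 
      then show ?thesis using T1(2) by simp
    qed
    then obtain t where "0 \<le> t" "\<phi> (- (- s)) w = \<phi> (- t) w"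
      using periodic_reduce[of "\<lambda>t. \<phi> (- t) w" T1 "- s"] T1(1) by metis
    then show ?thesis using w(3)[of t] s by simp
  qed
  have orbit_w: "y \<in> \<Omega> u" "y \<notin> orbit \<phi> q" if y: "y \<in> orbit \<phi> w" for y
  proof -
    show "y \<in> \<Omega> u" using y orbit_subset_cluster_set[OF w(1)] by blast
    obtain s where s: "y = \<phi> s w" using y by (auto simp: orbit_def)
    show "y \<notin> orbit \<phi> q"
    proof
      assume "y \<in> orbit \<phi> q"
      then have "\<phi> (- s) y \<in> orbit \<phi> q" by (rule flow_in_orbit)
      then have "w \<in> orbit \<phi> q" by (simp add: s)
      then show False using D_0 w(2) r(1) by auto
    qed
  qed
  have w_off: "w \<notin> orbit \<phi> q" using orbit_w(2)[OF self_in_orbit] .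
  have p_off: "p \<notin> orbit \<phi> w" using D_w r(3) by force
  have q_off: "y \<notin> orbit \<phi> w" if "y \<in> orbit \<phi> q" for y
    using orbit_w(2) that by blast
  \<comment> \<open>If \<open>z0\<close> is not the projection of \<open>p\<close>, then no point of
    the orbit of \<open>w\<close> projects inside \<open>G\<close>, since it is on the same side as
    \<open>p\<close>.\<close>
  have z0_G': "z0 \<notin> G'"
  proof (cases "P p \<in> inside G")
    case True
    have "P p \<noteq> P y" if "y \<in> orbit \<phi> w" for y
      using periodic_orbit_pairs[OF w(1) T' p(1) that] P_eq that p_off by blast
    then show ?thesis using z0(2)[OF True] by (auto simp: G'_def)
  next
    case False
    have "P y \<notin> inside G" if "y \<in> orbit \<phi> w" for y
      using periodic_orbit_same_side[OF q(1,3,4) orbit_w[OF that] p] False by (auto simp: G_def)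
    then show ?thesis using z0(1) by (auto simp: G'_def)
  qed
  \<comment> \<open>Outside \<open>G'\<close> the winding number would vanish, although the orbit of
    \<open>w\<close> shadows turns of a loop with winding number \<open>1\<close> or
    \<open>-1\<close> around \<open>z0\<close>.\<close>
  have "z0 \<in> inside G'"
  proof (rule ccontr)
    assume "z0 \<notin> inside G'"
    then have "z0 \<in> outside (path_image \<gamma>')"
      using z0_G' inside_Un_outside[of G'] \<gamma>'(3) by blast
    then have "winding_number \<gamma>' z0 = 0"
      by (rule winding_number_zero_in_outside[OF simple_path_imp_path[OF \<gamma>'(1)] \<gamma>'(2)])
    moreover obtain \<iota> :: real where "winding_number \<gamma> z0 = of_real \<iota>" "\<bar>\<iota>\<bar> = 1"
    proof -
      have "winding_number \<gamma> z0 = of_real 1 \<or> winding_number \<gamma> z0 = of_real (- 1)"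
        using simple_closed_path_winding_number_inside[OF \<gamma>(1)] z0(1) \<gamma>(3)
        by (metis of_real_1 of_real_minus)
      then show thesis using that[of 1] that[of "- 1"] by auto
    qed
    moreover have "winding_number (arc_between v 0 T1) z0 \<noteq> 0" if "winding_number (arc_between g 0 T0) z0 = of_real \<iota>" "\<bar>\<iota>\<bar> = 1" for \<iota>
    proof (rule winding_number_shadowing_nonzero[OF _ _ T0(1) _ _ _ T1(1) _ that])
      show "continuous_on UNIV g" "continuous_on UNIV v"
        unfolding g_def v_def by (rule contP)+
      show "g (t + T0) = g t" for t
        using flow_flow[of t T0 q] T0(2) by (simp add: g_def)
      show "v (t + T1) = v t" for t
        using flow_flow[of t T1 w] T1(2) by (simp add: v_def)
      have gG: "g t \<in> G" for t by (auto simp: g_def G_def orbit_def)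
      then show "g t \<noteq> z0" for t using z0_G by metis
      show "\<exists>\<theta>. \<forall>s\<in>{0..T0}. dist (v (t + s)) (g (\<theta> + s)) < dist (g (\<theta> + s)) z0" for t
      proof -
        have wt: "\<phi> t w \<in> orbit \<phi> w" by (auto simp: orbit_def)
        have "\<phi> t w \<in> O1" using d0(2)[OF orbit_w(1)[OF wt]] D_w[OF wt] r(2) by auto
        then obtain \<theta> where \<theta>: "\<And>s. s \<in> {0..T0} \<Longrightarrow> dist (P (\<phi> s (\<phi> t w))) (P (\<phi> s (\<phi> \<theta> q))) < \<delta>"
          unfolding O1_def by blast
        have "dist (v (t + s)) (g (\<theta> + s)) < dist (g (\<theta> + s)) z0" if "s \<in> {0..T0}" for s
        proof -
          have "\<delta> \<le> dist z0 (g (\<theta> + s))" unfolding \<delta>_def by (rule infdist_le[OF gG])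
          then show ?thesis using \<theta>[OF that] by (simp add: v_def g_def add.commute dist_commute)
        qed
        then show ?thesis by blast
      qed
    qed
    ultimately show False by (auto simp: \<gamma>_def \<gamma>'_def)
  qed
  show False
  proof (cases "P p \<in> inside G")
    case True
    have "G' \<subseteq> inside G"
      using periodic_orbit_same_side[OF q(1,3,4) p orbit_w] True by (auto simp: G_def G'_def)
    moreover have "G \<subseteq> inside G'"
    proof
      fix y assume "y \<in> G"
      then obtain x where x: "x \<in> orbit \<phi> q" "y = P x" by (auto simp: G_def)
      have "P p \<in> inside G'" using \<open>z0 \<in> inside G'\<close> z0(2)[OF True] by simp
      moreover have "x \<in> \<Omega> u" using x(1) orbit_subset_cluster_set[OF q(1)] by blast
      ultimately show "y \<in> inside G'"
        using periodic_orbit_same_side[OF w(1) T' p(1) p_off _ q_off[OF x(1)]] x(2) by (simp add: G'_def)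
    qed
    ultimately show False
      using not_mutually_inside[OF \<gamma>(1,2) \<gamma>'(1,2)] \<gamma>(3) \<gamma>'(3) by simp
  next
    case False
    then have "P p \<in> outside G"
      using off_G[OF p] inside_Un_outside[of G] by blast
    then obtain C where C: "connected C" "P p \<in> C" "far \<in> C" "\<And>y. y \<in> C \<Longrightarrow> dp \<le> infdist y G"
      using dp(2) by blast
    have G'_in: "P y \<notin> inside G" if "y \<in> orbit \<phi> w" for y
      using periodic_orbit_same_side[OF q(1,3,4) orbit_w[OF that] p] False by (auto simp: G_def)
    have "closure (inside G) = inside G \<union> G"
      using J closure_Un_frontier[of "inside G"] by auto
    then have conn: "connected (inside G \<union> G)"
      using connected_imp_connected_closure[of "inside G"] J by simp
    \<comment> \<open>This connected set contains \<open>z0\<close> and misses \<open>G'\<close>.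
      Hence \<open>q\<close> projects inside \<open>G'\<close>, and so does \<open>p\<close>, being
      on the same side of it.\<close>
    have "inside G \<union> G \<subseteq> inside G'"
    proof (rule connected_subset_inside[OF closed_G' conn])
      show "(inside G \<union> G) \<inter> G' = {}"
        using G'_in off_G orbit_w by (force simp: G'_def)
    qed (use z0(1) \<open>z0 \<in> inside G'\<close> in auto)
    moreover have "P q \<in> G" using self_in_orbit by (auto simp: G_def)
    ultimately have "P q \<in> inside G'" by blast
    then have "P p \<in> inside G'"
      using periodic_orbit_same_side[OF w(1) T' q(1) q_off[OF self_in_orbit] p(1) p_off] by (simp add: G'_def)
    \<comment> \<open>\<open>G'\<close> stays within \<open>r\<close> of \<open>G\<close> and
      \<open>C\<close> at distance at least \<open>dp > r\<close>, so \<open>C\<close> would connect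
      \<open>p\<close> to \<open>far\<close> inside \<open>G'\<close>.\<close>
    moreover have "C \<inter> G' = {}"
    proof -
      have "infdist (P y) G \<le> r" if "y \<in> orbit \<phi> w" for y
        using D_w[OF that] by (simp add: D_def)
      then show ?thesis using C(4) r(4) by (force simp: G'_def)
    qed
    ultimately have "far \<in> inside G'"
      using connected_subset_inside[OF closed_G' C(1) _ C(2)] C(3) by blast
    then show False
      using far[of "orbit \<phi> w"] inside_Int_outside[of G'] unfolding G'_def by blast
  qed
qed

section \<open>The dichotomy and its time reversal\<close>

lemma periodic_point_in_omega_limit:
  assumes "T > 0" "\<phi> T w = w"
  shows "w \<in> omega_limit \<phi> w"
proof -
  have "filterlim (\<lambda>n. real n * T) at_top sequentially"
    using assms(1) filterlim_real_sequentially filterlim_tendsto_pos_mult_at_top[of "\<lambda>_. T" T sequentially real]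
    by (simp add: mult.commute)
  then show ?thesis
    unfolding omega_limit_def using flow_period_nat[OF assms(2)]
    by (intro CollectI exI[of _ "\<lambda>n. real n * T"]) simp
qed

text \<open>Sequential limit points are cluster points, so the results above confine the limit set
  to one periodic orbit; \<open>inv\<close> gives the reverse inclusion. The alternatives exclude
  each other because a periodic point lies in its own limit set.\<close>

lemma omega_limit_dichotomy:
  assumes inv: "\<And>s. \<phi> s ` omega_limit \<phi> u = omega_limit \<phi> u"
  shows "periodic_orbit \<phi> (omega_limit \<phi> u) \<or> limits_in_equilibria \<phi> (omega_limit \<phi> u)"
    and "\<not> (periodic_orbit \<phi> (omega_limit \<phi> u) \<and> limits_in_equilibria \<phi> (omega_limit \<phi> u))"
proof -
  interpret R: compact_flow "\<lambda>s. \<phi> (- s)" by (rule reverse)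
  show "periodic_orbit \<phi> (omega_limit \<phi> u) \<or> limits_in_equilibria \<phi> (omega_limit \<phi> u)"
  proof (rule disjCI)
    assume "\<not> limits_in_equilibria \<phi> (omega_limit \<phi> u)"
    then obtain w x where w: "w \<in> omega_limit \<phi> u"
      and x: "x \<in> omega_limit \<phi> w \<union> alpha_limit \<phi> w" "x \<notin> equilibria \<phi>"
      unfolding limits_in_equilibria_def by blast
    have w\<Omega>: "w \<in> \<Omega> u" using w omega_limit_subset_cluster_set by blast
    have x\<Omega>: "x \<in> \<Omega> w \<union> cluster_set (\<lambda>s. \<phi> (- s) w)"
      using x(1) omega_limit_subset_cluster_set[of \<phi> w] omega_limit_subset_cluster_set[of "\<lambda>s. \<phi> (- s)" w]
      unfolding alpha_limit_eq by blast
    obtain T where T: "T > 0" "\<phi> T w = w"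
      using periodic_if_limit_not_equilibrium[OF w\<Omega> x\<Omega> x(2)] by blast
    have "w \<notin> equilibria \<phi>"
    proof
      assume "w \<in> equilibria \<phi>"
      then have orbit: "orbit \<phi> w = {w}" by (auto simp: orbit_def equilibria_def)
      have "x \<in> closure (orbit \<phi> w)"
        using x\<Omega> cluster_set_subset_closure_orbit reverse_cluster_set_subset by blast
      then show False using x(2) \<open>w \<in> equilibria \<phi>\<close> orbit by simp
    qed
    then have "\<Omega> u \<subseteq> orbit \<phi> w"
      using cluster_set_periodic_orbit[OF w\<Omega> _ T] by blast
    then have "omega_limit \<phi> u \<subseteq> orbit \<phi> w"
      using omega_limit_subset_cluster_set by blast
    moreover have "orbit \<phi> w \<subseteq> omega_limit \<phi> u"
      using w inv by (auto simp: orbit_def)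
    ultimately show "periodic_orbit \<phi> (omega_limit \<phi> u)"
      unfolding periodic_orbit_def using \<open>w \<notin> equilibria \<phi>\<close> T by blast
  qed
  show "\<not> (periodic_orbit \<phi> (omega_limit \<phi> u) \<and> limits_in_equilibria \<phi> (omega_limit \<phi> u))"
  proof
    assume *: "periodic_orbit \<phi> (omega_limit \<phi> u) \<and> limits_in_equilibria \<phi> (omega_limit \<phi> u)"
    then obtain w T where w: "omega_limit \<phi> u = orbit \<phi> w" "w \<notin> equilibria \<phi>" "T > 0" "\<phi> T w = w"
      unfolding periodic_orbit_def by blast
    then have "w \<in> omega_limit \<phi> u" using self_in_orbit by blast
    then have "omega_limit \<phi> w \<subseteq> equilibria \<phi>"
      using * unfolding limits_in_equilibria_def by blast
    then show False using periodic_point_in_omega_limit[OF w(3,4)] w(2) by blast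
  qed
qed

end

lemma equilibria_reverse: "equilibria (\<lambda>s. \<phi> (- s)) = equilibria (\<phi> :: real \<Rightarrow> 'a \<Rightarrow> 'a)"
  unfolding equilibria_def by (metis minus_minus)

lemma orbit_reverse: "orbit (\<lambda>s. \<phi> (- s)) x = orbit (\<phi> :: real \<Rightarrow> 'a \<Rightarrow> 'a) x"
  unfolding orbit_def by (auto simp: image_iff) (metis minus_minus)+

lemma limits_in_equilibria_reverse:
  fixes \<phi> :: "real \<Rightarrow> 'a::topological_space \<Rightarrow> 'a"
  shows "limits_in_equilibria (\<lambda>s. \<phi> (- s)) L \<longleftrightarrow> limits_in_equilibria \<phi> L"
  unfolding limits_in_equilibria_def alpha_limit_eq equilibria_reverse by auto

lemma (in compact_flow) periodic_orbit_reverse: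
  "periodic_orbit (\<lambda>s. \<phi> (- s)) L \<longleftrightarrow> periodic_orbit \<phi> L"
proof -
  have "\<phi> (- T) x = x \<longleftrightarrow> \<phi> T x = x" for T x
    using flow_inj[of T "\<phi> (- T) x" x] by auto
  then show ?thesis
    unfolding periodic_orbit_def equilibria_reverse orbit_reverse by simp
qed

theorem theorem3p1:
  fixes \<phi> :: "real \<Rightarrow> 'a::t2_space \<Rightarrow> 'a"
    and S :: "('a \<times> 'a) set"
    and W :: "'a \<times> 'a \<Rightarrow> int"
    and \<pi> :: "'a \<Rightarrow> real ^ 2"
    and u :: 'a
  assumes "compact (UNIV :: 'a set)"
    and "continuous_flow \<phi>"
    and "\<And>v. regular_limit_set \<phi> (omega_limit \<phi> v)"
    and "\<And>v. regular_limit_set \<phi> (alpha_limit \<phi> v)"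
    and "closed S" and "Id \<subseteq> S"
    and "axiom_A1 S W"
    and "axiom_A2 \<pi>"
    and "axiom_A3 S \<pi>"
    and "axiom_A4 \<phi> S"
    and "axiom_A5 \<phi> S W"
  shows "(periodic_orbit \<phi> (omega_limit \<phi> u) \<or> limits_in_equilibria \<phi> (omega_limit \<phi> u)) \<and>
         \<not> (periodic_orbit \<phi> (omega_limit \<phi> u) \<and> limits_in_equilibria \<phi> (omega_limit \<phi> u)) \<and>
         (periodic_orbit \<phi> (alpha_limit \<phi> u) \<or> limits_in_equilibria \<phi> (alpha_limit \<phi> u)) \<and>
         \<not> (periodic_orbit \<phi> (alpha_limit \<phi> u) \<and> limits_in_equilibria \<phi> (alpha_limit \<phi> u))"
proof -
  define P where "P = (\<lambda>x. Complex (\<pi> x $ 1) (\<pi> x $ 2))"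
  have P: "continuous_on UNIV P"
    using assms(8) unfolding P_def axiom_A2_def Complex_eq by (intro continuous_intros)
  have P_eq: "(x, y) \<in> S" if "P x = P y" for x y
  proof -
    have "\<pi> x = \<pi> y" using that by (simp add: P_def vec_eq_iff forall_2)
    then show ?thesis using assms(9) by (auto simp: axiom_A3_def)
  qed
  interpret F: pb_flow \<phi> S W P
    by unfold_locales (use assms P P_eq in auto)
  \<comment> \<open>The statement on the alpha limit set is the one on the omega limit set of the
    reversed flow.\<close>
  interpret R: pb_flow "\<lambda>s. \<phi> (- s)" S "\<lambda>p. - W p" P
    by (rule F.reverse_pb)
  have inv: "\<phi> s ` omega_limit \<phi> u = omega_limit \<phi> u" "\<phi> s ` alpha_limit \<phi> u = alpha_limit \<phi> u" for s
    using assms(3,4) by (auto simp: regular_limit_set_def)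
  show ?thesis
    using F.omega_limit_dichotomy[OF inv(1)] R.omega_limit_dichotomy[of u] inv(2)
    unfolding alpha_limit_eq limits_in_equilibria_reverse F.periodic_orbit_reverse by blast
qed

end
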